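(* Let $(W,S)$ be the Weyl group of a Kac--Moody group, let $I_1\subseteq S$ be a subset of type $E_7$, and put $I_2=\{s\in S\mid ss'=s's\text{ for all }s'\in I_1\}$ and $I=I_1\cup I_2$. Let $f:H_{I_2}\to\mathbb Z[\mathbf q^{\pm1}]$ be a $\mathbb Z[\mathbf q^{\pm1}]$-linear function which vanishes on $[H_{I_2},H_{I_2}]$. Then the function $$F:H\to\mathbb Z[\mathbf q^{\pm1}],\qquad h\mapsto\sum_{(v_1,v_2)\text{ valid}}\mathbf q^{-\ell(v_1)-\ell(v_2)}f(T_{v_2})\,\tau\bigl(T_{(v_1v_2w_{0,I_1})^{-1}}\,h\,T_{v_1}\bigr)$$ is well defined, i.e. the sum has only finitely many non-zero terms for each $h\in H$. It satisfies: (1) $F(h)=0$ for all $h\in[H,H]$; thus $F$ induces a map $\overline H\to\mathbb Z[\mathbf q^{\pm1}]$. (2) For $w\in W$, we have $F(T_w)\equiv f(T_{w_2})\pmod{\mathbf q-1}$ for any element $w_2\in W_{I_2}$ such that $w_{0,I_1}w_2$ is $W$-conjugate to $w$. If no such element $w_2$ exists, then $F(T_w)\equiv0\pmod{\mathbf q-1}$.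
   Context: $(W,S)$ is a crystallographic Coxeter system ($S$ finite) attached to a Kac--Moody root datum, with real roots $\Phi=\Phi^+\sqcup\Phi^-$ and length $\ell$. For $K\subseteq S$, $W_K$ is the subgroup generated by $K$ and $W^K=\{w\in W\mid ws>w\ \forall s\in K\}$. If $W_K$ is finite, $w_{0,K}$ is its longest element; if moreover $K$ is irreducible, $\theta_K$ is the highest root of the positive system $\Phi_K^+=\Phi^+\cap\sum_{s\in K}\mathbb Z\alpha_s$. "$K$ of type $X$" means $(W_K,K)$ has Dynkin type $X$. $\operatorname{supp}(v)$ is the set of simple reflections occurring in a reduced expression of $v$. A valid pair is a tuple $(v_1,v_2)\in W^I\times W_{I_2}$ such that for every $J$ with $\#J=8$, $I_1\subsetneq J\subseteq S$, $J$ of type $E_8$, and every element of $J$ commuting with every element of $\operatorname{supp}(v_2)$, we have $v_1\theta_J\in\Phi^+$. $H$ is the $\mathbb Z[\mathbf q^{\pm1}]$-algebra with generators $T_s$ ($s\in S$), relations $(T_s+1)(T_s-\mathbf q)=0$ and the braid relations, with standard basis $\{T_w\}_{w\in W}$; $H_{I_2}$ is the Hecke algebra of $(W_{I_2},I_2)$, the span of $T_w$, $w\in W_{I_2}$. $[H,H]$ denotes the span of commutators, $\overline H=H/[H,H]$. $\tau:H\to\mathbb Z[\mathbf q^{\pm1}]$ is the linear map with $\tau(T_1)=1$ and $\tau(T_w)=0$ for $w\neq1$. *)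

theory Defs
  imports "HOL-Library.Poly_Mapping" "HOL-Library.FuncSet" "HOL-Algebra.QuotRing"
begin

section \<open>Kac--Moody root data, Weyl groups and real roots\<close>

text \<open>The set \<open>S\<close> of simple reflections is the universe of a finite type \<open>'s\<close>. The character and
  cocharacter lattices are \<open>\<int>\<^sup>r\<close> with the standard perfect pairing; a basis of any free abelian group
  of finite rank reduces the general case to this one. The simple roots need not be linearly
  independent.\<close>

definition generalized_cartan_matrix :: "('s \<Rightarrow> 's \<Rightarrow> int) \<Rightarrow> bool" where
  "generalized_cartan_matrix A \<longleftrightarrow>
     (\<forall>s. A s s = 2) \<and>
     (\<forall>s t. s \<noteq> t \<longrightarrow> A s t \<le> 0) \<and>
     (\<forall>s t. A s t = 0 \<longleftrightarrow> A t s = 0)"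

definition kac_moody_root_datum ::
  "('s::finite \<Rightarrow> 's \<Rightarrow> int) \<Rightarrow> ('s \<Rightarrow> 'r::finite \<Rightarrow> int) \<Rightarrow> ('s \<Rightarrow> 'r \<Rightarrow> int) \<Rightarrow> bool" where
  "kac_moody_root_datum A alpha coalpha \<longleftrightarrow>
     generalized_cartan_matrix A \<and>
     (\<forall>s t. (\<Sum>i\<in>UNIV. coalpha s i * alpha t i) = A s t)"

text \<open>\<open>W\<close> is realised by its faithful action on the root lattice \<open>\<Oplus>\<^sub>s \<int>\<alpha>\<^sub>s\<close>, whose elements
  are written as coefficient functions \<open>'s \<Rightarrow> int\<close>; the action is
  \<open>s(\<alpha>\<^sub>t) = \<alpha>\<^sub>t - \<langle>\<alpha>\<^sub>t, \<alpha>\<^sub>s\<^sup>\<or>\<rangle> \<alpha>\<^sub>s = \<alpha>\<^sub>t - A s t \<alpha>\<^sub>s\<close>. Working with formal combinations keeps roots,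
  positivity and the sublattices \<open>\<Sum>\<^sub>s\<^sub>\<in>\<^sub>K \<int>\<alpha>\<^sub>s\<close> meaningful when the simple roots are dependent
  characters.\<close>

type_synonym 's weyl_elt = "('s \<Rightarrow> int) \<Rightarrow> ('s \<Rightarrow> int)"

definition simple_root :: "'s \<Rightarrow> 's \<Rightarrow> int" where
  "simple_root s = (\<lambda>u. if u = s then 1 else 0)"

definition simple_refl :: "('s::finite \<Rightarrow> 's \<Rightarrow> int) \<Rightarrow> 's \<Rightarrow> 's weyl_elt" where
  "simple_refl A s = (\<lambda>x u. x u - (\<Sum>t\<in>UNIV. A s t * x t) * simple_root s u)"

definition word_prod :: "('s::finite \<Rightarrow> 's \<Rightarrow> int) \<Rightarrow> 's list \<Rightarrow> 's weyl_elt" where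
  "word_prod A ss = foldr (\<lambda>s w. simple_refl A s \<circ> w) ss id"

text \<open>Simple reflections are involutions, so the products of words in \<open>K\<close> form the subgroup \<open>W\<^sub>K\<close>
  generated by \<open>K\<close>.\<close>

definition parabolic :: "('s::finite \<Rightarrow> 's \<Rightarrow> int) \<Rightarrow> 's set \<Rightarrow> 's weyl_elt set" where
  "parabolic A K = {word_prod A ss | ss. set ss \<subseteq> K}"

definition weyl_group :: "('s::finite \<Rightarrow> 's \<Rightarrow> int) \<Rightarrow> 's weyl_elt set" where
  "weyl_group A = parabolic A UNIV"

definition len :: "('s::finite \<Rightarrow> 's \<Rightarrow> int) \<Rightarrow> 's weyl_elt \<Rightarrow> nat" where
  "len A w = (LEAST n. \<exists>ss. word_prod A ss = w \<and> length ss = n)"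

definition reduced_word :: "('s::finite \<Rightarrow> 's \<Rightarrow> int) \<Rightarrow> 's weyl_elt \<Rightarrow> 's list \<Rightarrow> bool" where
  "reduced_word A w ss \<longleftrightarrow> word_prod A ss = w \<and> length ss = len A w"

definition supp :: "('s::finite \<Rightarrow> 's \<Rightarrow> int) \<Rightarrow> 's weyl_elt \<Rightarrow> 's set" where
  "supp A w = {s. \<exists>ss. reduced_word A w ss \<and> s \<in> set ss}"

text \<open>\<open>W\<^sup>K\<close>: for a simple reflection \<open>s\<close>, \<open>ws > w\<close> in the Bruhat order means \<open>\<ell>(ws) > \<ell>(w)\<close>.\<close>

definition min_coset_reps :: "('s::finite \<Rightarrow> 's \<Rightarrow> int) \<Rightarrow> 's set \<Rightarrow> 's weyl_elt set" where
  "min_coset_reps A K = {w \<in> weyl_group A. \<forall>s\<in>K. len A w < len A (w \<circ> simple_refl A s)}"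

definition longest :: "('s::finite \<Rightarrow> 's \<Rightarrow> int) \<Rightarrow> 's set \<Rightarrow> 's weyl_elt" where
  "longest A K = (THE w. w \<in> parabolic A K \<and> (\<forall>u\<in>parabolic A K. len A u \<le> len A w))"

definition conjugate :: "('s::finite \<Rightarrow> 's \<Rightarrow> int) \<Rightarrow> 's weyl_elt \<Rightarrow> 's weyl_elt \<Rightarrow> bool" where
  "conjugate A u w \<longleftrightarrow> (\<exists>x\<in>weyl_group A. w = x \<circ> u \<circ> inv_into UNIV x)"

definition commuting :: "('s::finite \<Rightarrow> 's \<Rightarrow> int) \<Rightarrow> 's \<Rightarrow> 's \<Rightarrow> bool" where
  "commuting A s t \<longleftrightarrow> simple_refl A s \<circ> simple_refl A t = simple_refl A t \<circ> simple_refl A s"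

definition real_roots :: "('s::finite \<Rightarrow> 's \<Rightarrow> int) \<Rightarrow> ('s \<Rightarrow> int) set" where
  "real_roots A = {w (simple_root s) | w s. w \<in> weyl_group A}"

definition pos_roots :: "('s::finite \<Rightarrow> 's \<Rightarrow> int) \<Rightarrow> ('s \<Rightarrow> int) set" where
  "pos_roots A = {b \<in> real_roots A. \<forall>s. 0 \<le> b s}"

definition pos_roots_in :: "('s::finite \<Rightarrow> 's \<Rightarrow> int) \<Rightarrow> 's set \<Rightarrow> ('s \<Rightarrow> int) set" where
  "pos_roots_in A K = {b \<in> pos_roots A. \<forall>s. s \<notin> K \<longrightarrow> b s = 0}"

definition highest_root :: "('s::finite \<Rightarrow> 's \<Rightarrow> int) \<Rightarrow> 's set \<Rightarrow> 's \<Rightarrow> int" where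
  "highest_root A K = (THE b. b \<in> pos_roots_in A K \<and> (\<forall>c\<in>pos_roots_in A K. \<forall>s. c s \<le> b s))"

text \<open>Bourbaki labelling of \<open>E\<^sub>n\<close>: the chain \<open>1 - 3 - 4 - 5 - \<dots> - n\<close> with \<open>2\<close> attached to \<open>4\<close>.\<close>

definition E_edge :: "nat \<Rightarrow> nat \<Rightarrow> bool" where
  "E_edge i j \<longleftrightarrow> {i, j} \<in> {{1,3}, {2,4}, {3,4}, {4,5}, {5,6}, {6,7}, {7,8}}"

definition type_E :: "nat \<Rightarrow> ('s \<Rightarrow> 's \<Rightarrow> int) \<Rightarrow> 's set \<Rightarrow> bool" where
  "type_E n A K \<longleftrightarrow>
     (\<exists>b. bij_betw b {1..n} K \<and>
       (\<forall>i\<in>{1..n}. \<forall>j\<in>{1..n}.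
          A (b i) (b j) = (if i = j then 2 else if E_edge i j then -1 else 0)))"

definition commutant :: "('s::finite \<Rightarrow> 's \<Rightarrow> int) \<Rightarrow> 's set \<Rightarrow> 's set" where
  "commutant A K = {s. \<forall>t\<in>K. commuting A s t}"

definition valid_pairs ::
  "('s::finite \<Rightarrow> 's \<Rightarrow> int) \<Rightarrow> 's set \<Rightarrow> ('s weyl_elt \<times> 's weyl_elt) set" where
  "valid_pairs A I\<^sub>1 =
     {(v\<^sub>1, v\<^sub>2).
        v\<^sub>1 \<in> min_coset_reps A (I\<^sub>1 \<union> commutant A I\<^sub>1) \<and>
        v\<^sub>2 \<in> parabolic A (commutant A I\<^sub>1) \<and>
        (\<forall>J. card J = 8 \<and> I\<^sub>1 \<subset> J \<and> type_E 8 A J \<and>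
             (\<forall>s\<in>J. \<forall>t\<in>supp A v\<^sub>2. commuting A s t)
           \<longrightarrow> v\<^sub>1 (highest_root A J) \<in> pos_roots A)}"


section \<open>The Iwahori--Hecke algebra\<close>

text \<open>\<open>\<int>[q\<^sup>\<plusminus>\<^sup>1]\<close> is the group ring of \<open>\<int>\<close>, and the free associative algebra over it is the monoid
  ring of the free monoid. The free monoid gets a type of its own because \<^type>\<open>poly_mapping\<close> expects
  the monoid operation on exponents to be written as addition.\<close>

type_synonym laurent = "int \<Rightarrow>\<^sub>0 int"

definition qpow :: "int \<Rightarrow> laurent" where
  "qpow n = Poly_Mapping.single n 1"

abbreviation qvar :: laurent where
  "qvar \<equiv> qpow 1"

datatype 's free_monoid = Word "'s list"

instantiation free_monoid :: (type) monoid_add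
begin

definition "0 = Word []"

fun plus_free_monoid :: "'a free_monoid \<Rightarrow> 'a free_monoid \<Rightarrow> 'a free_monoid" where
  "plus_free_monoid (Word u) (Word v) = Word (u @ v)"

instance
proof
  fix a b c :: "'a free_monoid"
  show "a + b + c = a + (b + c)"
    by (cases a; cases b; cases c) simp
  show "0 + a = a"
    by (cases a) (simp add: zero_free_monoid_def)
  show "a + 0 = a"
    by (cases a) (simp add: zero_free_monoid_def)
qed

end

type_synonym 's falg = "'s free_monoid \<Rightarrow>\<^sub>0 laurent"

definition free_alg :: "'s falg ring" where
  "free_alg = \<lparr>carrier = UNIV, mult = (*), one = 1, zero = 0, add = (+)\<rparr>"

definition word_monomial :: "'s list \<Rightarrow> 's falg" where
  "word_monomial ss = Poly_Mapping.single (Word ss) 1"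

definition scalar :: "laurent \<Rightarrow> 's falg" where
  "scalar c = Poly_Mapping.single 0 c"

fun alternating :: "nat \<Rightarrow> 's \<Rightarrow> 's \<Rightarrow> 's list" where
  "alternating 0 s t = []"
| "alternating (Suc n) s t = s # alternating n t s"

text \<open>\<open>m\<close> is the (finite) order of \<open>st\<close> in \<open>W\<close>.\<close>

definition braid_order :: "('s::finite \<Rightarrow> 's \<Rightarrow> int) \<Rightarrow> 's \<Rightarrow> 's \<Rightarrow> nat \<Rightarrow> bool" where
  "braid_order A s t m \<longleftrightarrow>
     0 < m \<and> (simple_refl A s \<circ> simple_refl A t) ^^ m = id \<and>
     (\<forall>k. 0 < k \<and> k < m \<longrightarrow> (simple_refl A s \<circ> simple_refl A t) ^^ k \<noteq> id)"

definition hecke_relators :: "('s::finite \<Rightarrow> 's \<Rightarrow> int) \<Rightarrow> 's falg set" where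
  "hecke_relators A =
     {(word_monomial [s] + 1) * (word_monomial [s] - scalar qvar) | s. True} \<union>
     {word_monomial (alternating m s t) - word_monomial (alternating m t s) | s t m. s \<noteq> t \<and> braid_order A s t m}"

definition hecke_ideal :: "('s::finite \<Rightarrow> 's \<Rightarrow> int) \<Rightarrow> 's falg set" where
  "hecke_ideal A = Idl\<^bsub>free_alg\<^esub> (hecke_relators A)"

definition hecke :: "('s::finite \<Rightarrow> 's \<Rightarrow> int) \<Rightarrow> 's falg set ring" where
  "hecke A = free_alg Quot (hecke_ideal A)"

definition hecke_class :: "('s::finite \<Rightarrow> 's \<Rightarrow> int) \<Rightarrow> 's falg \<Rightarrow> 's falg set" where
  "hecke_class A x = hecke_ideal A +>\<^bsub>free_alg\<^esub> x"

definition hecke_smult ::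
  "('s::finite \<Rightarrow> 's \<Rightarrow> int) \<Rightarrow> laurent \<Rightarrow> 's falg set \<Rightarrow> 's falg set" where
  "hecke_smult A c h = hecke_class A (scalar c) \<otimes>\<^bsub>hecke A\<^esub> h"

text \<open>The standard basis element \<open>T\<^sub>w\<close> is the product of generators along a reduced word of \<open>w\<close>; by
  Matsumoto's theorem the choice is irrelevant.\<close>

definition hecke_T :: "('s::finite \<Rightarrow> 's \<Rightarrow> int) \<Rightarrow> 's weyl_elt \<Rightarrow> 's falg set" where
  "hecke_T A w = hecke_class A (word_monomial (SOME ss. reduced_word A w ss))"

inductive_set hecke_span ::
  "('s::finite \<Rightarrow> 's \<Rightarrow> int) \<Rightarrow> 's falg set set \<Rightarrow> 's falg set set"
  for A :: "'s::finite \<Rightarrow> 's \<Rightarrow> int" and X :: "'s falg set set" where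
  zero: "\<zero>\<^bsub>hecke A\<^esub> \<in> hecke_span A X"
| step: "x \<in> X \<Longrightarrow> y \<in> hecke_span A X \<Longrightarrow> hecke_smult A c x \<oplus>\<^bsub>hecke A\<^esub> y \<in> hecke_span A X"

definition hecke_parabolic :: "('s::finite \<Rightarrow> 's \<Rightarrow> int) \<Rightarrow> 's set \<Rightarrow> 's falg set set" where
  "hecke_parabolic A K = hecke_span A (hecke_T A ` parabolic A K)"

definition commutator_span ::
  "('s::finite \<Rightarrow> 's \<Rightarrow> int) \<Rightarrow> 's falg set set \<Rightarrow> 's falg set set" where
  "commutator_span A M =
     hecke_span A {x \<otimes>\<^bsub>hecke A\<^esub> y \<ominus>\<^bsub>hecke A\<^esub> y \<otimes>\<^bsub>hecke A\<^esub> x | x y. x \<in> M \<and> y \<in> M}"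

definition laurent_linear_on ::
  "('s::finite \<Rightarrow> 's \<Rightarrow> int) \<Rightarrow> 's falg set set \<Rightarrow> ('s falg set \<Rightarrow> laurent) \<Rightarrow> bool" where
  "laurent_linear_on A M g \<longleftrightarrow>
     (\<forall>x\<in>M. \<forall>y\<in>M. g (x \<oplus>\<^bsub>hecke A\<^esub> y) = g x + g y) \<and>
     (\<forall>c. \<forall>x\<in>M. g (hecke_smult A c x) = c * g x)"

text \<open>Extensionality fixes the irrelevant values outside \<open>H\<close>, so that \<open>\<tau>\<close> is unique as a HOL
  function.\<close>

definition tau :: "('s::finite \<Rightarrow> 's \<Rightarrow> int) \<Rightarrow> 's falg set \<Rightarrow> laurent" where
  "tau A = (THE g. g \<in> extensional (carrier (hecke A)) \<and>
                   laurent_linear_on A (carrier (hecke A)) g \<and>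
                   (\<forall>w\<in>weyl_group A. g (hecke_T A w) = (if w = id then 1 else 0)))"

fun F_term ::
  "('s::finite \<Rightarrow> 's \<Rightarrow> int) \<Rightarrow> 's set \<Rightarrow> ('s falg set \<Rightarrow> laurent) \<Rightarrow> 's falg set
     \<Rightarrow> 's weyl_elt \<times> 's weyl_elt \<Rightarrow> laurent" where
  "F_term A I\<^sub>1 f h (v\<^sub>1, v\<^sub>2) =
     qpow (- int (len A v\<^sub>1) - int (len A v\<^sub>2)) * f (hecke_T A v\<^sub>2) *
     tau A (hecke_T A (inv_into UNIV (v\<^sub>1 \<circ> v\<^sub>2 \<circ> longest A I\<^sub>1)) \<otimes>\<^bsub>hecke A\<^esub> h \<otimes>\<^bsub>hecke A\<^esub> hecke_T A v\<^sub>1)"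

text \<open>The sum over all valid pairs is taken over its non-zero terms; it is meaningful once this
  support is finite.\<close>

definition F_support ::
  "('s::finite \<Rightarrow> 's \<Rightarrow> int) \<Rightarrow> 's set \<Rightarrow> ('s falg set \<Rightarrow> laurent) \<Rightarrow> 's falg set
     \<Rightarrow> ('s weyl_elt \<times> 's weyl_elt) set" where
  "F_support A I\<^sub>1 f h = {p \<in> valid_pairs A I\<^sub>1. F_term A I\<^sub>1 f h p \<noteq> 0}"

definition trace_F ::
  "('s::finite \<Rightarrow> 's \<Rightarrow> int) \<Rightarrow> 's set \<Rightarrow> ('s falg set \<Rightarrow> laurent) \<Rightarrow> 's falg set \<Rightarrow> laurent" where
  "trace_F A I\<^sub>1 f h = (\<Sum>p\<in>F_support A I\<^sub>1 f h. F_term A I\<^sub>1 f h p)"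

end

theory Submission
  imports Defs "HOL-Library.Function_Algebras"
begin

text \<open>Moving factors cyclically inside \<open>\<tau>\<close>, the summand of \<open>(v\<^sub>1,v\<^sub>2)\<close> becomes a scalar times \<open>\<tau>(h k)\<close>
  with \<open>k = T\<^bsub>v\<^sub>1\<^esub> T\<^bsub>w\<^sub>0v\<^sub>2\<^sup>-\<^sup>1\<^esub> T\<^bsub>v\<^sub>1\<^sup>-\<^sup>1\<^esub>\<close>. For \<open>F(T\<^sub>s h) = F(h T\<^sub>s)\<close> the valid pairs are grouped
  according to \<open>s\<close>. If \<open>sv\<^sub>1 \<in> W\<^sup>I\<close>, then the contributions of \<open>(v\<^sub>1,v\<^sub>2)\<close> and \<open>(sv\<^sub>1,v\<^sub>2)\<close> cancel when both
  pairs are valid; when only the first is, \<open>v\<^sub>1\<theta>\<^sub>J = \<alpha>\<^sub>s\<close> for some \<open>J\<close>, and \<open>k\<close> commutes with \<open>T\<^sub>s\<close> because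
  \<open>T\<close> of the longest element of \<open>W\<^sub>J\<close> is central in \<open>H\<^sub>J\<close>. Otherwise \<open>sv\<^sub>1 = v\<^sub>1t\<close> with \<open>t \<in> I\<close>, and the
  contributions of the double coset of \<open>v\<^sub>2\<close> modulo \<open>\<langle>t\<rangle>\<close> cancel because \<open>f\<close> is a trace.

  Finiteness and the congruence rest on the injectivity of \<open>(v\<^sub>1,v\<^sub>2) \<mapsto> v\<^sub>1v\<^sub>2w\<^sub>0v\<^sub>1\<^sup>-\<^sup>1\<close> on valid pairs: a
  product of simple reflections contributes only through its finitely many subproducts, and at
  \<open>q = 1\<close> exactly the valid pair lying over \<open>w\<close> survives. Involutions of the valid pairs that lift
  conjugation by simple reflections reduce injectivity to pairs lying over some \<open>v\<^sub>2w\<^sub>0\<close>. There a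
  minimal double coset representative mapping \<open>I\<^sub>1\<close> to simple roots is trivial or makes some \<open>\<theta>\<^sub>J\<close>
  negative, which validity forbids.\<close>

text \<open>Without validity \<open>wt\<close> is not injective. If \<open>insert j I1\<close> has
  type E8 and its elements commute with the support of \<open>v2\<close>, then \<open>w0\<close> and
  \<open>v2\<close> both fix the highest root \<open>theta j\<close>. So
  \<open>v2 \<circ> w0\<close> commutes with the reflection r in \<open>theta j\<close>, and
  \<open>v1\<close> and \<open>v1 \<circ> r\<close> conjugate it to the same element. Validity
  selects the factor that keeps \<open>theta j\<close> positive. No other neighbour of
  \<open>I1\<close> causes such a collision: for \<open>j\<close> outside \<open>I1\<close> and
  \<open>I2\<close>, the projection of \<open>\<alpha> j\<close> orthogonal to \<open>I1\<close> is
  antidominant for \<open>insert j I1\<close> unless \<open>j\<close> extends \<open>I1\<close> to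
  E8. The Cartan matrix may be non-symmetrizable. Orthogonality is therefore expressed by pairings
  with simple coroots, and the role of an invariant form is taken by the fact that an antidominant
  vector can only increase under the Weyl group. The Hecke algebra is handled through functions on
  the Weyl group: left and right multiplication by generators are operators on functions, their
  commutation stands for associativity, and \<open>tau\<close> becomes evaluation at the
  identity.\<close>

definition smul :: "'b::times \<Rightarrow> ('a \<Rightarrow> 'b) \<Rightarrow> 'a \<Rightarrow> 'b"  (infixr "\<cdot>" 75) where
  "c \<cdot> x = (\<lambda>u. c * x u)"

lemma smul_apply: "(c \<cdot> x) u = c * x u"
  by (simp add: smul_def)

declare plus_fun_apply [simp del] zero_fun_apply [simp del] minus_apply [simp del] uminus_apply [simp del]

text \<open>Coordinates are unfolded only on demand: with the pointwise rules removed from the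
  simpset, sums and multiples of roots remain vectors.\<close>

lemmas vec = plus_fun_apply zero_fun_apply minus_apply uminus_apply smul_apply

section \<open>The Weyl group acting linearly on the root lattice\<close>

locale gcm =
  fixes A :: "'s::finite \<Rightarrow> 's \<Rightarrow> int"
  assumes gcm: "generalized_cartan_matrix A"
begin

abbreviation "sr \<equiv> simple_refl A"
abbreviation "wp \<equiv> word_prod A"
abbreviation "W \<equiv> weyl_group A"
abbreviation "\<alpha> \<equiv> simple_root"
abbreviation "ell \<equiv> len A"
abbreviation "nn (x :: 's \<Rightarrow> int) \<equiv> \<forall>u. 0 \<le> x u"

text \<open>The pairing of a root lattice vector with the simple coroot of \<open>s\<close>.\<close>

definition pr :: "'s \<Rightarrow> ('s \<Rightarrow> int) \<Rightarrow> int" where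
  "pr s x = (\<Sum>t\<in>UNIV. A s t * x t)"

lemma A_diag [simp]: "A s s = 2"
  and A_off: "s \<noteq> t \<Longrightarrow> A s t \<le> 0"
  and A_zero_sym: "A s t = 0 \<longleftrightarrow> A t s = 0"
  using gcm by (auto simp: generalized_cartan_matrix_def)

lemma pr_add: "pr s (x + y) = pr s x + pr s y"
  and pr_diff: "pr s (x - y) = pr s x - pr s y"
  and pr_uminus: "pr s (- x) = - pr s x"
  and pr_smul: "pr s (c \<cdot> x) = c * pr s x"
  by (simp_all add: pr_def vec algebra_simps sum.distrib sum_subtractf sum_negf sum_distrib_left)

lemma pr_simple [simp]: "pr s (\<alpha> t) = A s t"
  by (simp add: pr_def simple_root_def if_distrib cong: if_cong)

lemma sr_eq: "sr s x = x - pr s x \<cdot> \<alpha> s"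
  by (rule ext) (simp add: simple_refl_def pr_def vec)

lemma sr_simple: "sr s (\<alpha> t) = \<alpha> t - A s t \<cdot> \<alpha> s"
  by (simp add: sr_eq)

lemma sr_simple_self [simp]: "sr s (\<alpha> s) = - \<alpha> s"
  by (rule ext) (simp add: sr_eq vec)

lemma sr_invol [simp]: "sr s (sr s x) = x"
  by (rule ext) (simp add: sr_eq pr_diff pr_smul vec)

lemma sr_comp_self [simp]: "sr s \<circ> sr s = id"
  by auto

lemma sr_comp_self_assoc [simp]: "w \<circ> sr s \<circ> sr s = w" "sr s \<circ> (sr s \<circ> w) = w"
  by (auto simp: fun_eq_iff)

lemma simple_self [simp]: "\<alpha> s s = 1" and simple_other [simp]: "u \<noteq> s \<Longrightarrow> \<alpha> s u = 0"
  by (auto simp: simple_root_def)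

lemma simple_inject [simp]: "\<alpha> s = \<alpha> t \<longleftrightarrow> s = t"
  by (auto simp: simple_root_def fun_eq_iff split: if_splits)

lemma nn_simple: "nn (\<alpha> s)"
  by (simp add: simple_root_def)

lemma sr_coeff [simp]: "u \<noteq> s \<Longrightarrow> sr s x u = x u"
  by (simp add: sr_eq vec)

lemma wp_Nil [simp]: "wp [] = id"
  and wp_Cons [simp]: "wp (s # ss) = sr s \<circ> wp ss"
  by (simp_all add: word_prod_def)

lemma wp_append [simp]: "wp (xs @ ys) = wp xs \<circ> wp ys"
  by (induction xs) (auto simp: comp_assoc)

lemma wp_rev [simp]: "wp (rev ss) \<circ> wp ss = id"
proof (induction ss)
  case (Cons s ss)
  have "wp (rev (s # ss)) \<circ> wp (s # ss) = wp (rev ss) \<circ> (sr s \<circ> sr s) \<circ> wp ss"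
    by (simp add: comp_assoc)
  then show ?case using Cons by simp
qed auto

lemma wp_rev' [simp]: "wp ss \<circ> wp (rev ss) = id"
  using wp_rev[of "rev ss"] by simp

lemma inv_wp: "inv_into UNIV (wp ss) = wp (rev ss)"
  by (rule inv_unique_comp) auto

lemma wp_in_parabolic: "set ss \<subseteq> K \<Longrightarrow> wp ss \<in> parabolic A K"
  by (auto simp: parabolic_def)

lemma wp_in_W [simp]: "wp ss \<in> W"
  by (auto simp: weyl_group_def parabolic_def)

lemma parabolicE:
  assumes "w \<in> parabolic A K"
  obtains ss where "set ss \<subseteq> K" "w = wp ss"
  using assms by (auto simp: parabolic_def)

lemma WE: assumes "w \<in> W" obtains ss where "w = wp ss"
  using assms by (auto simp: weyl_group_def parabolic_def)

lemma parabolic_W: "w \<in> parabolic A K \<Longrightarrow> w \<in> W"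
  by (auto elim: parabolicE)

lemma id_parabolic [simp]: "id \<in> parabolic A K"
  using wp_in_parabolic[of "[]"] by simp

lemma sr_parabolic: "s \<in> K \<Longrightarrow> sr s \<in> parabolic A K"
  using wp_in_parabolic[of "[s]"] by simp

lemma comp_parabolic: "x \<in> parabolic A K \<Longrightarrow> y \<in> parabolic A K \<Longrightarrow> x \<circ> y \<in> parabolic A K"
  by (metis parabolicE set_append sup.boundedI wp_append wp_in_parabolic)

lemma inv_parabolic: "x \<in> parabolic A K \<Longrightarrow> inv_into UNIV x \<in> parabolic A K"
  by (metis inv_wp parabolicE set_rev wp_in_parabolic)

lemma parabolic_mono: "K \<subseteq> L \<Longrightarrow> parabolic A K \<subseteq> parabolic A L"
  by (auto simp: parabolic_def)

lemma id_W [simp]: "id \<in> W" and sr_W [simp]: "sr s \<in> W"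
  and comp_W [simp]: "x \<in> W \<Longrightarrow> y \<in> W \<Longrightarrow> x \<circ> y \<in> W"
  and inv_W [simp]: "x \<in> W \<Longrightarrow> inv_into UNIV x \<in> W"
  unfolding weyl_group_def by (auto simp: sr_parabolic comp_parabolic inv_parabolic)

lemma W_bij: "w \<in> W \<Longrightarrow> bij w"
  by (metis WE o_bij wp_rev wp_rev')

lemma W_inv_left [simp]: "w \<in> W \<Longrightarrow> inv_into UNIV w \<circ> w = id"
  and W_inv_right [simp]: "w \<in> W \<Longrightarrow> w \<circ> inv_into UNIV w = id"
  using W_bij by (auto simp: bij_def surj_iff)

lemma W_inv_left_apply [simp]: "w \<in> W \<Longrightarrow> inv_into UNIV w (w x) = x"
  and W_inv_right_apply [simp]: "w \<in> W \<Longrightarrow> w (inv_into UNIV w x) = x"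
  using W_inv_left W_inv_right by (metis comp_apply id_apply)+

lemma inv_inv_W [simp]: "w \<in> W \<Longrightarrow> inv_into UNIV (inv_into UNIV w) = w"
  by (simp add: W_bij inv_inv_eq)

lemma inv_sr [simp]: "inv_into UNIV (sr s) = sr s"
  by (rule inv_unique_comp) auto

lemma inv_comp: "x \<in> W \<Longrightarrow> y \<in> W \<Longrightarrow> inv_into UNIV (x \<circ> y) = inv_into UNIV y \<circ> inv_into UNIV x"
  by (simp add: W_bij o_inv_distrib)

lemma W_cancel_left: "x \<in> W \<Longrightarrow> x \<circ> y = x \<circ> z \<longleftrightarrow> y = z"
  by (metis W_inv_left comp_assoc fun.map_id0 id_apply id_comp)

lemma W_cancel_right: "x \<in> W \<Longrightarrow> y \<circ> x = z \<circ> x \<longleftrightarrow> y = z"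
  by (metis W_inv_right comp_assoc comp_id)

lemma sr_add: "sr s (x + y) = sr s x + sr s y"
  by (rule ext) (simp add: sr_eq pr_add vec algebra_simps)

lemma sr_smul: "sr s (c \<cdot> x) = c \<cdot> sr s x"
  by (rule ext) (simp add: sr_eq pr_smul vec algebra_simps)

lemma W_linear:
  assumes "w \<in> W"
  shows W_add: "w (x + y) = w x + w y"
    and W_smul: "w (c \<cdot> x) = c \<cdot> w x"
proof -
  obtain ss where w: "w = wp ss" using assms by (rule WE)
  have "wp ss (x + y) = wp ss x + wp ss y"
    by (induction ss) (simp_all only: wp_Nil wp_Cons id_apply comp_apply sr_add)
  moreover have "wp ss (c \<cdot> x) = c \<cdot> wp ss x"
    by (induction ss) (simp_all only: wp_Nil wp_Cons id_apply comp_apply sr_smul)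
  ultimately show "w (x + y) = w x + w y" "w (c \<cdot> x) = c \<cdot> w x" using w by auto
qed

lemma W_uminus: "w \<in> W \<Longrightarrow> w (- x) = - w x"
  using W_smul[of w "-1" x] by (metis (no_types, lifting) ext mult_minus1 smul_apply uminus_apply)

lemma W_diff: "w \<in> W \<Longrightarrow> w (x - y) = w x - w y"
  by (metis W_add W_uminus add_uminus_conv_diff)

lemma W_zero: "w \<in> W \<Longrightarrow> w 0 = 0"
  using W_diff[of w 0 0] by simp

lemma W_sum: "w \<in> W \<Longrightarrow> w (\<Sum>i\<in>X. g i) = (\<Sum>i\<in>X. w (g i))"
  by (induction X rule: infinite_finite_induct) (simp_all add: W_zero W_add)

lemma sum_fun_apply: "(\<Sum>i\<in>X. g i) u = (\<Sum>i\<in>X. g i u)" for g :: "'i \<Rightarrow> 'a \<Rightarrow> 'b::comm_monoid_add"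
  by (induction X rule: infinite_finite_induct) (simp_all add: vec)

lemma W_eq_zero: "w \<in> W \<Longrightarrow> w x = 0 \<longleftrightarrow> x = 0"
  by (metis W_inv_left_apply W_zero)

lemma expand: fixes x :: "'s \<Rightarrow> int" shows "x = (\<Sum>i\<in>UNIV. x i \<cdot> \<alpha> i)"
proof
  fix u
  have "(\<Sum>i\<in>UNIV. x i \<cdot> \<alpha> i) u = (\<Sum>i\<in>UNIV. if i = u then x u else 0)"
    unfolding sum_fun_apply smul_apply by (rule sum.cong) (auto simp: simple_root_def)
  also have "\<dots> = x u" by simp
  finally show "x u = (\<Sum>i\<in>UNIV. x i \<cdot> \<alpha> i) u" by simp
qed

section \<open>Length\<close>

lemma len_le: "wp ss = w \<Longrightarrow> ell w \<le> length ss"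
  unfolding len_def by (rule Least_le) auto

lemma reduced_exists: assumes "w \<in> W" shows "\<exists>ss. reduced_word A w ss"
proof -
  obtain ss where "w = wp ss" using assms by (rule WE)
  then have "\<exists>n ss. wp ss = w \<and> length ss = n" by blast
  then have "\<exists>ss. wp ss = w \<and> length ss = ell w"
    unfolding len_def by (rule LeastI_ex)
  then show ?thesis by (auto simp: reduced_word_def)
qed

lemma len_id [simp]: "ell id = 0"
  using len_le[of "[]" id] by simp

lemma len_eq_0: "w \<in> W \<Longrightarrow> ell w = 0 \<longleftrightarrow> w = id"
  using reduced_exists[of w] by (auto simp: reduced_word_def)

lemma len_comp_le: assumes "x \<in> W" "y \<in> W" shows "ell (x \<circ> y) \<le> ell x + ell y"
proof -
  obtain xs ys where "reduced_word A x xs" "reduced_word A y ys"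
    using assms reduced_exists by blast
  then show ?thesis using len_le[of "xs @ ys" "x \<circ> y"] by (auto simp: reduced_word_def)
qed

lemma len_inv_le: assumes "x \<in> W" shows "ell (inv_into UNIV x) \<le> ell x"
proof -
  obtain xs where "reduced_word A x xs" using assms reduced_exists by blast
  then show ?thesis using len_le[of "rev xs"] by (auto simp: reduced_word_def inv_wp[symmetric])
qed

lemma len_inv [simp]: "x \<in> W \<Longrightarrow> ell (inv_into UNIV x) = ell x"
  using len_inv_le[of x] len_inv_le[of "inv_into UNIV x"] by simp

lemma len_sr_le: "ell (sr s) \<le> 1"
  using len_le[of "[s]"] by simp

lemma len_right_le: "w \<in> W \<Longrightarrow> ell (w \<circ> sr s) \<le> ell w + 1"
  using len_comp_le[of w "sr s"] len_sr_le[of s] by simp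

lemma last_letter:
  assumes "w \<in> W" "w \<noteq> id"
  obtains s where "ell (w \<circ> sr s) < ell w"
proof -
  obtain ss where ss: "reduced_word A w ss" using assms(1) reduced_exists by blast
  then have "ss \<noteq> []" using assms by (auto simp: reduced_word_def)
  then obtain s rs where "ss = rs @ [s]" by (metis rev_exhaust)
  then have "wp rs = w \<circ> sr s" "length rs < ell w" using ss by (auto simp: reduced_word_def)
  then have "ell (w \<circ> sr s) < ell w" using len_le[of rs "w \<circ> sr s"] by simp
  then show ?thesis by (rule that)
qed

section \<open>Rank two\<close>

text \<open>Alternating words read from the end that acts first: a word of positive length ends in
  \<open>t\<close>, so its product applies \<open>sr t\<close> before \<open>sr s\<close>.\<close>

definition ralt :: "nat \<Rightarrow> 's \<Rightarrow> 's \<Rightarrow> 's list" where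
  "ralt n s t = rev (alternating n t s)"

lemma ralt_0 [simp]: "ralt 0 s t = []" and ralt_Suc: "ralt (Suc n) s t = ralt n t s @ [t]"
  by (simp_all add: ralt_def)

lemma ralt_length [simp]: "length (ralt n s t) = n"
  by (induction n arbitrary: s t) (auto simp: ralt_Suc)

lemma ralt_set: "set (ralt n s t) \<subseteq> {s, t}"
  by (induction n arbitrary: s t) (auto simp: ralt_Suc)

lemma ralt_suffix: "\<exists>pre. ralt (j + m) s t = pre @ ralt m s t \<and> length pre = j \<and> set pre \<subseteq> {s, t}"
proof (induction m arbitrary: s t)
  case 0 then show ?case using ralt_set by auto
next
  case (Suc m) then show ?case by (fastforce simp: ralt_Suc)
qed

lemma word_alternating_or_repeats:
  "set ss \<subseteq> {s, t} \<Longrightarrow> (\<exists>n. ss = ralt n s t \<or> ss = ralt n t s) \<or> (\<exists>xs y zs. ss = xs @ y # y # zs)"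
proof (induction ss rule: rev_induct)
  case Nil then show ?case using ralt_0 by metis
next
  case (snoc x ss)
  then have "(\<exists>n. ss = ralt n s t \<or> ss = ralt n t s) \<or> (\<exists>xs y zs. ss = xs @ y # y # zs)" by auto
  then show ?case
  proof (elim disjE exE)
    fix n assume ss: "ss = ralt n s t"
    show ?thesis
    proof (cases "x = t")
      case True
      show ?thesis
      proof (cases n)
        case 0
        then have "ss @ [x] = ralt (Suc 0) s t" using ss True by (simp add: ralt_Suc)
        then show ?thesis by blast
      next
        case (Suc m)
        then have "ss @ [x] = ralt m t s @ t # t # []" using ss True by (simp add: ralt_Suc)
        then show ?thesis by blast
      qed
    next
      case False
      then have "ss @ [x] = ralt (Suc n) t s" using snoc.prems ss by (simp add: ralt_Suc)
      then show ?thesis by blast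
    qed
  next
    fix n assume ss: "ss = ralt n t s"
    show ?thesis
    proof (cases "x = s")
      case True
      show ?thesis
      proof (cases n)
        case 0
        then have "ss @ [x] = ralt (Suc 0) t s" using ss True by (simp add: ralt_Suc)
        then show ?thesis by blast
      next
        case (Suc m)
        then have "ss @ [x] = ralt m s t @ s # s # []" using ss True by (simp add: ralt_Suc)
        then show ?thesis by blast
      qed
    next
      case False
      then have "ss @ [x] = ralt (Suc n) s t" using snoc.prems ss by (simp add: ralt_Suc)
      then show ?thesis by blast
    qed
  next
    fix xs y zs assume "ss = xs @ y # y # zs"
    then have "ss @ [x] = xs @ y # y # (zs @ [x])" by simp
    then show ?thesis by blast
  qed
qed

text \<open>The invariant \<open>2 * b \<le> - A t s * a\<close> says that the vector pairs
  nonpositively with the coroot of the letter applied next, so that reflection does not decrease its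
  coefficient. The bound 4 on the product of the Cartan entries passes the invariant on to the other
  letter.\<close>

lemma ralt_nonneg_infinite:
  assumes "s \<noteq> t" "A s t * A t s \<ge> 4" "a \<ge> 0" "2 * b \<le> - A t s * a"
  shows "\<exists>a' b'. a' \<ge> 0 \<and> b' \<ge> 0 \<and>
           (wp (ralt (Suc n) s t)) (a \<cdot> \<alpha> s + b \<cdot> \<alpha> t) = a' \<cdot> \<alpha> s + b' \<cdot> \<alpha> t"
  using assms
proof (induction n arbitrary: s t a b)
  case 0
  have "b \<le> - A t s * a" using 0 A_off[of t s]
    by (smt (verit, best) mult_minus_left mult_nonpos_nonneg)
  moreover have "sr t (a \<cdot> \<alpha> s + b \<cdot> \<alpha> t) = a \<cdot> \<alpha> s + (- A t s * a - b) \<cdot> \<alpha> t"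
    by (rule ext) (simp add: sr_eq pr_add pr_smul vec algebra_simps)
  ultimately show ?case using 0 by (intro exI[of _ a] exI[of _ "- A t s * a - b"]) (auto simp: ralt_Suc)
next
  case (Suc n)
  define b' where "b' = - A t s * a - b"
  have eq: "sr t (a \<cdot> \<alpha> s + b \<cdot> \<alpha> t) = b' \<cdot> \<alpha> t + a \<cdot> \<alpha> s"
    by (rule ext) (simp add: sr_eq pr_add pr_smul vec algebra_simps b'_def)
  have st: "A s t \<le> 0" "A t s \<le> 0" using A_off Suc.prems by auto
  have b': "b' \<ge> 0" using Suc.prems st unfolding b'_def
    by (smt (verit, best) mult_minus_left mult_nonpos_nonneg)
  have 1: "2 * b' \<ge> - A t s * a" using Suc.prems(4) by (simp add: b'_def mult.commute)
  have "- A s t * (- A t s * a) \<ge> 4 * a"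
    using mult_right_mono[OF Suc.prems(2,3)] by (simp add: algebra_simps)
  moreover have "- A s t * (2 * b') \<ge> - A s t * (- A t s * a)"
    using 1 st by (intro mult_left_mono) auto
  ultimately have "2 * a \<le> - A s t * b'" by simp
  then obtain p q where "p \<ge> 0" "q \<ge> 0"
    "(wp (ralt (Suc n) t s)) (b' \<cdot> \<alpha> t + a \<cdot> \<alpha> s) = p \<cdot> \<alpha> t + q \<cdot> \<alpha> s"
    using Suc.IH[of t s b' a] Suc.prems b' by (auto simp: mult.commute)
  then have "wp (ralt (Suc (Suc n)) s t) (a \<cdot> \<alpha> s + b \<cdot> \<alpha> t) = q \<cdot> \<alpha> s + p \<cdot> \<alpha> t"
    using eq by (simp add: ralt_Suc[of "Suc n"] add.commute)
  then show ?case using \<open>p \<ge> 0\<close> \<open>q \<ge> 0\<close> by blast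
qed

text \<open>A product below 4 leaves, up to transposition, the Cartan matrices of A1 x A1, A2, B2
  and G2, for which \<open>M\<close> is 2, 3, 4 and 6; each is settled by computation.\<close>

lemma finite_rank_two:
  assumes "s \<noteq> t" "A s t * A t s < 4"
  shows "\<exists>M>0. wp (ralt M s t) = wp (ralt M t s) \<and>
           (\<forall>k<M. \<exists>a b. a \<ge> 0 \<and> b \<ge> 0 \<and> wp (ralt k s t) (\<alpha> s) = a \<cdot> \<alpha> s + b \<cdot> \<alpha> t)"
proof -
  define p m where pm: "p = - A s t" "m = - A t s"
  have nn: "p \<ge> 0" "m \<ge> 0" "p = 0 \<longleftrightarrow> m = 0" using A_off A_zero_sym assms(1) pm by auto
  have "p * m < 4" using assms pm by simp
  have A: "A s t = - p" "A t s = - m" using pm by auto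
  have "p < 4"
  proof (rule ccontr)
    assume "\<not> p < 4"
    then have "m \<ge> 1" "p \<ge> 4" using nn by auto
    then show False using \<open>p * m < 4\<close> mult_mono[of 4 p 1 m] by simp
  qed
  have "m < 4"
  proof (rule ccontr)
    assume "\<not> m < 4"
    then have "p \<ge> 1" "m \<ge> 4" using nn by auto
    then show False using \<open>p * m < 4\<close> mult_mono[of 1 p 4 m] by simp
  qed
  have "p \<in> {0,1,2,3}" "m \<in> {0,1,2,3}" using nn \<open>p < 4\<close> \<open>m < 4\<close> by auto
  then have cases: "(p = 0 \<and> m = 0) \<or> (p = 1 \<and> m = 1) \<or> (p = 1 \<and> m = 2) \<or> (p = 2 \<and> m = 1)
      \<or> (p = 1 \<and> m = 3) \<or> (p = 3 \<and> m = 1)"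
    using \<open>p * m < 4\<close> nn by auto
  \<comment> \<open>The braid relation has to hold on every vector. \<open>ph x a b\<close> records
    an arbitrary \<open>x\<close> with its changes in the two relevant coordinates, so both words
    can be evaluated symbolically.\<close>
  define ph where "ph = (\<lambda>x a b. x + a \<cdot> \<alpha> s + b \<cdot> \<alpha> t)"
  have phs: "sr s (ph x a b) = ph x (p * b - a - pr s x) b"
    and pht: "sr t (ph x a b) = ph x a (m * a - b - pr t x)" for x a b
    by (rule ext, simp add: ph_def sr_eq pr_add pr_smul A vec algebra_simps)+
  have ph0: "x = ph x 0 0" for x
    by (rule ext, simp add: ph_def sr_eq vec)+
  have qs: "sr s (a \<cdot> \<alpha> s + b \<cdot> \<alpha> t) = (p * b - a) \<cdot> \<alpha> s + b \<cdot> \<alpha> t"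
    and qt: "sr t (a \<cdot> \<alpha> s + b \<cdot> \<alpha> t) = a \<cdot> \<alpha> s + (m * a - b) \<cdot> \<alpha> t" for a b
    by (rule ext, simp add: sr_eq pr_add pr_smul A vec algebra_simps)+
  have q0: "\<alpha> s = 1 \<cdot> \<alpha> s + 0 \<cdot> \<alpha> t" by (rule ext) (simp add: vec)
  have less: "k < 2 \<Longrightarrow> k = 0 \<or> k = 1" "k < 3 \<Longrightarrow> k = 0 \<or> k = 1 \<or> k = 2"
     "k < 4 \<Longrightarrow> k = 0 \<or> k = 1 \<or> k = 2 \<or> k = 3"
     "k < 6 \<Longrightarrow> k = 0 \<or> k = 1 \<or> k = 2 \<or> k = 3 \<or> k = 4 \<or> k = 5" for k :: nat by auto
  have goal: ?thesis
    if "0 < M" "\<And>x. wp (ralt M s t) (ph x 0 0) = wp (ralt M t s) (ph x 0 0)"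
      "\<And>k. k < M \<Longrightarrow> \<exists>a b. a \<ge> 0 \<and> b \<ge> 0 \<and>
        wp (ralt k s t) (1 \<cdot> \<alpha> s + 0 \<cdot> \<alpha> t) = a \<cdot> \<alpha> s + b \<cdot> \<alpha> t" for M
    using that q0 ph0 by (intro exI[of _ M] conjI ext) auto
  note comp = ralt_Suc eval_nat_numeral phs pht
  note comp2 = ralt_Suc eval_nat_numeral qs qt
  have ex: "\<exists>a\<ge>0. \<exists>b\<ge>0. a' \<cdot> \<alpha> s + b' \<cdot> \<alpha> t = a \<cdot> \<alpha> s + b \<cdot> \<alpha> t"
    if "a' \<ge> 0" "b' \<ge> 0" for a' b' using that by blast
  from cases show ?thesis
  proof (elim disjE conjE)
    assume pm: "p = 0" "m = 0"
    show ?thesis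
      by (rule goal[of 2], simp, simp add: comp pm,
          drule less, elim disjE; simp add: comp2 pm; rule ex; simp)
  next
    assume pm: "p = 1" "m = 1"
    show ?thesis
      by (rule goal[of 3], simp, simp add: comp pm,
          drule less, elim disjE; simp add: comp2 pm; rule ex; simp)
  next
    assume pm: "p = 1" "m = 2"
    show ?thesis
      by (rule goal[of 4], simp, simp add: comp pm,
          drule less, elim disjE; simp add: comp2 pm; rule ex; simp)
  next
    assume pm: "p = 2" "m = 1"
    show ?thesis
      by (rule goal[of 4], simp, simp add: comp pm,
          drule less, elim disjE; simp add: comp2 pm; rule ex; simp)
  next
    assume pm: "p = 1" "m = 3"
    show ?thesis
      by (rule goal[of 6], simp, simp add: comp pm,
          drule less, elim disjE; simp add: comp2 pm; rule ex; simp)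
  next
    assume pm: "p = 3" "m = 1"
    show ?thesis
      by (rule goal[of 6], simp, simp add: comp pm,
          drule less, elim disjE; simp add: comp2 pm; rule ex; simp)
  qed
qed

text \<open>Length with respect to the generators \<open>K\<close>. Its agreement with
  \<open>ell\<close> on \<open>parabolic A K\<close> comes from the exchange condition, which rests
  on \<open>tits\<close>; the proof of \<open>tits\<close> therefore keeps the two lengths
  apart.\<close>

definition lenK :: "'s set \<Rightarrow> 's weyl_elt \<Rightarrow> nat" where
  "lenK K d = (LEAST n. \<exists>ss. set ss \<subseteq> K \<and> wp ss = d \<and> length ss = n)"

lemma lenK_le: "set ss \<subseteq> K \<Longrightarrow> wp ss = d \<Longrightarrow> lenK K d \<le> length ss"
  unfolding lenK_def by (rule Least_le) auto

lemma lenK_word: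
  assumes "d \<in> parabolic A K"
  shows "\<exists>ss. set ss \<subseteq> K \<and> wp ss = d \<and> length ss = lenK K d"
proof -
  obtain ss where "set ss \<subseteq> K" "d = wp ss" using assms by (rule parabolicE)
  then have "\<exists>n ss. set ss \<subseteq> K \<and> wp ss = d \<and> length ss = n" by blast
  then show ?thesis unfolding lenK_def by (rule LeastI_ex)
qed

lemma len_le_lenK: "d \<in> parabolic A K \<Longrightarrow> ell d \<le> lenK K d"
  using lenK_word len_le by metis

text \<open>A shortest word of \<open>d\<close> in the two letters alternates, and it ends in
  \<open>t\<close> because \<open>sr s\<close> does not shorten \<open>d\<close>. In the finite case
  it is shorter than \<open>M\<close>, since otherwise the braid relation would move an
  \<open>s\<close> to its end.\<close>

lemma rank_two_nonneg:
  assumes st: "s \<noteq> t" and d: "d \<in> parabolic A {s, t}"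
    and le: "lenK {s, t} d \<le> lenK {s, t} (d \<circ> sr s)"
  shows "\<exists>a b. a \<ge> 0 \<and> b \<ge> 0 \<and> d (\<alpha> s) = a \<cdot> \<alpha> s + b \<cdot> \<alpha> t"
proof -
  obtain ss where ss: "set ss \<subseteq> {s, t}" "wp ss = d" "length ss = lenK {s, t} d"
    using lenK_word[OF d] by blast
  have "\<not> (\<exists>xs y zs. ss = xs @ y # y # zs)"
  proof
    assume "\<exists>xs y zs. ss = xs @ y # y # zs"
    then obtain xs y zs where eq: "ss = xs @ y # y # zs" by blast
    then have "wp (xs @ zs) = d" using ss(2) by (auto simp: comp_assoc)
    moreover have "set (xs @ zs) \<subseteq> {s, t}" using ss(1) eq by auto
    ultimately have "lenK {s, t} d \<le> length (xs @ zs)" by (intro lenK_le)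
    then show False using ss(3) eq by simp
  qed
  then obtain n where n: "ss = ralt n s t \<or> ss = ralt n t s"
    using word_alternating_or_repeats[OF ss(1)] by blast
  have alt: "ss = ralt n s t"
  proof (rule ccontr)
    assume ne: "ss \<noteq> ralt n s t"
    then have ts: "ss = ralt n t s" using n by blast
    with ne obtain k where k: "n = Suc k" by (cases n) auto
    have "d \<circ> sr s = wp (ralt k s t)" using ss(2)[symmetric] ts k by (simp add: ralt_Suc)
    then have "lenK {s, t} (d \<circ> sr s) \<le> k"
      using lenK_le[of "ralt k s t" "{s, t}"] ralt_set[of k s t] by simp
    then show False using le ss(3) ts k by simp
  qed
  show ?thesis
  proof (cases "A s t * A t s \<ge> 4")
    case True
    show ?thesis
    proof (cases n)
      case 0
      then have "d = id" using alt ss(2) by simp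
      then have "d (\<alpha> s) = 1 \<cdot> \<alpha> s + 0 \<cdot> \<alpha> t" by (auto simp: vec)
      then show ?thesis by (intro exI[of _ 1] exI[of _ 0]) simp
    next
      case (Suc k)
      have "\<alpha> s = 1 \<cdot> \<alpha> s + 0 \<cdot> \<alpha> t" by (rule ext) (simp add: vec)
      moreover have "2 * 0 \<le> - A t s * 1" using A_off[of t s] st by simp
      ultimately show ?thesis
        using ralt_nonneg_infinite[OF st True, of 1 0 k] alt ss(2) Suc by auto
    qed
  next
    case False
    then have "A s t * A t s < 4" by simp
    then obtain M where M: "M > 0" "wp (ralt M s t) = wp (ralt M t s)"
      "\<And>k. k < M \<Longrightarrow> \<exists>a b. a \<ge> 0 \<and> b \<ge> 0 \<and> wp (ralt k s t) (\<alpha> s) = a \<cdot> \<alpha> s + b \<cdot> \<alpha> t"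
      using finite_rank_two[OF st] by blast
    have "n < M"
    proof (rule ccontr)
      assume "\<not> n < M"
      then obtain j where j: "n = j + M" using le_Suc_ex by (metis add.commute not_less)
      obtain pre where pre: "ralt (j + M) s t = pre @ ralt M s t" "length pre = j" "set pre \<subseteq> {s, t}"
        using ralt_suffix by blast
      obtain k where k: "M = Suc k" using M(1) by (cases M) auto
      have "d \<circ> sr s = wp pre \<circ> wp (ralt M t s) \<circ> sr s"
        using ss(2) alt j pre(1) M(2) by simp
      also have "\<dots> = wp (pre @ ralt k s t)" by (simp add: k ralt_Suc comp_assoc)
      finally have "lenK {s, t} (d \<circ> sr s) \<le> length (pre @ ralt k s t)"
        using lenK_le[of "pre @ ralt k s t" "{s, t}"] ralt_set[of k s t] pre(3) by simp
      then show False using le ss(3) alt j k pre(2) by simp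
    qed
    then show ?thesis using M(3) alt ss(2) by blast
  qed
qed

text \<open>Tits' positivity theorem. Write \<open>w\<close> as \<open>v \<circ> d\<close> with
  \<open>d\<close> in the dihedral group of \<open>s\<close> and a descent \<open>t\<close>, and
  \<open>v\<close> as short as possible. By induction \<open>v\<close> keeps
  \<open>\<alpha> s\<close> and \<open>\<alpha> t\<close> positive, and by the rank two case
  \<open>d (\<alpha> s)\<close> is a nonnegative combination of these.\<close>

theorem tits:
  assumes "w \<in> W" "ell w \<le> ell (w \<circ> sr s)"
  shows "nn (w (\<alpha> s))"
  using assms
proof (induction "ell w" arbitrary: w s rule: less_induct)
  case less
  show ?case
  proof (cases "w = id")
    case True then show ?thesis by (simp add: nn_simple)
  next
    case False
    then obtain t where t: "ell (w \<circ> sr t) < ell w" using last_letter less.prems by blast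
    then have st: "s \<noteq> t" using less.prems by auto
    define Q where "Q = (\<lambda>n. \<exists>v d. v \<in> W \<and> d \<in> parabolic A {s, t} \<and> w = v \<circ> d \<and>
       ell w = ell v + lenK {s, t} d \<and> ell v = n)"
    have l1: "lenK {s, t} (sr t) \<le> 1" using lenK_le[of "[t]" "{s, t}"] by simp
    have "ell w = ell (w \<circ> sr t) + lenK {s, t} (sr t)"
    proof -
      have "ell w \<le> ell (w \<circ> sr t) + lenK {s, t} (sr t)"
        using len_comp_le[of "w \<circ> sr t" "sr t"] less.prems(1)
          len_le_lenK[of "sr t" "{s, t}"] sr_parabolic[of t "{s, t}"] by simp
      then show ?thesis using t l1 by linarith
    qed
    then have Q1: "Q (ell (w \<circ> sr t))"
      unfolding Q_def using less.prems(1) sr_parabolic[of t "{s, t}"]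
      by (intro exI[of _ "w \<circ> sr t"] exI[of _ "sr t"]) auto
    define n where "n = (LEAST n. Q n)"
    have "Q n" unfolding n_def using Q1 by (rule LeastI)
    then obtain v d where vd: "v \<in> W" "d \<in> parabolic A {s, t}" "w = v \<circ> d"
       "ell w = ell v + lenK {s, t} d" "ell v = n" unfolding Q_def by blast
    have "n \<le> ell (w \<circ> sr t)" unfolding n_def using Q1 by (rule Least_le)
    then have vw: "ell v < ell w" using t vd(5) by simp
    \<comment> \<open>If \<open>sr u\<close> shortened \<open>v\<close>, moving it into
      \<open>d\<close> would give another length-additive decomposition, with a shorter first
      factor.\<close>
    have vmin: "ell v \<le> ell (v \<circ> sr u)" if u: "u \<in> {s, t}" for u
    proof (rule ccontr)
      assume lt: "\<not> ell v \<le> ell (v \<circ> sr u)"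
      have su: "sr u \<circ> d \<in> parabolic A {s, t}"
        using comp_parabolic sr_parabolic u vd(2) by blast
      have w: "w = (v \<circ> sr u) \<circ> (sr u \<circ> d)" using vd(3) by (simp add: comp_assoc)
      obtain ss where ss: "set ss \<subseteq> {s, t}" "wp ss = d" "length ss = lenK {s, t} d"
        using lenK_word[OF vd(2)] by blast
      have "lenK {s, t} (sr u \<circ> d) \<le> lenK {s, t} d + 1"
        using lenK_le[of "u # ss" "{s, t}"] ss u by auto
      moreover have "ell w \<le> ell (v \<circ> sr u) + lenK {s, t} (sr u \<circ> d)"
        using len_comp_le[of "v \<circ> sr u" "sr u \<circ> d"] w vd(1) su len_le_lenK[OF su]
        by (metis (no_types, lifting) add_left_mono comp_W le_trans parabolic_W sr_W)
      ultimately have "ell w = ell (v \<circ> sr u) + lenK {s, t} (sr u \<circ> d)"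
        using lt vd(4) by linarith
      then have "Q (ell (v \<circ> sr u))" unfolding Q_def using vd(1) su w by (metis comp_W sr_W)
      then have "n \<le> ell (v \<circ> sr u)" unfolding n_def by (rule Least_le)
      then show False using lt vd(5) by simp
    qed
    have "nn (v (\<alpha> s))" "nn (v (\<alpha> t))"
      using less.hyps[OF vw vd(1)] vmin by auto
    moreover have "lenK {s, t} d \<le> lenK {s, t} (d \<circ> sr s)"
    proof (rule ccontr)
      assume lt: "\<not> lenK {s, t} d \<le> lenK {s, t} (d \<circ> sr s)"
      have ds: "d \<circ> sr s \<in> parabolic A {s, t}"
        using comp_parabolic sr_parabolic vd(2) by blast
      have "ell (w \<circ> sr s) \<le> ell v + lenK {s, t} (d \<circ> sr s)"
        using len_comp_le[of v "d \<circ> sr s"] vd(1,3) ds len_le_lenK[OF ds] parabolic_W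
        by (fastforce simp: comp_assoc)
      then show False using lt vd(4) less.prems by simp
    qed
    then obtain a b where "a \<ge> 0" "b \<ge> 0" "d (\<alpha> s) = a \<cdot> \<alpha> s + b \<cdot> \<alpha> t"
      using rank_two_nonneg[OF st vd(2)] by blast
    ultimately show ?thesis using vd(1,3) by (simp add: W_add W_smul vec)
  qed
qed

lemma W_simple_nonzero: "w \<in> W \<Longrightarrow> \<exists>u. w (\<alpha> s) u \<noteq> 0"
proof (rule ccontr)
  assume w: "w \<in> W" and "\<nexists>u. w (\<alpha> s) u \<noteq> 0"
  then have "w (\<alpha> s) = 0" by (auto simp: vec)
  then have "\<alpha> s = 0" using W_eq_zero[OF w] by simp
  then have "\<alpha> s s = 0" by (simp only: zero_fun_apply)
  then show False by simp
qed

lemma not_nn_neg: assumes "w \<in> W" "nn (w (\<alpha> s))" shows "\<not> nn (- w (\<alpha> s))"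
proof
  assume "nn (- w (\<alpha> s))"
  then have "w (\<alpha> s) u = 0" for u using assms(2) by (simp add: vec) (meson antisym)
  then show False using W_simple_nonzero[OF assms(1)] by blast
qed

lemma W_sr_neg: "w \<in> W \<Longrightarrow> (w \<circ> sr s) (\<alpha> s) = - w (\<alpha> s)"
  by (simp add: W_uminus)

lemma len_right_iff:
  assumes w: "w \<in> W"
  shows "ell w < ell (w \<circ> sr s) \<longleftrightarrow> nn (w (\<alpha> s))"
proof
  assume "ell w < ell (w \<circ> sr s)" then show "nn (w (\<alpha> s))" using tits[OF w] by simp
next
  assume nn: "nn (w (\<alpha> s))"
  show "ell w < ell (w \<circ> sr s)"
  proof (rule ccontr)
    assume "\<not> ell w < ell (w \<circ> sr s)"
    then have "nn ((w \<circ> sr s) (\<alpha> s))" using tits[of "w \<circ> sr s" s] w by simp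
    then show False using not_nn_neg[OF w nn] W_sr_neg[OF w] by simp
  qed
qed

lemma len_right_pos: "w \<in> W \<Longrightarrow> nn (w (\<alpha> s)) \<Longrightarrow> ell (w \<circ> sr s) = ell w + 1"
  using len_right_iff[of w s] len_right_le[of w s] by simp

lemma nn_or_neg:
  assumes w: "w \<in> W" shows "nn (w (\<alpha> s)) \<or> nn (- w (\<alpha> s))"
proof (cases "ell w \<le> ell (w \<circ> sr s)")
  case True then show ?thesis using tits[OF w] by simp
next
  case False
  then have "nn ((w \<circ> sr s) (\<alpha> s))" using tits[of "w \<circ> sr s" s] w by simp
  then show ?thesis using W_sr_neg[OF w] by simp
qed

lemma len_right_neg:
  assumes w: "w \<in> W" and "\<not> nn (w (\<alpha> s))"
  shows "ell w = ell (w \<circ> sr s) + 1"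
proof -
  have "nn ((w \<circ> sr s) (\<alpha> s))" using assms nn_or_neg[OF w] W_sr_neg[OF w] by metis
  then show ?thesis using w len_right_pos[of "w \<circ> sr s" s] by simp
qed

lemma nn_all_id: assumes "w \<in> W" "\<And>s. nn (w (\<alpha> s))" shows "w = id"
  using last_letter[OF assms(1)] len_right_iff[OF assms(1)] assms(2) by (metis less_asym)

section \<open>Real roots\<close>

abbreviation "\<Phi> \<equiv> real_roots A"

lemma root_simple [simp]: "\<alpha> s \<in> \<Phi>"
  unfolding real_roots_def using id_W by (metis (mono_tags, lifting) id_apply mem_Collect_eq)

lemma root_W [simp]: "w \<in> W \<Longrightarrow> \<beta> \<in> \<Phi> \<Longrightarrow> w \<beta> \<in> \<Phi>"
  unfolding real_roots_def using comp_W by (smt (verit, ccfv_SIG) comp_apply mem_Collect_eq)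

lemma rootE: assumes "\<beta> \<in> \<Phi>" obtains w s where "w \<in> W" "\<beta> = w (\<alpha> s)"
  using assms by (auto simp: real_roots_def)

lemma root_uminus [simp]: "\<beta> \<in> \<Phi> \<Longrightarrow> - \<beta> \<in> \<Phi>"
  by (metis W_sr_neg comp_W root_W root_simple rootE sr_W)

lemma root_nn_or_neg: "\<beta> \<in> \<Phi> \<Longrightarrow> nn \<beta> \<or> nn (- \<beta>)"
  using nn_or_neg by (metis rootE)

lemma root_not_both: "\<beta> \<in> \<Phi> \<Longrightarrow> nn \<beta> \<Longrightarrow> \<not> nn (- \<beta>)"
  using not_nn_neg by (metis rootE)

lemma root_pos_coeff: assumes "\<beta> \<in> \<Phi>" "\<beta> u > 0" shows "nn \<beta>"
proof -
  have "\<not> nn (- \<beta>)" using assms(2) by (auto simp: vec intro!: exI[of _ u])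
  then show ?thesis using root_nn_or_neg[OF assms(1)] by blast
qed

lemma root_neg_coeff: assumes "\<beta> \<in> \<Phi>" "\<beta> u < 0" shows "nn (- \<beta>)"
  using root_pos_coeff[of "- \<beta>" u] assms by (simp add: vec)

text \<open>Carrying the root back to a simple root exhibits its coefficient at \<open>s\<close> as
  a divisor of 1.\<close>

lemma root_multiple_simple:
  assumes "\<beta> \<in> \<Phi>" "nn \<beta>" "\<And>u. u \<noteq> s \<Longrightarrow> \<beta> u = 0"
  shows "\<beta> = \<alpha> s"
proof -
  obtain w r where w: "w \<in> W" "\<beta> = w (\<alpha> r)" using assms(1) by (rule rootE)
  have b: "\<beta> = \<beta> s \<cdot> \<alpha> s" using assms(3) by (auto simp: vec simple_root_def)
  have "\<alpha> r = inv_into UNIV w (\<beta> s \<cdot> \<alpha> s)" using w b by (metis W_inv_left_apply)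
  also have "\<dots> = \<beta> s \<cdot> inv_into UNIV w (\<alpha> s)" using w(1) by (intro W_smul) simp
  finally have "\<alpha> r r = \<beta> s * inv_into UNIV w (\<alpha> s) r" by (metis smul_apply)
  then have "\<beta> s dvd 1" by (metis dvd_triv_left simple_self)
  then have "\<beta> s = 1" using assms(2) zdvd1_eq[of "\<beta> s"] by (metis abs_of_nonneg)
  then show ?thesis using b by (auto simp: vec)
qed

text \<open>Some coefficient away from \<open>s\<close> is positive and survives the reflection, and
  one positive coefficient decides the sign of a root.\<close>

lemma sr_pos:
  assumes "\<beta> \<in> \<Phi>" "nn \<beta>" "\<beta> \<noteq> \<alpha> s"
  shows "nn (sr s \<beta>)"
proof -
  obtain u where u: "u \<noteq> s" "\<beta> u \<noteq> 0" using root_multiple_simple assms by blast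
  then have "sr s \<beta> u > 0" using assms(2) by (metis sr_coeff order_le_less)
  then show ?thesis using root_pos_coeff assms(1) by (metis root_W sr_W)
qed

text \<open>The letters act from the right end of the word, and by \<open>sr_pos\<close> the sign
  can change only at a letter whose own simple root has been reached.\<close>

lemma exchange_root:
  assumes "\<beta> \<in> \<Phi>" "nn \<beta>" "\<not> nn (wp ss \<beta>)"
  shows "\<exists>xs s ys. ss = xs @ s # ys \<and> wp ys \<beta> = \<alpha> s"
  using assms(3)
proof (induction ss)
  case Nil then show ?case using assms by simp
next
  case (Cons s ss)
  show ?case
  proof (cases "nn (wp ss \<beta>)")
    case True
    have "wp ss \<beta> \<in> \<Phi>" using assms(1) by simp
    then have "wp ss \<beta> = \<alpha> s" using sr_pos[OF _ True] Cons.prems by auto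
    then show ?thesis by (intro exI[of _ "[]"]) auto
  next
    case False
    then show ?thesis using Cons.IH by (metis append_Cons)
  qed
qed

text \<open>The product \<open>g\<close> of the two candidate reflections fixes
  \<open>\<alpha> t\<close> and changes every other simple root by a multiple of
  \<open>\<alpha> t\<close>. So it makes no simple root negative and is the identity. This replaces
  an intrinsic definition of the reflection in a root.\<close>

lemma reflection_eq:
  assumes w: "w \<in> W" "w (\<alpha> s) = \<alpha> t"
  shows "w \<circ> sr s = sr t \<circ> w"
proof -
  define g where "g = w \<circ> sr s \<circ> inv_into UNIV w \<circ> sr t"
  have gW: "g \<in> W" using w by (simp add: g_def)
  have inv: "inv_into UNIV w (\<alpha> t) = \<alpha> s" using w by (metis W_inv_left_apply)
  have iW: "inv_into UNIV w \<in> W" using w by simp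
  have g: "\<exists>c. g x = x + c \<cdot> \<alpha> t" for x
  proof -
    define y where "y = inv_into UNIV w (sr t x)"
    have wy: "w y = sr t x" using w by (simp add: y_def)
    have "g x = w (y - pr s y \<cdot> \<alpha> s)" by (simp add: g_def y_def sr_eq)
    also have "\<dots> = sr t x - pr s y \<cdot> \<alpha> t" using w wy by (simp add: W_diff[OF w(1)] W_smul[OF w(1)])
    also have "\<dots> = x + (- pr t x - pr s y) \<cdot> \<alpha> t"
      by (rule ext) (simp add: sr_eq vec algebra_simps)
    finally show ?thesis by blast
  qed
  have "nn (g (\<alpha> u))" for u
  proof (cases "u = t")
    case True
    have "g (\<alpha> t) = \<alpha> t" using w inv
      by (simp add: g_def W_uminus[OF iW] W_uminus[OF w(1)] W_uminus[OF sr_W])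
    then show ?thesis using True nn_simple by simp
  next
    case False
    obtain c where "g (\<alpha> u) = \<alpha> u + c \<cdot> \<alpha> t" using g by blast
    then have "g (\<alpha> u) u = 1" using False by (simp add: vec)
    then show ?thesis using root_pos_coeff[of "g (\<alpha> u)" u] gW by simp
  qed
  then have "g = id" using nn_all_id[OF gW] by blast
  then have "w \<circ> sr s \<circ> inv_into UNIV w = sr t"
    unfolding g_def by (metis sr_comp_self_assoc(1) id_comp)
  then show ?thesis using w by (metis W_inv_left comp_assoc comp_id)
qed

lemma reflection_eq_neg:
  assumes w: "w \<in> W" "w (\<alpha> s) = - \<alpha> t"
  shows "w \<circ> sr s = sr t \<circ> w"
proof -
  have "(w \<circ> sr s) (\<alpha> s) = \<alpha> t" using w by (simp add: W_uminus)
  then have "w \<circ> sr s \<circ> sr s = sr t \<circ> (w \<circ> sr s)" using reflection_eq[of "w \<circ> sr s" s t] w by simp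
  then show ?thesis by (metis comp_assoc sr_comp_self_assoc(1))
qed

section \<open>Parabolic subgroups and coset representatives\<close>

lemma len_id' [simp]: "ell (\<lambda>x. x) = 0"
  using len_id by (simp add: id_def)

abbreviation "par \<equiv> parabolic A"
abbreviation "mcr \<equiv> min_coset_reps A"
abbreviation "winv (w :: 's weyl_elt) \<equiv> inv_into UNIV w"

lemma reduced_W: "reduced_word A w ss \<Longrightarrow> w \<in> W"
  by (auto simp: reduced_word_def)

lemma reduced_snoc:
  assumes "reduced_word A w ss" "nn (w (\<alpha> s))"
  shows "reduced_word A (w \<circ> sr s) (ss @ [s])"
  using assms len_right_pos[OF reduced_W[OF assms(1)]] by (auto simp: reduced_word_def)

lemma reduced_snocD:
  assumes "reduced_word A w (ss @ [s])"
  shows "reduced_word A (w \<circ> sr s) ss" "\<not> nn (w (\<alpha> s))"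
proof -
  have w: "w = wp ss \<circ> sr s" "ell w = length ss + 1" using assms by (auto simp: reduced_word_def)
  have e: "w \<circ> sr s = wp ss" using w by simp
  have "ell (wp ss) \<le> length ss" by (rule len_le) simp
  moreover have "ell w \<le> ell (wp ss) + 1" using w len_right_le[of "wp ss" s] by simp
  ultimately have l: "ell (wp ss) = length ss" using w by simp
  then show "reduced_word A (w \<circ> sr s) ss" using e by (simp add: reduced_word_def)
  show "\<not> nn (w (\<alpha> s))"
    using len_right_iff[of w s] e l w by (metis comp_W lessI not_less_iff_gr_or_eq Suc_eq_plus1 sr_W wp_in_W)
qed

text \<open>The deletion property: a further letter either lengthens the reduced word found so far
  or cancels one of its letters.\<close>

lemma reduced_sublist: "\<exists>rs. set rs \<subseteq> set ss \<and> reduced_word A (wp ss) rs"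
proof (induction ss rule: rev_induct)
  case Nil then show ?case by (auto simp: reduced_word_def)
next
  case (snoc x ss)
  then obtain rs where rs: "set rs \<subseteq> set ss" "reduced_word A (wp ss) rs" by blast
  show ?case
  proof (cases "nn (wp ss (\<alpha> x))")
    case True
    then have "reduced_word A (wp (ss @ [x])) (rs @ [x])"
      using reduced_snoc[OF rs(2) True] by (simp only: wp_append wp_Cons wp_Nil comp_id)
    moreover have "set (rs @ [x]) \<subseteq> set (ss @ [x])" using rs(1) by auto
    ultimately show ?thesis by blast
  next
    case False
    have w: "wp rs = wp ss" using rs by (simp add: reduced_word_def)
    then obtain xs s ys where e: "rs = xs @ s # ys" "wp ys (\<alpha> x) = \<alpha> s"
      using exchange_root[of "\<alpha> x" rs] False nn_simple by auto
    have "wp ys \<circ> sr x = sr s \<circ> wp ys" using reflection_eq e(2) by simp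
    then have "wp xs \<circ> sr s \<circ> (wp ys \<circ> sr x) = wp xs \<circ> sr s \<circ> sr s \<circ> wp ys" by (simp add: comp_assoc)
    then have eq: "wp (ss @ [x]) = wp (xs @ ys)"
      using w e(1) by (simp add: comp_assoc[symmetric])
    have "ell (wp ss \<circ> sr x) + 1 = length rs"
      using len_right_neg[of "wp ss" x] False rs(2) by (simp add: reduced_word_def)
    then have "reduced_word A (wp (ss @ [x])) (xs @ ys)"
      using eq e(1) by (simp add: reduced_word_def)
    moreover have "set (xs @ ys) \<subseteq> set (ss @ [x])" using rs(1) e(1) by auto
    ultimately show ?thesis by blast
  qed
qed

lemma parabolic_reduced:
  assumes "w \<in> par K" obtains ss where "reduced_word A w ss" "set ss \<subseteq> K"
  using assms reduced_sublist by (metis order_trans parabolicE)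

lemma parabolic_coeff: assumes "w \<in> par K" "u \<notin> K" shows "w x u = x u"
proof -
  obtain ss where "w = wp ss" "set ss \<subseteq> K" using assms(1) by (rule parabolicE)
  moreover have "set ss \<subseteq> K \<Longrightarrow> wp ss x u = x u" for ss
    using assms(2) by (induction ss) (auto intro!: sr_coeff[THEN trans])
  ultimately show ?thesis by blast
qed

text \<open>If the last letter \<open>s\<close> were outside \<open>K\<close>, then
  \<open>w (\<alpha> s)\<close> would keep the coefficient 1 at \<open>s\<close> and be positive,
  against reducedness.\<close>

lemma parabolic_all_reduced:
  assumes "w \<in> par K" "reduced_word A w ss" shows "set ss \<subseteq> K"
  using assms
proof (induction ss arbitrary: w rule: rev_induct)
  case (snoc s ss)
  have "s \<in> K"
  proof (rule ccontr)
    assume "s \<notin> K"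
    then have "w (\<alpha> s) s > 0" using parabolic_coeff[OF snoc.prems(1)] by simp
    then have "nn (w (\<alpha> s))" using root_pos_coeff snoc.prems(1) parabolic_W by (metis root_W root_simple)
    then show False using reduced_snocD(2)[OF snoc.prems(2)] by simp
  qed
  moreover have "set ss \<subseteq> K"
    using snoc.IH[OF _ reduced_snocD(1)[OF snoc.prems(2)]] snoc.prems(1)
      comp_parabolic sr_parabolic[OF \<open>s \<in> K\<close>] by blast
  ultimately show ?case by simp
qed auto

lemma supp_subset_iff: assumes "w \<in> W" shows "supp A w \<subseteq> K \<longleftrightarrow> w \<in> par K"
proof
  assume s: "supp A w \<subseteq> K"
  obtain ss where ss: "reduced_word A w ss" using reduced_exists assms by blast
  then have "set ss \<subseteq> K" using s by (auto simp: supp_def)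
  then show "w \<in> par K" using ss wp_in_parabolic by (auto simp: reduced_word_def)
next
  assume "w \<in> par K" then show "supp A w \<subseteq> K" using parabolic_all_reduced by (auto simp: supp_def)
qed

lemma mcr_iff: "v \<in> mcr K \<longleftrightarrow> v \<in> W \<and> (\<forall>s\<in>K. nn (v (\<alpha> s)))"
  using len_right_iff by (auto simp: min_coset_reps_def)

lemma mcr_W: "v \<in> mcr K \<Longrightarrow> v \<in> W" by (simp add: mcr_iff)

lemma W_expand: "v \<in> W \<Longrightarrow> v x = (\<Sum>i\<in>UNIV. x i \<cdot> v (\<alpha> i))"
  by (subst expand[of x]) (simp only: W_sum W_smul)

lemma mcr_nn:
  assumes "v \<in> mcr K" "nn x" "\<And>u. u \<notin> K \<Longrightarrow> x u = 0"
  shows "nn (v x)"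
proof -
  have "0 \<le> x i * v (\<alpha> i) u" for i u using assms(1,2) assms(3)[of i] unfolding mcr_iff by (cases "i \<in> K") auto
  then show ?thesis unfolding W_expand[OF mcr_W[OF assms(1)], of x]
    by (simp add: sum_fun_apply smul_apply sum_nonneg)
qed

text \<open>When a letter lengthens an element of \<open>par K\<close>, the positive root
  responsible is supported in \<open>K\<close>, so \<open>v\<close> keeps it positive and the same
  letter lengthens the product.\<close>

lemma len_coset_add:
  assumes v: "v \<in> mcr K" and u: "u \<in> par K"
  shows "ell (v \<circ> u) = ell v + ell u"
proof -
  obtain ss where "reduced_word A u ss" "set ss \<subseteq> K" using u by (rule parabolic_reduced)
  then show ?thesis
  proof (induction ss arbitrary: u rule: rev_induct)
    case Nil then show ?case by (simp add: reduced_word_def)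
  next
    case (snoc s ss)
    define u' where "u' = u \<circ> sr s"
    have r: "reduced_word A u' ss" unfolding u'_def using reduced_snocD(1)[OF snoc.prems(1)] .
    have u'K: "u' \<in> par K" using r snoc.prems(2) wp_in_parabolic by (auto simp: reduced_word_def)
    have u: "u = u' \<circ> sr s" by (simp add: u'_def)
    have uW: "u \<in> W" "u' \<in> W" using r snoc.prems(1) reduced_W by auto
    have "u' (\<alpha> s) = - u (\<alpha> s)" using W_sr_neg[OF uW(1)] by (simp add: u'_def)
    then have p: "nn (u' (\<alpha> s))" using nn_or_neg[OF uW(1)] reduced_snocD(2)[OF snoc.prems(1)] by metis
    have "u' (\<alpha> s) i = 0" if "i \<notin> K" for i
      using parabolic_coeff[OF u'K that] that snoc.prems(2) by (auto simp: simple_root_def)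
    then have "nn (v (u' (\<alpha> s)))" using mcr_nn[OF v p] by blast
    then have "ell (v \<circ> u' \<circ> sr s) = ell (v \<circ> u') + 1"
      using len_right_pos[of "v \<circ> u'" s] mcr_W[OF v] uW by simp
    moreover have "ell u = ell u' + 1" using len_right_pos[OF uW(2) p] u by simp
    moreover have "ell (v \<circ> u') = ell v + ell u'" by (rule snoc.IH[OF r]) (use snoc.prems(2) in simp)
    moreover have "v \<circ> u = v \<circ> u' \<circ> sr s" unfolding u by (simp only: comp_assoc)
    ultimately show ?case by (simp only:)
  qed
qed

lemma coset_decomp:
  assumes "w \<in> W" obtains v u where "v \<in> mcr K" "u \<in> par K" "w = v \<circ> u"
  using assms
proof (induction "ell w" arbitrary: w thesis rule: less_induct)
  case less
  show ?case
  proof (cases "w \<in> mcr K")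
    case True then show ?thesis using less.prems(1)[of w id] by simp
  next
    case False
    then obtain s where s: "s \<in> K" "\<not> nn (w (\<alpha> s))" using less.prems(2) by (auto simp: mcr_iff)
    then have "ell (w \<circ> sr s) < ell w" using len_right_neg[OF less.prems(2)] by simp
    then obtain v u where vu: "v \<in> mcr K" "u \<in> par K" "w \<circ> sr s = v \<circ> u"
      using less.hyps[of "w \<circ> sr s"] less.prems(2) by (metis comp_W sr_W)
    then have "w = v \<circ> (u \<circ> sr s)" by (metis comp_assoc sr_comp_self_assoc(1))
    moreover have "u \<circ> sr s \<in> par K" using vu s sr_parabolic comp_parabolic by blast
    ultimately show ?thesis using less.prems(1) vu(1) by blast
  qed
qed

text \<open>Deodhar's lemma: \<open>sr s\<close> turns only the positive root
  \<open>\<alpha> s\<close> negative, so minimality can be lost only if \<open>\<alpha> s\<close> is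
  the image of a simple root of \<open>K\<close>.\<close>

lemma deodhar:
  assumes "v \<in> mcr K"
  shows "sr s \<circ> v \<in> mcr K \<or> (\<exists>t\<in>K. v (\<alpha> t) = \<alpha> s)"
proof (rule disjCI)
  assume no: "\<not> (\<exists>t\<in>K. v (\<alpha> t) = \<alpha> s)"
  have v: "v \<in> W" using mcr_W[OF assms] .
  have "nn (sr s (v (\<alpha> t)))" if "t \<in> K" for t
    using sr_pos[of "v (\<alpha> t)" s] v that no assms by (auto simp: mcr_iff)
  then show "sr s \<circ> v \<in> mcr K" using v by (simp add: mcr_iff)
qed

text \<open>The reflection in a root supported in \<open>K\<close> changes only coordinates in
  \<open>K\<close>, which forces it into \<open>par K\<close>. A word in \<open>K\<close> for it
  turns the root negative, and \<open>exchange_root\<close> applied to that word places the root in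
  the \<open>par K\<close>-orbit of a simple root of \<open>K\<close>.\<close>

lemma root_parabolic:
  assumes "\<beta> \<in> \<Phi>" "nn \<beta>" and K: "\<And>u. u \<notin> K \<Longrightarrow> \<beta> u = 0"
  obtains w s where "w \<in> par K" "s \<in> K" "\<beta> = w (\<alpha> s)"
proof -
  obtain x s where x: "x \<in> W" "\<beta> = x (\<alpha> s)" using assms(1) by (rule rootE)
  define r where "r = x \<circ> sr s \<circ> winv x"
  have r: "r \<in> W" using x by (simp add: r_def)
  have r_eq: "r y u = y u" if "u \<notin> K" for y u
  proof -
    have "r y = x (winv x y - pr s (winv x y) \<cdot> \<alpha> s)" by (simp add: r_def sr_eq)
    also have "\<dots> = y - pr s (winv x y) \<cdot> \<beta>" using x by (simp add: W_diff[OF x(1)] W_smul[OF x(1)])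
    finally show ?thesis using K[OF that] by (simp add: vec)
  qed
  obtain v u where vu: "v \<in> mcr K" "u \<in> par K" "r = v \<circ> u" using r by (rule coset_decomp)
  \<comment> \<open>Outside \<open>K\<close> neither \<open>r\<close> nor \<open>winv u\<close>
    changes coordinates, so \<open>v (\<alpha> i)\<close> keeps the coefficient 1 at
    \<open>i\<close>.\<close>
  have "nn (v (\<alpha> i))" for i
  proof (cases "i \<in> K")
    case True then show ?thesis using vu(1) by (simp add: mcr_iff)
  next
    case False
    have "v (\<alpha> i) = r (winv u (\<alpha> i))" using vu parabolic_W by simp
    then have "v (\<alpha> i) i = 1"
      using r_eq[OF False] parabolic_coeff[OF inv_parabolic[OF vu(2)] False] by simp
    then show ?thesis using root_pos_coeff[of "v (\<alpha> i)" i] mcr_W[OF vu(1)] by simp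
  qed
  then have "r \<in> par K" using nn_all_id[of v] vu mcr_W by auto
  then obtain ss where ss: "r = wp ss" "set ss \<subseteq> K" by (rule parabolicE)
  have "r \<beta> = - \<beta>" using x by (simp add: r_def W_uminus)
  then have "\<not> nn (wp ss \<beta>)" using ss root_not_both assms by metis
  then obtain xs t ys where e: "ss = xs @ t # ys" "wp ys \<beta> = \<alpha> t" using exchange_root assms by blast
  have "\<beta> = winv (wp ys) (\<alpha> t)" using e by (metis W_inv_left_apply wp_in_W)
  moreover have "winv (wp ys) \<in> par K" using e ss by (intro inv_parabolic wp_in_parabolic) auto
  ultimately show ?thesis using that e ss by auto
qed

text \<open>Along a reduced word each new letter \<open>s\<close> adds \<open>- pr s x\<close> times
  the positive root by which the word grows.\<close>

lemma antidominant:
  assumes w: "w \<in> par K" and x: "\<And>i. i \<in> K \<Longrightarrow> pr i x \<le> 0"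
  shows "nn (w x - x)"
proof -
  obtain ss where "reduced_word A w ss" "set ss \<subseteq> K" using w by (rule parabolic_reduced)
  then show ?thesis
  proof (induction ss arbitrary: w rule: rev_induct)
    case Nil then show ?case by (simp add: reduced_word_def vec)
  next
    case (snoc s ss)
    define v where "v = w \<circ> sr s"
    have r: "reduced_word A v ss" unfolding v_def using reduced_snocD(1)[OF snoc.prems(1)] .
    have v: "v \<in> W" using reduced_W[OF r] .
    have w: "w \<in> W" "w = v \<circ> sr s" using reduced_W snoc.prems by (auto simp: v_def)
    have "v (\<alpha> s) = - w (\<alpha> s)" using W_sr_neg[OF w(1)] by (simp add: v_def)
    then have p: "nn (v (\<alpha> s))" using nn_or_neg[OF w(1)] reduced_snocD(2)[OF snoc.prems(1)] by metis
    have "w x - x = (v x - x) + (- pr s x) \<cdot> v (\<alpha> s)"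
      using v by (simp add: w(2) sr_eq W_diff W_smul) (rule ext, simp add: vec)
    then have eq: "(w x - x) i = (v x - x) i + (- pr s x) * v (\<alpha> s) i" for i
      by (simp only: plus_fun_apply smul_apply)
    have 1: "nn (v x - x)" using snoc.IH[OF r] snoc.prems(2) by simp
    have 2: "- pr s x \<ge> 0" using x snoc.prems(2) by simp
    show ?case
    proof
      fix i show "0 \<le> (w x - x) i"
        unfolding eq using 1 2 p by (metis add_nonneg_nonneg mult_nonneg_nonneg)
    qed
  qed
qed

lemma dominant:
  assumes "w \<in> par K" "\<And>i. i \<in> K \<Longrightarrow> pr i x \<ge> 0"
  shows "nn (x - w x)"
  using antidominant[of w K "- x"] assms by (simp add: pr_uminus W_uminus parabolic_W vec)

text \<open>Compare heights: \<open>h i\<close> is the height of \<open>v (\<alpha> i)\<close> and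
  at least 1 on \<open>L\<close>, while the total height is 1. This leaves room for a single
  coefficient of \<open>y\<close>, equal to 1.\<close>

lemma coset_simple:
  assumes v: "v \<in> mcr L" and y: "nn y" "\<And>u. u \<notin> L \<Longrightarrow> y u = 0" and e: "v y = \<alpha> s"
  obtains t where "t \<in> L" "y = \<alpha> t"
proof -
  define h where "h = (\<lambda>i. \<Sum>u\<in>UNIV. v (\<alpha> i) u)"
  have vW: "v \<in> W" using v by (rule mcr_W)
  have h: "h i \<ge> 1" if "i \<in> L" for i
  proof -
    have nn: "nn (v (\<alpha> i))" using that v by (simp add: mcr_iff)
    obtain u where "v (\<alpha> i) u \<noteq> 0" using W_simple_nonzero[OF vW] by blast
    then have "v (\<alpha> i) u \<ge> 1" using nn by (metis int_one_le_iff_zero_less order_le_less)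
    also have "v (\<alpha> i) u \<le> h i" unfolding h_def using nn by (intro member_le_sum) auto
    finally show ?thesis .
  qed
  have "(\<Sum>u\<in>UNIV. v y u) = (\<Sum>i\<in>UNIV. y i * h i)"
    unfolding W_expand[OF vW, of y] sum_fun_apply smul_apply h_def
    by (subst sum.swap) (simp add: sum_distrib_left)
  moreover have "(\<Sum>u\<in>UNIV. v y u) = 1" unfolding e by (simp add: simple_root_def)
  ultimately have S: "(\<Sum>i\<in>UNIV. y i * h i) = 1" by simp
  have nonneg: "y i * h i \<ge> 0" for i using y h[of i] by (cases "i \<in> L") auto
  obtain t where t: "y t \<noteq> 0" using S by (metis (no_types, lifting) mult_zero_left sum.neutral zero_neq_one)
  then have tL: "t \<in> L" and yt: "y t \<ge> 1" using y(2)[of t] y(1)[rule_format, of t] by (blast, linarith)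
  have ge: "y t * h t \<ge> y t" using h[OF tL] yt by simp
  have le: "y t * h t \<le> 1" using S member_le_sum[of t UNIV "\<lambda>i. y i * h i"] nonneg by simp
  have yt1: "y t = 1" "y t * h t = 1" using ge le yt by linarith+
  have "y u = 0" if "u \<noteq> t" for u
  proof (rule ccontr)
    assume "y u \<noteq> 0"
    then have "u \<in> L" "y u \<ge> 1" using y(2)[of u] y(1)[rule_format, of u] by (blast, linarith)
    then have "y u * h u \<ge> 1" using h[of u] by (smt (verit) mult_le_cancel_left1 mult_less_cancel_left1)
    moreover have "y t * h t + y u * h u \<le> (\<Sum>i\<in>UNIV. y i * h i)"
      using sum_mono2[of UNIV "{t, u}" "\<lambda>i. y i * h i"] nonneg that by simp
    ultimately show False using S yt1 by simp
  qed
  then have "y = \<alpha> t" using yt1 by (auto simp: simple_root_def)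
  then show ?thesis using that tL by blast
qed

section \<open>Elements acting as minus one on a parabolic root system\<close>

lemma neg_supported:
  assumes z: "z \<in> W" "\<And>i. i \<in> K \<Longrightarrow> z (\<alpha> i) = - \<alpha> i" and x: "\<And>u. u \<notin> K \<Longrightarrow> x u = 0"
  shows "z x = - x"
proof -
  have "x i \<cdot> z (\<alpha> i) = - (x i \<cdot> \<alpha> i)" for i
    using z(2)[of i] x[of i] by (cases "i \<in> K") (auto simp: vec)
  then have "z x = (\<Sum>i\<in>UNIV. - (x i \<cdot> \<alpha> i))" unfolding W_expand[OF z(1), of x] by simp
  also have "\<dots> = - x" by (subst (2) expand[of x]) (simp add: sum_negf)
  finally show ?thesis .
qed

lemma neg_commute:
  assumes z: "z \<in> W" "\<And>i. i \<in> K \<Longrightarrow> z (\<alpha> i) = - \<alpha> i" and u: "u \<in> par K"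
  shows "z \<circ> u = u \<circ> z"
proof -
  obtain ss where "u = wp ss" "set ss \<subseteq> K" using u by (rule parabolicE)
  moreover have "set ss \<subseteq> K \<Longrightarrow> z \<circ> wp ss = wp ss \<circ> z" for ss
  proof (induction ss)
    case (Cons s ss)
    then have "z \<circ> sr s = sr s \<circ> z" using reflection_eq_neg z by simp
    then show ?case using Cons by (metis comp_assoc list.set_intros(2) subset_code(1) wp_Cons)
  qed simp
  ultimately show ?thesis by simp
qed

text \<open>As \<open>z\<close> negates every vector supported in \<open>K\<close>, a letter that
  lengthens \<open>u\<close> shortens \<open>z \<circ> u\<close>.\<close>

lemma neg_len:
  assumes z: "z \<in> W" "\<And>i. i \<in> K \<Longrightarrow> z (\<alpha> i) = - \<alpha> i" and u: "u \<in> par K"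
  shows "ell (z \<circ> u) + ell u = ell z"
proof -
  obtain ss where "reduced_word A u ss" "set ss \<subseteq> K" using u by (rule parabolic_reduced)
  then show ?thesis
  proof (induction ss arbitrary: u rule: rev_induct)
    case Nil then show ?case by (simp add: reduced_word_def)
  next
    case (snoc s ss)
    define v where "v = u \<circ> sr s"
    have r: "reduced_word A v ss" unfolding v_def using reduced_snocD(1)[OF snoc.prems(1)] .
    have v: "v \<in> W" using reduced_W[OF r] .
    have vK: "v \<in> par K" using r snoc.prems(2) wp_in_parabolic by (auto simp: reduced_word_def)
    have u: "u \<in> W" "u = v \<circ> sr s" using reduced_W snoc.prems by (auto simp: v_def)
    have "v (\<alpha> s) = - u (\<alpha> s)" using W_sr_neg[OF u(1)] by (simp add: v_def)
    then have p: "nn (v (\<alpha> s))" using nn_or_neg[OF u(1)] reduced_snocD(2)[OF snoc.prems(1)] by metis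
    have "z (v (\<alpha> s)) = - v (\<alpha> s)"
    proof (rule neg_supported[OF z])
      fix i assume "i \<notin> K"
      then show "v (\<alpha> s) i = 0"
        using parabolic_coeff[OF vK] snoc.prems(2) by (auto simp: simple_root_def)
    qed
    then have "\<not> nn ((z \<circ> v) (\<alpha> s))" using not_nn_neg[OF v p] by simp
    then have "ell (z \<circ> v) = ell (z \<circ> u) + 1"
      using len_right_neg[of "z \<circ> v" s] v z(1) u by (simp add: comp_assoc)
    moreover have "ell u = ell v + 1" using len_right_pos[OF v p] u by simp
    moreover have "ell (z \<circ> v) + ell v = ell z" by (rule snoc.IH[OF r]) (use snoc.prems(2) in simp)
    ultimately show ?case by linarith
  qed
qed

lemma neg_involution:
  assumes z: "z \<in> par K" "\<And>i. i \<in> K \<Longrightarrow> z (\<alpha> i) = - \<alpha> i"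
  shows "z \<circ> z = id"
proof (rule nn_all_id)
  have zW: "z \<in> W" using z(1) parabolic_W by blast
  then show "z \<circ> z \<in> W" by simp
  fix s show "nn ((z \<circ> z) (\<alpha> s))"
  proof (cases "s \<in> K")
    case True then show ?thesis using z zW by (simp add: W_uminus nn_simple)
  next
    case False
    then have "(z \<circ> z) (\<alpha> s) s = 1" using parabolic_coeff[OF z(1) False] by simp
    then show ?thesis using root_pos_coeff[of "(z \<circ> z) (\<alpha> s)" s] zW by simp
  qed
qed

lemma neg_longest:
  assumes z: "z \<in> par K" "\<And>i. i \<in> K \<Longrightarrow> z (\<alpha> i) = - \<alpha> i"
  shows "longest A K = z"
  unfolding longest_def
proof (rule the_equality)
  have zW: "z \<in> W" using z(1) parabolic_W by blast
  have zz: "z \<circ> z = id" using neg_involution[OF z] by blast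
  show "z \<in> par K \<and> (\<forall>u\<in>par K. ell u \<le> ell z)" using neg_len[OF zW z(2)] z(1) by (metis le_add2)
  fix w assume w: "w \<in> par K \<and> (\<forall>u\<in>par K. ell u \<le> ell w)"
  have "ell (z \<circ> w) = 0" using neg_len[OF zW z(2), where u = w] w z(1) by fastforce
  then have "z \<circ> w = id" using len_eq_0[of "z \<circ> w"] zW w by (metis comp_W parabolic_W)
  then show "w = z" using zz zW by (metis W_cancel_left)
qed

section \<open>Reflections and double cosets\<close>

text \<open>Strong exchange: deleting the letter of a reduced word at which the root turns negative
  amounts to multiplying by the reflection in that root.\<close>

lemma reflection_shorter:
  assumes w: "w \<in> W" and u: "u \<in> W" and b: "nn (u (\<alpha> s))" "\<not> nn (w (u (\<alpha> s)))"
  shows "ell (w \<circ> u \<circ> sr s \<circ> winv u) < ell w"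
proof -
  obtain ss where ss: "reduced_word A w ss" using reduced_exists w by blast
  then have "\<not> nn (wp ss (u (\<alpha> s)))" using b by (simp add: reduced_word_def)
  moreover have "u (\<alpha> s) \<in> \<Phi>" using u by simp
  ultimately obtain xs t ys where e: "ss = xs @ t # ys" "wp ys (u (\<alpha> s)) = \<alpha> t"
    using exchange_root b(1) by blast
  then have "(wp ys \<circ> u) (\<alpha> s) = \<alpha> t" by simp
  then have r: "wp ys \<circ> u \<circ> sr s = sr t \<circ> (wp ys \<circ> u)" using reflection_eq u by simp
  have "w \<circ> u \<circ> sr s \<circ> winv u = wp xs \<circ> sr t \<circ> (wp ys \<circ> u \<circ> sr s) \<circ> winv u"
    using ss e(1) by (auto simp: reduced_word_def comp_assoc)
  also have "\<dots> = wp xs \<circ> sr t \<circ> (sr t \<circ> (wp ys \<circ> u)) \<circ> winv u" unfolding r ..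
  also have "\<dots> = wp xs \<circ> (sr t \<circ> sr t) \<circ> wp ys \<circ> (u \<circ> winv u)" by (simp only: comp_assoc)
  also have "\<dots> = wp (xs @ ys)" using u by simp
  finally have "ell (w \<circ> u \<circ> sr s \<circ> winv u) \<le> length (xs @ ys)" using len_le by metis
  then show ?thesis using ss e(1) by (simp add: reduced_word_def)
qed

lemma parabolic_off_nn:
  assumes "g \<in> par K" "\<beta> \<in> \<Phi>" "nn \<beta>" "u \<notin> K" "\<beta> u \<noteq> 0" shows "nn (g \<beta>)"
proof -
  have "g \<beta> u > 0" using parabolic_coeff[OF assms(1,4)] assms(3)[rule_format, of u] assms(5) by simp
  then show ?thesis using root_pos_coeff assms(1,2) parabolic_W by (metis root_W)
qed

text \<open>Splitting \<open>winv v\<close> makes \<open>winv b\<close> minimal. If \<open>b\<close>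
  sent a simple root of \<open>K\<close> to a negative root, its negative would either have support
  outside \<open>K\<close>, so that \<open>a\<close> keeps it positive although \<open>v\<close> is
  minimal, or lie in the span of \<open>K\<close>, where the minimality of \<open>winv b\<close> is
  violated.\<close>

lemma double_coset_rep:
  assumes v: "v \<in> mcr K"
  obtains a b where "v = a \<circ> b" "a \<in> par K" "b \<in> mcr K" "winv b \<in> mcr K"
proof -
  have vW: "v \<in> W" using mcr_W[OF v] .
  obtain b' a' where d: "b' \<in> mcr K" "a' \<in> par K" "winv v = b' \<circ> a'"
    using coset_decomp[of "winv v" K] vW by auto
  define a b where ab: "a = winv a'" "b = winv b'"
  have W: "b' \<in> W" "a' \<in> W" using d mcr_W parabolic_W by auto
  have "v = winv (b' \<circ> a')" using d(3) vW by (metis inv_inv_W)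
  then have vab: "v = a \<circ> b" using W by (simp add: inv_comp ab)
  have a: "a \<in> par K" using d inv_parabolic ab by blast
  have b: "winv b = b'" using W ab by simp
  have "nn (b (\<alpha> s))" if s: "s \<in> K" for s
  proof (rule ccontr)
    assume no: "\<not> nn (b (\<alpha> s))"
    define \<gamma> where "\<gamma> = - b (\<alpha> s)"
    have bW: "b \<in> W" using W ab by simp
    have g: "\<gamma> \<in> \<Phi>" "nn \<gamma>" using no nn_or_neg[OF bW] bW by (auto simp: \<gamma>_def)
    have iv: "winv b \<gamma> = - \<alpha> s" using bW by (simp add: \<gamma>_def W_uminus)
    show False
    proof (cases "\<exists>u. u \<notin> K \<and> \<gamma> u \<noteq> 0")
      case True
      then have "nn (a \<gamma>)" using parabolic_off_nn[OF a g] by blast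
      moreover have "v (\<alpha> s) = - a \<gamma>" using a parabolic_W by (simp add: vab \<gamma>_def W_uminus)
      moreover have "nn (v (\<alpha> s))" using v s by (simp add: mcr_iff)
      ultimately show False using not_nn_neg[OF vW, of s] by (metis minus_minus)
    next
      case False
      then have "nn (winv b \<gamma>)" using mcr_nn[of "winv b" K \<gamma>] b d(1) g by blast
      then show False using iv root_not_both[of "- \<alpha> s"] nn_simple by simp
    qed
  qed
  then have "b \<in> mcr K" using W ab by (simp add: mcr_iff)
  then show ?thesis using that vab a b d(1) by simp
qed

text \<open>Kilmoyer's theorem in the form needed: for a minimal double coset representative
  \<open>b\<close>, conjugation matches two elements of \<open>par K\<close> letter by letter. The
  root of the last letter of \<open>g'\<close> is sent by \<open>b\<close> to a positive root that
  \<open>g\<close> makes negative. That root is therefore supported in \<open>K\<close>, and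
  minimality of \<open>winv b\<close> makes it simple; the letter is then peeled off on both
  sides.\<close>

lemma double_coset_simple:
  assumes b: "b \<in> mcr K" "winv b \<in> mcr K" and g: "g \<in> par K" "g' \<in> par K" "g \<circ> b = b \<circ> g'"
    and ss: "reduced_word A g' ss" "k \<in> set ss"
  obtains r where "r \<in> K" "b (\<alpha> k) = \<alpha> r"
proof -
  have bW: "b \<in> W" using mcr_W[OF b(1)] .
  have "\<forall>k\<in>set ss. \<exists>r\<in>K. b (\<alpha> k) = \<alpha> r"
    using g ss(1)
  proof (induction ss arbitrary: g g' rule: rev_induct)
    case (snoc k ss)
    have k: "k \<in> K" using parabolic_all_reduced[OF snoc.prems(2,4)] by simp
    have W: "g \<in> W" "g' \<in> W" using snoc.prems parabolic_W by auto
    define \<gamma> where "\<gamma> = - g' (\<alpha> k)"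
    have "nn \<gamma>" using nn_or_neg[OF W(2)] reduced_snocD(2)[OF snoc.prems(4)] by (auto simp: \<gamma>_def)
    moreover have "\<gamma> u = 0" if "u \<notin> K" for u
      using parabolic_coeff[OF snoc.prems(2) that] that k by (auto simp: \<gamma>_def vec simple_root_def)
    ultimately have bg: "nn (b \<gamma>)" using mcr_nn[OF b(1)] by blast
    have gb: "g (b (\<alpha> k)) = - b \<gamma>"
      using snoc.prems(3) bW by (metis \<gamma>_def W_uminus add.inverse_inverse comp_apply)
    have d: "b (\<alpha> k) \<in> \<Phi>" "nn (b (\<alpha> k))" using b(1) k bW by (auto simp: mcr_iff)
    have "nn (- (b \<gamma>)) \<Longrightarrow> False"
      using root_not_both[of "b \<gamma>"] bg bW W by (simp add: \<gamma>_def)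
    then have off: "b (\<alpha> k) u = 0" if "u \<notin> K" for u
      using parabolic_off_nn[OF snoc.prems(1) d that] gb by metis
    obtain r where r: "r \<in> K" "b (\<alpha> k) = \<alpha> r"
      using coset_simple[OF b(2) d(2) off, of k] bW by auto
    have c: "b \<circ> sr k = sr r \<circ> b" using reflection_eq[OF bW r(2)] .
    have "(g \<circ> sr r) \<circ> b = g \<circ> b \<circ> sr k" by (simp add: comp_assoc c)
    then have "(g \<circ> sr r) \<circ> b = b \<circ> (g' \<circ> sr k)" using snoc.prems(3) by (metis comp_assoc)
    then have "\<forall>k\<in>set ss. \<exists>r\<in>K. b (\<alpha> k) = \<alpha> r"
      using snoc.IH[of "g \<circ> sr r" "g' \<circ> sr k"] snoc.prems k r reduced_snocD(1)[OF snoc.prems(4)]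
        sr_parabolic comp_parabolic by metis
    then show ?case using r by auto
  qed simp
  then show ?thesis using that ss(2) by blast
qed

section \<open>Commuting parabolic subgroups\<close>

lemma commuting_iff: "commuting A s t \<longleftrightarrow> s = t \<or> A s t = 0"
proof
  assume c: "commuting A s t"
  show "s = t \<or> A s t = 0"
  proof (rule ccontr)
    assume no: "\<not> (s = t \<or> A s t = 0)"
    have "(sr s \<circ> sr t) (\<alpha> t) = (sr t \<circ> sr s) (\<alpha> t)" using c by (simp add: commuting_def)
    then have "sr s (sr t (\<alpha> t)) s = sr t (sr s (\<alpha> t)) s" by simp
    moreover have "sr s (sr t (\<alpha> t)) s = A s t"
      using no by (simp add: W_uminus[OF sr_W] sr_simple vec)
    moreover have "sr t (sr s (\<alpha> t)) s = - A s t"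
      using no by (simp add: sr_simple[of s] vec)
    ultimately show False using no by simp
  qed
next
  assume "s = t \<or> A s t = 0"
  then show "commuting A s t"
  proof
    assume "A s t = 0"
    then have "sr s (\<alpha> t) = \<alpha> t" by (simp add: sr_simple) (auto simp: vec)
    from reflection_eq[OF sr_W this] show ?thesis by (simp add: commuting_def)
  qed (simp add: commuting_def)
qed

lemma commuting_comp: "A s t = 0 \<Longrightarrow> sr s \<circ> sr t = sr t \<circ> sr s"
  using commuting_iff by (auto simp: commuting_def)

lemma parabolic_commute:
  assumes "x \<in> par K" "y \<in> par L" and c: "\<And>s t. s \<in> K \<Longrightarrow> t \<in> L \<Longrightarrow> A s t = 0"
  shows "x \<circ> y = y \<circ> x"
proof -
  have 1: "sr s \<circ> wp ts = wp ts \<circ> sr s" if "s \<in> K" "set ts \<subseteq> L" for s ts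
    using that(2)
  proof (induction ts)
    case (Cons t ts)
    then have "sr s \<circ> sr t = sr t \<circ> sr s" by (intro commuting_comp c that(1)) simp
    then show ?case using Cons by (metis comp_assoc list.set_intros(2) subset_code(1) wp_Cons)
  qed simp
  have 2: "wp ss \<circ> wp ts = wp ts \<circ> wp ss" if "set ss \<subseteq> K" "set ts \<subseteq> L" for ss ts
    using that(1)
  proof (induction ss)
    case (Cons s ss)
    then have "sr s \<circ> wp ts = wp ts \<circ> sr s" using 1 that(2) by simp
    then show ?case using Cons by (metis comp_assoc list.set_intros(2) subset_code(1) wp_Cons)
  qed simp
  show ?thesis using assms(1,2) 2 by (metis parabolicE)
qed

lemma parabolic_fix:
  assumes "x \<in> par K" "\<And>s. s \<in> K \<Longrightarrow> pr s v = 0" shows "x v = v"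
proof -
  obtain ss where "x = wp ss" "set ss \<subseteq> K" using assms(1) by (rule parabolicE)
  moreover have "set ss \<subseteq> K \<Longrightarrow> wp ss v = v" for ss
  proof (induction ss)
    case (Cons s ss)
    moreover have "sr s v = v" if "pr s v = 0" using that by (auto simp: sr_eq vec)
    ultimately show ?case using assms(2) by simp
  qed simp
  ultimately show ?thesis by blast
qed

end

section \<open>Extensions of type \<open>E\<^sub>8\<close>\<close>

locale e7 = gcm A for A :: "'s::finite \<Rightarrow> 's \<Rightarrow> int" +
  fixes I1 :: "'s set" and b :: "nat \<Rightarrow> 's"
  assumes b_bij: "bij_betw b {1..7} I1"
    and b_A: "\<And>i j. i \<in> {1..7} \<Longrightarrow> j \<in> {1..7} \<Longrightarrow>
       A (b i) (b j) = (if i = j then 2 else if E_edge i j then -1 else 0)"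
begin

abbreviation "I2 \<equiv> commutant A I1"
abbreviation "II \<equiv> I1 \<union> I2"

text \<open>The Cartan entries are spelled out as rewrite rules; \<open>Suc 0\<close> stands for the
  label 1 because that is the form the simplifier produces.\<close>

lemma b_A_eval [simp]:
  shows "A (b (Suc 0)) (b 2) = 0" "A (b (Suc 0)) (b 3) = -1" "A (b (Suc 0)) (b 4) = 0" "A (b (Suc 0)) (b 5) = 0" "A (b (Suc 0)) (b 6) = 0" "A (b (Suc 0)) (b 7) = 0"
    and "A (b 2) (b (Suc 0)) = 0" "A (b 2) (b 3) = 0" "A (b 2) (b 4) = -1" "A (b 2) (b 5) = 0" "A (b 2) (b 6) = 0" "A (b 2) (b 7) = 0"
    and "A (b 3) (b (Suc 0)) = -1" "A (b 3) (b 2) = 0" "A (b 3) (b 4) = -1" "A (b 3) (b 5) = 0" "A (b 3) (b 6) = 0" "A (b 3) (b 7) = 0"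
    and "A (b 4) (b (Suc 0)) = 0" "A (b 4) (b 2) = -1" "A (b 4) (b 3) = -1" "A (b 4) (b 5) = -1" "A (b 4) (b 6) = 0" "A (b 4) (b 7) = 0"
    and "A (b 5) (b (Suc 0)) = 0" "A (b 5) (b 2) = 0" "A (b 5) (b 3) = 0" "A (b 5) (b 4) = -1" "A (b 5) (b 6) = -1" "A (b 5) (b 7) = 0"
    and "A (b 6) (b (Suc 0)) = 0" "A (b 6) (b 2) = 0" "A (b 6) (b 3) = 0" "A (b 6) (b 4) = 0" "A (b 6) (b 5) = -1" "A (b 6) (b 7) = -1"
    and "A (b 7) (b (Suc 0)) = 0" "A (b 7) (b 2) = 0" "A (b 7) (b 3) = 0" "A (b 7) (b 4) = 0" "A (b 7) (b 5) = 0" "A (b 7) (b 6) = -1"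
  by (simp_all add: b_A E_edge_def doubleton_eq_iff)

lemma b_in [simp]: "b (Suc 0) \<in> I1" "b 2 \<in> I1" "b 3 \<in> I1" "b 4 \<in> I1" "b 5 \<in> I1" "b 6 \<in> I1" "b 7 \<in> I1"
  using b_bij by (auto simp: bij_betw_def)

lemma I1_eq: "I1 = {b 1, b 2, b 3, b 4, b 5, b 6, b 7}"
proof -
  have "{1..7::nat} = {1,2,3,4,5,6,7}" by auto
  then show ?thesis using b_bij by (auto simp: bij_betw_def)
qed

lemma I1_cases: "i \<in> I1 \<Longrightarrow> (P (b 1) \<Longrightarrow> P (b 2) \<Longrightarrow> P (b 3) \<Longrightarrow> P (b 4) \<Longrightarrow> P (b 5) \<Longrightarrow> P (b 6) \<Longrightarrow> P (b 7) \<Longrightarrow> P i)"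
  unfolding I1_eq by blast

lemma card_I1: "card I1 = 7"
  using b_bij bij_betw_same_card by fastforce

lemma b_eq_iff [simp]: "i \<in> {1..7} \<Longrightarrow> j \<in> {1..7} \<Longrightarrow> b i = b j \<longleftrightarrow> i = j"
  using b_bij by (auto simp: bij_betw_def inj_on_def)

lemma I2_disjoint: "s \<in> I2 \<Longrightarrow> s \<notin> I1"
proof
  assume s: "s \<in> I2" and "s \<in> I1"
  have "\<not> (\<forall>t\<in>I1. commuting A s t)"
    using \<open>s \<in> I1\<close>
  proof (rule I1_cases)
    show "\<not> (\<forall>t\<in>I1. commuting A (b 1) t)" by (auto simp: commuting_iff intro!: bexI[of _ "b 3"])
    show "\<not> (\<forall>t\<in>I1. commuting A (b 2) t)" by (auto simp: commuting_iff intro!: bexI[of _ "b 4"])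
    show "\<not> (\<forall>t\<in>I1. commuting A (b 3) t)" by (auto simp: commuting_iff intro!: bexI[of _ "b 4"])
    show "\<not> (\<forall>t\<in>I1. commuting A (b 4) t)" by (auto simp: commuting_iff intro!: bexI[of _ "b 5"])
    show "\<not> (\<forall>t\<in>I1. commuting A (b 5) t)" by (auto simp: commuting_iff intro!: bexI[of _ "b 6"])
    show "\<not> (\<forall>t\<in>I1. commuting A (b 6) t)" by (auto simp: commuting_iff intro!: bexI[of _ "b 7"])
    show "\<not> (\<forall>t\<in>I1. commuting A (b 7) t)" by (auto simp: commuting_iff intro!: bexI[of _ "b 6"])
  qed
  then show False using s by (auto simp: commutant_def)
qed

lemma I2_iff: "s \<in> I2 \<longleftrightarrow> s \<notin> I1 \<and> (\<forall>t\<in>I1. A s t = 0)"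
  using I2_disjoint[of s] by (auto simp: commutant_def commuting_iff)

lemma I2_zero: "s \<in> I2 \<Longrightarrow> t \<in> I1 \<Longrightarrow> A s t = 0" "s \<in> I2 \<Longrightarrow> t \<in> I1 \<Longrightarrow> A t s = 0"
  using I2_iff A_zero_sym by auto

text \<open>Symbolic coordinates: reflections become arithmetic on seven integers, so identities in
  the E7 root system are checked by rewriting.\<close>

definition v7 :: "int \<Rightarrow> int \<Rightarrow> int \<Rightarrow> int \<Rightarrow> int \<Rightarrow> int \<Rightarrow> int \<Rightarrow> 's \<Rightarrow> int" where
  "v7 c1 c2 c3 c4 c5 c6 c7 = c1 \<cdot> \<alpha> (b 1) + c2 \<cdot> \<alpha> (b 2) + c3 \<cdot> \<alpha> (b 3) + c4 \<cdot> \<alpha> (b 4) + c5 \<cdot> \<alpha> (b 5) + c6 \<cdot> \<alpha> (b 6) + c7 \<cdot> \<alpha> (b 7)"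

lemma pr_v7:
  shows "pr (b (Suc 0)) (v7 c1 c2 c3 c4 c5 c6 c7) = 2 * c1 - (c3)"
    "pr (b 2) (v7 c1 c2 c3 c4 c5 c6 c7) = 2 * c2 - (c4)"
    "pr (b 3) (v7 c1 c2 c3 c4 c5 c6 c7) = 2 * c3 - (c1 + c4)"
    "pr (b 4) (v7 c1 c2 c3 c4 c5 c6 c7) = 2 * c4 - (c2 + c3 + c5)"
    "pr (b 5) (v7 c1 c2 c3 c4 c5 c6 c7) = 2 * c5 - (c4 + c6)"
    "pr (b 6) (v7 c1 c2 c3 c4 c5 c6 c7) = 2 * c6 - (c5 + c7)"
    "pr (b 7) (v7 c1 c2 c3 c4 c5 c6 c7) = 2 * c7 - (c6)"
  by (simp_all add: v7_def pr_add pr_smul)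

lemma sr_v7:
  shows "sr (b (Suc 0)) (v7 c1 c2 c3 c4 c5 c6 c7) = v7 (c3 - c1) c2 c3 c4 c5 c6 c7"
    "sr (b 2) (v7 c1 c2 c3 c4 c5 c6 c7) = v7 c1 (c4 - c2) c3 c4 c5 c6 c7"
    "sr (b 3) (v7 c1 c2 c3 c4 c5 c6 c7) = v7 c1 c2 (c1 + c4 - c3) c4 c5 c6 c7"
    "sr (b 4) (v7 c1 c2 c3 c4 c5 c6 c7) = v7 c1 c2 c3 (c2 + c3 + c5 - c4) c5 c6 c7"
    "sr (b 5) (v7 c1 c2 c3 c4 c5 c6 c7) = v7 c1 c2 c3 c4 (c4 + c6 - c5) c6 c7"
    "sr (b 6) (v7 c1 c2 c3 c4 c5 c6 c7) = v7 c1 c2 c3 c4 c5 (c5 + c7 - c6) c7"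
    "sr (b 7) (v7 c1 c2 c3 c4 c5 c6 c7) = v7 c1 c2 c3 c4 c5 c6 (c6 - c7)"
  by (rule ext, simp only: sr_eq pr_v7 One_nat_def minus_apply smul_apply, simp add: v7_def vec algebra_simps)+

lemma simple_v7:
  shows "\<alpha> (b 1) = v7 1 0 0 0 0 0 0"
    "\<alpha> (b 2) = v7 0 1 0 0 0 0 0"
    "\<alpha> (b 3) = v7 0 0 1 0 0 0 0"
    "\<alpha> (b 4) = v7 0 0 0 1 0 0 0"
    "\<alpha> (b 5) = v7 0 0 0 0 1 0 0"
    "\<alpha> (b 6) = v7 0 0 0 0 0 1 0"
    "\<alpha> (b 7) = v7 0 0 0 0 0 0 1"
  by (rule ext, simp add: v7_def vec)+

lemma v7_off: "u \<notin> I1 \<Longrightarrow> v7 c1 c2 c3 c4 c5 c6 c7 u = 0"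
  by (auto simp: v7_def vec simple_root_def)

text \<open>The Coxeter number of \<open>E\<^sub>7\<close> is 18, so the ninth power of a Coxeter element is \<open>w\<^sub>0 = -1\<close>.\<close>

definition cox :: "'s list" where
  "cox = [b 7, b 6, b 5, b 4, b 3, b 2, b 1]"

lemma minus_one:
  defines "z \<equiv> wp (cox @ cox @ cox @ cox @ cox @ cox @ cox @ cox @ cox)"
  shows "z \<in> par I1" "i \<in> I1 \<Longrightarrow> z (\<alpha> i) = - \<alpha> i"
proof -
  show "z \<in> par I1" unfolding z_def by (intro wp_in_parabolic) (auto simp: cox_def)
  have cox: "wp cox (v7 c1 c2 c3 c4 c5 c6 c7) = v7 (c3 - c1) (c4 - c2) (c4 - c1) (c4 + c5 - c2 - c1) (c4 + c6 - c2 - c1) (c4 + c7 - c2 - c1) (c4 - c2 - c1)" for c1 c2 c3 c4 c5 c6 c7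
    by (simp add: cox_def sr_v7 algebra_simps)
  assume "i \<in> I1"
  then have "i = b 1 \<or> i = b 2 \<or> i = b 3 \<or> i = b 4 \<or> i = b 5 \<or> i = b 6 \<or> i = b 7"
    unfolding I1_eq by blast
  moreover have "z (\<alpha> (b 1)) = - \<alpha> (b 1)"
    unfolding z_def wp_append comp_apply simple_v7(1) cox by (simp add: v7_def vec fun_eq_iff)
  moreover have "z (\<alpha> (b 2)) = - \<alpha> (b 2)"
    unfolding z_def wp_append comp_apply simple_v7(2) cox by (simp add: v7_def vec fun_eq_iff)
  moreover have "z (\<alpha> (b 3)) = - \<alpha> (b 3)"
    unfolding z_def wp_append comp_apply simple_v7(3) cox by (simp add: v7_def vec fun_eq_iff)
  moreover have "z (\<alpha> (b 4)) = - \<alpha> (b 4)"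
    unfolding z_def wp_append comp_apply simple_v7(4) cox by (simp add: v7_def vec fun_eq_iff)
  moreover have "z (\<alpha> (b 5)) = - \<alpha> (b 5)"
    unfolding z_def wp_append comp_apply simple_v7(5) cox by (simp add: v7_def vec fun_eq_iff)
  moreover have "z (\<alpha> (b 6)) = - \<alpha> (b 6)"
    unfolding z_def wp_append comp_apply simple_v7(6) cox by (simp add: v7_def vec fun_eq_iff)
  moreover have "z (\<alpha> (b 7)) = - \<alpha> (b 7)"
    unfolding z_def wp_append comp_apply simple_v7(7) cox by (simp add: v7_def vec fun_eq_iff)
  ultimately show "z (\<alpha> i) = - \<alpha> i" by (elim disjE) simp_all
qed

definition w0 :: "'s weyl_elt" where "w0 = longest A I1"

lemma w0: "w0 \<in> par I1" "i \<in> I1 \<Longrightarrow> w0 (\<alpha> i) = - \<alpha> i"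
proof -
  have e: "w0 = wp (cox @ cox @ cox @ cox @ cox @ cox @ cox @ cox @ cox)"
    unfolding w0_def by (rule neg_longest) (fact minus_one)+
  show "w0 \<in> par I1" "i \<in> I1 \<Longrightarrow> w0 (\<alpha> i) = - \<alpha> i"
    unfolding e by (fact minus_one)+
qed

lemma w0_W [simp]: "w0 \<in> W" using w0(1) by (rule parabolic_W)

text \<open>\<open>E8_node j\<close> means that \<open>I\<^sub>1 \<union> {j}\<close> is of type \<open>E\<^sub>8\<close>, and then \<open>theta j\<close> is its highest root. For any
  \<open>j\<close>, \<open>xs j\<close> is twice the projection of \<open>\<alpha>\<^sub>j\<close> along \<open>\<Sum>\<^sub>i \<real>\<alpha>\<^sub>i\<close>, \<open>i \<in> I\<^sub>1\<close>, onto the vectors fixed by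
  \<open>W\<^bsub>I\<^sub>1\<^esub>\<close>; its coefficients come from twice the inverse \<open>E\<^sub>7\<close> Cartan matrix.\<close>

definition E8_node :: "'s \<Rightarrow> bool" where
  "E8_node j \<longleftrightarrow> j \<notin> I1 \<and> A (b 7) j = -1 \<and> A j (b 7) = -1 \<and>
     (\<forall>i\<in>{1..6}. A (b i) j = 0 \<and> A j (b i) = 0)"

definition xs :: "'s \<Rightarrow> 's \<Rightarrow> int" where
  "xs j = v7 (- (4 * A (b 1) j + 4 * A (b 2) j + 6 * A (b 3) j + 8 * A (b 4) j + 6 * A (b 5) j + 4 * A (b 6) j + 2 * A (b 7) j)) (- (4 * A (b 1) j + 7 * A (b 2) j + 8 * A (b 3) j + 12 * A (b 4) j + 9 * A (b 5) j + 6 * A (b 6) j + 3 * A (b 7) j)) (- (6 * A (b 1) j + 8 * A (b 2) j + 12 * A (b 3) j + 16 * A (b 4) j + 12 * A (b 5) j + 8 * A (b 6) j + 4 * A (b 7) j)) (- (8 * A (b 1) j + 12 * A (b 2) j + 16 * A (b 3) j + 24 * A (b 4) j + 18 * A (b 5) j + 12 * A (b 6) j + 6 * A (b 7) j)) (- (6 * A (b 1) j + 9 * A (b 2) j + 12 * A (b 3) j + 18 * A (b 4) j + 15 * A (b 5) j + 10 * A (b 6) j + 5 * A (b 7) j)) (- (4 * A (b 1) j + 6 * A (b 2) j + 8 * A (b 3) j + 12 * A (b 4) j + 10 * A (b 5) j + 8 * A (b 6) j + 4 * A (b 7) j)) (- (2 * A (b 1) j + 3 * A (b 2) j + 4 *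 A (b 3) j + 6 * A (b 4) j + 5 * A (b 5) j + 4 * A (b 6) j + 3 * A (b 7) j)) + 2 \<cdot> \<alpha> j"

definition theta :: "'s \<Rightarrow> 's \<Rightarrow> int" where
  "theta j = v7 2 3 4 6 5 4 3 + 2 \<cdot> \<alpha> j"

lemma E8_nodeD:
  assumes "E8_node j"
  shows "A (b 7) j = -1" "A j (b 7) = -1"
    "A (b (Suc 0)) j = 0" "A (b 2) j = 0" "A (b 3) j = 0" "A (b 4) j = 0" "A (b 5) j = 0" "A (b 6) j = 0"
    "A j (b (Suc 0)) = 0" "A j (b 2) = 0" "A j (b 3) = 0" "A j (b 4) = 0" "A j (b 5) = 0" "A j (b 6) = 0"
    "j \<notin> I1"
  using assms by (auto simp: E8_node_def)

lemma E8_node_not_I2: "E8_node j \<Longrightarrow> j \<notin> I2"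
  using I2_zero(1)[of j "b 7"] by (auto simp: E8_node_def)

lemma xs_E8_node: "E8_node j \<Longrightarrow> xs j = theta j"
  by (simp add: xs_def theta_def E8_nodeD)

lemma pr_xs: "i \<in> I1 \<Longrightarrow> pr i (xs j) = 0"
  by (erule I1_cases; simp add: xs_def pr_add pr_smul pr_v7)

lemma xs_nn: assumes "j \<notin> I1" shows "nn (xs j)"
proof -
  have "A i j \<le> 0" if "i \<in> I1" for i using that assms by (metis A_off)
  then have "A (b 1) j \<le> 0" "A (b 2) j \<le> 0" "A (b 3) j \<le> 0" "A (b 4) j \<le> 0" "A (b 5) j \<le> 0"
    "A (b 6) j \<le> 0" "A (b 7) j \<le> 0" by simp_all
  then show ?thesis unfolding xs_def v7_def plus_fun_apply smul_apply
    by (intro allI add_nonneg_nonneg mult_nonneg_nonneg) (auto simp: simple_root_def)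
qed

lemma xs_off: "u \<notin> insert j I1 \<Longrightarrow> xs j u = 0"
  by (simp add: xs_def vec v7_off)

lemma theta_off: "u \<notin> insert j I1 \<Longrightarrow> theta j u = 0"
  by (simp add: theta_def vec v7_off)

lemma xs_j: "j \<notin> I1 \<Longrightarrow> xs j j = 2"
  by (simp add: xs_def vec v7_off)

lemma theta_j: "j \<notin> I1 \<Longrightarrow> theta j j = 2"
  by (simp add: theta_def vec v7_off)

text \<open>Only the pairing with the coroot of \<open>j\<close> matters. It is at most 4 minus the
  sum of the products \<open>a i * a' i\<close> weighted by the diagonal 4, 7, 12, 24, 15, 8, 3 of
  twice the inverse Cartan matrix. So it can be positive only if \<open>j\<close> is attached to
  node 7 alone, by a simple bond.\<close>

lemma E8_node_or_antidominant:
  assumes j: "j \<notin> II"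
  shows "E8_node j \<or> (\<forall>i\<in>insert j I1. pr i (xs j) \<le> 0)"
proof -
  define a where "a = (\<lambda>i. - A (b i) j)"
  define a' where "a' = (\<lambda>i. - A j (b i))"
  have nnA: "A i j \<le> 0" "A j i \<le> 0" if "i \<in> I1" for i using that j by (metis A_off UnCI)+
  then have nn: "a 1 \<ge> 0" "a 2 \<ge> 0" "a 3 \<ge> 0" "a 4 \<ge> 0" "a 5 \<ge> 0" "a 6 \<ge> 0" "a 7 \<ge> 0"
    "a' 1 \<ge> 0" "a' 2 \<ge> 0" "a' 3 \<ge> 0" "a' 4 \<ge> 0" "a' 5 \<ge> 0" "a' 6 \<ge> 0" "a' 7 \<ge> 0"
    by (simp_all add: a_def a'_def)
  have z: "a i = 0 \<longleftrightarrow> a' i = 0" for i using A_zero_sym by (auto simp: a_def a'_def)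
  have p: "a i * a' i \<ge> 0" if "a i \<ge> 0" "a' i \<ge> 0" for i using that by simp
  \<comment> \<open>All terms of the quadratic expression are products of nonnegative numbers, so
    keeping only the diagonal ones bounds the pairing from above.\<close>
  have pr: "pr j (xs j) \<le> 4 - (4 * (a 1 * a' 1) + 7 * (a 2 * a' 2) + 12 * (a 3 * a' 3) + 24 * (a 4 * a' 4)
      + 15 * (a 5 * a' 5) + 8 * (a 6 * a' 6) + 3 * (a 7 * a' 7))"
  proof -
    define c1 where "c1 = 4 * a 1 + 4 * a 2 + 6 * a 3 + 8 * a 4 + 6 * a 5 + 4 * a 6 + 2 * a 7"
    define c2 where "c2 = 4 * a 1 + 7 * a 2 + 8 * a 3 + 12 * a 4 + 9 * a 5 + 6 * a 6 + 3 * a 7"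
    define c3 where "c3 = 6 * a 1 + 8 * a 2 + 12 * a 3 + 16 * a 4 + 12 * a 5 + 8 * a 6 + 4 * a 7"
    define c4 where "c4 = 8 * a 1 + 12 * a 2 + 16 * a 3 + 24 * a 4 + 18 * a 5 + 12 * a 6 + 6 * a 7"
    define c5 where "c5 = 6 * a 1 + 9 * a 2 + 12 * a 3 + 18 * a 4 + 15 * a 5 + 10 * a 6 + 5 * a 7"
    define c6 where "c6 = 4 * a 1 + 6 * a 2 + 8 * a 3 + 12 * a 4 + 10 * a 5 + 8 * a 6 + 4 * a 7"
    define c7 where "c7 = 2 * a 1 + 3 * a 2 + 4 * a 3 + 6 * a 4 + 5 * a 5 + 4 * a 6 + 3 * a 7"
    note c_def = c1_def c2_def c3_def c4_def c5_def c6_def c7_def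
    have x: "xs j = v7 c1 c2 c3 c4 c5 c6 c7 + 2 \<cdot> \<alpha> j"
      by (simp add: xs_def c_def a_def algebra_simps)
    have "pr j (xs j) = 4 - (a' 1 * c1 + a' 2 * c2 + a' 3 * c3 + a' 4 * c4 + a' 5 * c5 + a' 6 * c6 + a' 7 * c7)"
      unfolding x by (simp add: pr_add pr_smul v7_def a'_def algebra_simps)
    moreover have "a' 1 * (4 * a 1) \<le> a' 1 * c1" "a' 2 * (7 * a 2) \<le> a' 2 * c2"
      "a' 3 * (12 * a 3) \<le> a' 3 * c3" "a' 4 * (24 * a 4) \<le> a' 4 * c4" "a' 5 * (15 * a 5) \<le> a' 5 * c5"
      "a' 6 * (8 * a 6) \<le> a' 6 * c6" "a' 7 * (3 * a 7) \<le> a' 7 * c7"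
      using nn by (auto intro!: mult_left_mono simp only: c_def)
    ultimately show ?thesis by (simp add: mult.commute mult.left_commute)
  qed
  show ?thesis
  proof (cases "\<exists>i\<in>{1,2,3,4,5,6}. a i \<noteq> 0")
    case True
    then obtain i where i: "i \<in> {1,2,3,4,5,6}" "a i \<noteq> 0" by blast
    have "a i \<ge> 0" "a' i \<ge> 0" using i nn by auto
    then have "a i * a' i > 0" using i(2) z by (simp add: zero_less_mult_iff order_le_less)
    then have "a i * a' i \<ge> 1" by simp
    moreover have "i = 1 \<or> i = 2 \<or> i = 3 \<or> i = 4 \<or> i = 5 \<or> i = 6" using i(1) by simp
    moreover have "a 1 * a' 1 \<ge> 0" "a 2 * a' 2 \<ge> 0" "a 3 * a' 3 \<ge> 0" "a 4 * a' 4 \<ge> 0"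
      "a 5 * a' 5 \<ge> 0" "a 6 * a' 6 \<ge> 0" "a 7 * a' 7 \<ge> 0" using nn p by blast+
    ultimately have "pr j (xs j) \<le> 0" using pr by (elim disjE; hypsubst; linarith)
    then show ?thesis using pr_xs by auto
  next
    case False
    then have a0: "a 1 = 0" "a 2 = 0" "a 3 = 0" "a 4 = 0" "a 5 = 0" "a 6 = 0" by auto
    then have a0': "a' 1 = 0" "a' 2 = 0" "a' 3 = 0" "a' 4 = 0" "a' 5 = 0" "a' 6 = 0" using z by auto
    have a7: "a 7 \<noteq> 0"
    proof
      assume "a 7 = 0"
      then have "A j t = 0" if "t \<in> I1" for t
        using that a0 A_zero_sym[of j t] by (auto simp: a_def I1_eq)
      then have "j \<in> I2" using j by (auto simp: I2_iff)
      then show False using j by blast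
    qed
    then have a7': "a' 7 \<noteq> 0" using z by blast
    show ?thesis
    proof (cases "a 7 = 1 \<and> a' 7 = 1")
      case True
      have "i \<in> {1..6} \<Longrightarrow> i = 1 \<or> i = 2 \<or> i = 3 \<or> i = 4 \<or> i = 5 \<or> i = 6" for i :: nat by auto
      then have "A (b i) j = 0 \<and> A j (b i) = 0" if "i \<in> {1..6}" for i
        using that a0 a0' unfolding a_def a'_def by (metis neg_equal_0_iff_equal)
      then have "E8_node j" using True j by (auto simp: E8_node_def a_def a'_def)
      then show ?thesis by blast
    next
      case False
      then have "a 7 * a' 7 \<ge> 2"
      proof (cases "a 7 = 1")
        case True then show ?thesis using False a7' nn by auto
      next
        case F: False
        then have "a 7 \<ge> 2" "a' 7 \<ge> 1" using a7 a7' nn by auto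
        then show ?thesis using mult_mono[of 2 "a 7" 1 "a' 7"] by simp
      qed
      then have "pr j (xs j) \<le> 0" using pr a0 by simp
      then show ?thesis using pr_xs by auto
    qed
  qed
qed

definition v8 :: "'s \<Rightarrow> int \<Rightarrow> int \<Rightarrow> int \<Rightarrow> int \<Rightarrow> int \<Rightarrow> int \<Rightarrow> int \<Rightarrow> int \<Rightarrow> 's \<Rightarrow> int" where
  "v8 j c8 c1 c2 c3 c4 c5 c6 c7 = v7 c1 c2 c3 c4 c5 c6 c7 + c8 \<cdot> \<alpha> j"

lemma sr_v8:
  assumes "E8_node j"
  shows "sr (b (Suc 0)) (v8 j c8 c1 c2 c3 c4 c5 c6 c7) = v8 j c8 (c3 - c1) c2 c3 c4 c5 c6 c7"
    "sr (b 2) (v8 j c8 c1 c2 c3 c4 c5 c6 c7) = v8 j c8 c1 (c4 - c2) c3 c4 c5 c6 c7"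
    "sr (b 3) (v8 j c8 c1 c2 c3 c4 c5 c6 c7) = v8 j c8 c1 c2 (c1 + c4 - c3) c4 c5 c6 c7"
    "sr (b 4) (v8 j c8 c1 c2 c3 c4 c5 c6 c7) = v8 j c8 c1 c2 c3 (c2 + c3 + c5 - c4) c5 c6 c7"
    "sr (b 5) (v8 j c8 c1 c2 c3 c4 c5 c6 c7) = v8 j c8 c1 c2 c3 c4 (c4 + c6 - c5) c6 c7"
    "sr (b 6) (v8 j c8 c1 c2 c3 c4 c5 c6 c7) = v8 j c8 c1 c2 c3 c4 c5 (c5 + c7 - c6) c7"
    "sr (b 7) (v8 j c8 c1 c2 c3 c4 c5 c6 c7) = v8 j c8 c1 c2 c3 c4 c5 c6 (c6 + c8 - c7)"
    "sr j (v8 j c8 c1 c2 c3 c4 c5 c6 c7) = v8 j (c7 - c8) c1 c2 c3 c4 c5 c6 c7"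
  by (rule ext, simp add: sr_eq v8_def pr_add pr_smul pr_v7 E8_nodeD[OF assms],
      simp add: v7_def pr_add pr_smul E8_nodeD[OF assms] vec algebra_simps)+

text \<open>The highest root of E8 has height 29, and each of the 28 letters raises the height by
  one, starting from \<open>\<alpha> j\<close>.\<close>

lemma theta_word:
  assumes "E8_node j"
  shows "wp [j, b 7, b 6, b 5, b 4, b 3, b 2, b 4, b 5, b 6, b 7, b 1, b 3, b 4, b 5, b 6, b 2, b 4, b 5, b 3, b 4, b 1, b 3, b 2, b 4, b 5, b 6, b 7] (\<alpha> j) = theta j"
proof -
  have "\<alpha> j = v8 j 1 0 0 0 0 0 0 0" by (rule ext) (simp add: v8_def v7_def vec)
  moreover have "theta j = v8 j 2 2 3 4 6 5 4 3" by (simp add: theta_def v8_def)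
  ultimately show ?thesis by (simp add: sr_v8[OF assms])
qed

lemma theta_par:
  obtains w where "E8_node j \<Longrightarrow> w \<in> par (insert j I1)" "E8_node j \<Longrightarrow> theta j = w (\<alpha> j)"
  using theta_word[of j] wp_in_parabolic[of "[j, b 7, b 6, b 5, b 4, b 3, b 2, b 4, b 5, b 6, b 7, b 1, b 3, b 4, b 5, b 6, b 2, b 4, b 5, b 3, b 4, b 1, b 3, b 2, b 4, b 5, b 6, b 7]" "insert j I1"] that by simp

lemma theta_root [simp]: "E8_node j \<Longrightarrow> theta j \<in> \<Phi>"
  using theta_par[of j] parabolic_W by (metis root_W root_simple)

lemma theta_nn: "nn (theta j)"
  by (auto simp: theta_def v7_def vec simple_root_def)

lemma pr_theta_I1: "E8_node j \<Longrightarrow> i \<in> I1 \<Longrightarrow> pr i (theta j) = 0"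
  using pr_xs xs_E8_node by metis

lemma pr_theta_j: "E8_node j \<Longrightarrow> pr j (theta j) = 1"
  by (simp add: theta_def v7_def pr_add pr_smul E8_nodeD)

lemma w0_theta: "E8_node j \<Longrightarrow> w0 (theta j) = theta j"
  by (rule parabolic_fix[OF w0(1)]) (rule pr_theta_I1)

lemma adjacent_orbit:
  assumes "A s t = -1" "A t s = -1" shows "(sr s \<circ> sr t) (\<alpha> s) = \<alpha> t"
  using assms by (auto simp: sr_simple sr_add sr_smul W_diff vec fun_eq_iff)

text \<open>The diagram is connected and simply laced, so adjacent simple roots are conjugate; the
  chain of conjugations starts at \<open>\<alpha> j\<close>, which \<open>theta_par\<close> links to
  \<open>theta j\<close>.\<close>

lemma root_in_theta_orbit:
  assumes j: "E8_node j" and s: "s \<in> insert j I1"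
  obtains y where "y \<in> par (insert j I1)" "\<alpha> s = y (theta j)"
proof -
  define Orb where "Orb = {y (theta j) | y. y \<in> par (insert j I1)}"
  have step: "\<alpha> t \<in> Orb" if st: "\<alpha> s \<in> Orb" "A s t = -1" "A t s = -1" "s \<in> insert j I1" "t \<in> insert j I1" for s t
  proof -
    obtain y where y: "y \<in> par (insert j I1)" "\<alpha> s = y (theta j)" using st(1) unfolding Orb_def by blast
    have "sr s \<circ> sr t \<circ> y \<in> par (insert j I1)"
      using y(1) that by (intro comp_parabolic sr_parabolic) auto
    moreover have "(sr s \<circ> sr t \<circ> y) (theta j) = \<alpha> t"
      using adjacent_orbit[OF that(2,3)] y(2) by simp
    ultimately show ?thesis unfolding Orb_def by (metis (mono_tags, lifting) mem_Collect_eq)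
  qed
  obtain w where w: "w \<in> par (insert j I1)" "theta j = w (\<alpha> j)" using theta_par j by metis
  then have "\<alpha> j \<in> Orb" unfolding Orb_def
    using inv_parabolic parabolic_W by (metis (mono_tags, lifting) W_inv_left_apply mem_Collect_eq)
  note 8 = this
  have 7: "\<alpha> (b 7) \<in> Orb" by (rule step[OF 8]) (simp_all add: E8_nodeD[OF j])
  have 6: "\<alpha> (b 6) \<in> Orb" by (rule step[OF 7]) simp_all
  have 5: "\<alpha> (b 5) \<in> Orb" by (rule step[OF 6]) simp_all
  have 4: "\<alpha> (b 4) \<in> Orb" by (rule step[OF 5]) simp_all
  have 3: "\<alpha> (b 3) \<in> Orb" by (rule step[OF 4]) simp_all
  have 2: "\<alpha> (b 2) \<in> Orb" by (rule step[OF 4]) simp_all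
  have 1: "\<alpha> (b 1) \<in> Orb" by (rule step[OF 3]) simp_all
  have "\<alpha> s \<in> Orb" using s 1 2 3 4 5 6 7 8 unfolding I1_eq by blast
  then show ?thesis using that unfolding Orb_def by blast
qed

text \<open>All roots of the E8 system lie in the orbit of \<open>theta j\<close>, and
  \<open>theta j\<close> is dominant, so no element of its orbit exceeds it.\<close>

lemma root_le_theta:
  assumes j: "E8_node j" and c: "c \<in> pos_roots_in A (insert j I1)"
  shows "c u \<le> theta j u"
proof -
  have c': "c \<in> \<Phi>" "nn c" "\<And>u. u \<notin> insert j I1 \<Longrightarrow> c u = 0"
    using c by (auto simp: pos_roots_in_def pos_roots_def)
  obtain w s where w: "w \<in> par (insert j I1)" "s \<in> insert j I1" "c = w (\<alpha> s)"
    using root_parabolic[OF c'] by blast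
  obtain y where y: "y \<in> par (insert j I1)" "\<alpha> s = y (theta j)" using root_in_theta_orbit[OF j w(2)] by blast
  have "pr i (theta j) \<ge> 0" if "i \<in> insert j I1" for i
    using that pr_theta_I1[OF j] pr_theta_j[OF j] by auto
  then have "nn (theta j - (w \<circ> y) (theta j))"
    using dominant[OF comp_parabolic[OF w(1) y(1)]] by blast
  then show ?thesis using w y by (simp add: vec)
qed

lemma highest_theta:
  assumes j: "E8_node j" shows "highest_root A (insert j I1) = theta j"
  unfolding highest_root_def
proof (rule the_equality)
  have "theta j \<in> pos_roots_in A (insert j I1)"
    using j theta_nn theta_off by (simp add: pos_roots_in_def pos_roots_def)
  then show 1: "theta j \<in> pos_roots_in A (insert j I1) \<and> (\<forall>c\<in>pos_roots_in A (insert j I1). \<forall>s. c s \<le> theta j s)"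
    using root_le_theta[OF j] by blast
  fix c assume "c \<in> pos_roots_in A (insert j I1) \<and> (\<forall>d\<in>pos_roots_in A (insert j I1). \<forall>s. d s \<le> c s)"
  then show "c = theta j" using 1 by (metis (no_types, lifting) antisym ext)
qed

lemma E8_node_type_E8:
  assumes j: "E8_node j" shows "type_E 8 A (insert j I1)"
  unfolding type_E_def
proof (intro exI[of _ "b(8 := j)"] conjI ballI)
  have e: "{1..8::nat} = insert 8 {1..7}" by auto
  show "bij_betw (b(8 := j)) {1..8} (insert j I1)"
  proof -
    have "bij_betw (b(8 := j)) {1..7} I1" using b_bij by (rule bij_betw_cong[THEN iffD1, rotated]) auto
    moreover have "bij_betw (b(8 := j)) {8} {j}" by (simp add: bij_betw_def)
    ultimately have "bij_betw (b(8 := j)) ({1..7} \<union> {8}) (I1 \<union> {j})"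
      using E8_nodeD(15)[OF j] by (intro bij_betw_combine) auto
    moreover have "{1..7} \<union> {8::nat} = {1..8}" by auto
    ultimately show ?thesis by simp
  qed
  fix k l :: nat assume kl: "k \<in> {1..8}" "l \<in> {1..8}"
  have E8: "E_edge 8 i \<longleftrightarrow> i = 7" "E_edge i 8 \<longleftrightarrow> i = 7" for i
    by (auto simp: E_edge_def doubleton_eq_iff)
  have j0: "A (b i) j = (if i = 7 then -1 else 0)" "A j (b i) = (if i = 7 then -1 else 0)" if "i \<in> {1..7}" for i
    using j that by (auto simp: E8_node_def)
  show "A ((b(8 := j)) k) ((b(8 := j)) l) = (if k = l then 2 else if E_edge k l then - 1 else 0)"
  proof (cases "k = 8"; cases "l = 8")
    assume "k \<noteq> 8" "l \<noteq> 8" then show ?thesis using kl b_A[of k l] by auto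
  next
    assume "k = 8" "l = 8" then show ?thesis by simp
  next
    assume "k = 8" "l \<noteq> 8" then show ?thesis using kl j0(2)[of l] E8 by auto
  next
    assume "k \<noteq> 8" "l = 8" then show ?thesis using kl j0(1)[of k] E8 by auto
  qed
qed

text \<open>The given labelling of \<open>J\<close> need not extend that of \<open>I1\<close>.
  Connectedness of the diagram keeps \<open>j\<close> out of \<open>I2\<close>. Antidominance of
  \<open>xs j\<close> is excluded by weighting its pairings with \<open>y\<close>: as
  \<open>y\<close> times the Cartan matrix is the all-ones vector, the weighted sum is the height of
  \<open>xs j\<close>, which is positive.\<close>

lemma type_E8_E8_node:
  assumes J: "type_E 8 A J" "card J = 8" "I1 \<subset> J"
  obtains j where "E8_node j" "J = insert j I1"
proof -
  obtain c where c: "bij_betw c {1..8} J"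
    and cA: "\<And>i k. i \<in> {1..8} \<Longrightarrow> k \<in> {1..8} \<Longrightarrow>
       A (c i) (c k) = (if i = k then 2 else if E_edge i k then -1 else 0)"
    using J(1) unfolding type_E_def by blast
  obtain j where j: "j \<in> J" "j \<notin> I1" using J(3) by blast
  have fin: "finite J" by simp
  have "card (insert j I1) = card J" using j(2) card_I1 J(2) by simp
  moreover have "insert j I1 \<subseteq> J" using j J(3) by blast
  ultimately have Je: "J = insert j I1" using card_subset_eq[OF fin] by metis
  have r8: "{1..8::nat} = {1,2,3,4,5,6,7,8}" by auto
  have cJ: "c k \<in> J" if "k \<in> {1..8}" for k using c that by (auto simp: bij_betw_def)
  have "j \<notin> I2"
  proof
    assume jI: "j \<in> I2"
    obtain k where k: "k \<in> {1..8}" "j = c k" using c j(1) by (auto simp: bij_betw_def)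
    have "\<exists>l\<in>{1..8}. k \<noteq> l \<and> E_edge k l"
      using k(1) unfolding r8 by (auto simp: E_edge_def doubleton_eq_iff)
    then obtain l where l: "l \<in> {1..8}" "k \<noteq> l" "E_edge k l" by blast
    then have m: "A j (c l) = -1" using cA[OF k(1), of l] k by simp
    then have "c l \<noteq> j" using A_diag[of j] by auto
    then have "c l \<in> I1" using cJ[OF l(1)] Je by blast
    then show False using I2_zero(1)[OF jI] m by simp
  qed
  then have "E8_node j \<or> (\<forall>i\<in>J. pr i (xs j) \<le> 0)" using E8_node_or_antidominant[of j] j Je by blast
  moreover have "\<not> (\<forall>i\<in>J. pr i (xs j) \<le> 0)"
  proof
    assume anti: "\<forall>i\<in>J. pr i (xs j) \<le> 0"
    \<comment> \<open>\<open>y\<close> holds the coefficients of half the sum of the positive roots of \<open>E\<^sub>8\<close>.\<close>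
    define y :: "nat \<Rightarrow> int" where "y = (\<lambda>k. [0, 46, 68, 91, 135, 110, 84, 57, 29] ! k)"
    have col: "(\<Sum>k\<in>{1..8}. y k * A (c k) (c l)) = 1" if "l \<in> {1..8}" for l
    proof -
      have "(\<Sum>k\<in>{1..8}. y k * A (c k) (c l)) = (\<Sum>k\<in>{1..8}. y k * (if k = l then 2 else if E_edge k l then -1 else 0))"
        using cA that by (intro sum.cong) auto
      also have "\<dots> = 1" using that unfolding r8
        by (auto simp: y_def E_edge_def doubleton_eq_iff)
      finally show ?thesis .
    qed
    have prJ: "pr s (xs j) = (\<Sum>l\<in>{1..8}. A s (c l) * xs j (c l))" for s
    proof -
      have "pr s (xs j) = (\<Sum>t\<in>J. A s t * xs j t)"
        unfolding pr_def using xs_off[of _ j] Je by (intro sum.mono_neutral_right) auto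
      also have "\<dots> = (\<Sum>l\<in>{1..8}. A s (c l) * xs j (c l))"
        by (rule sum.reindex_bij_betw[OF c, symmetric])
      finally show ?thesis .
    qed
    have "(\<Sum>k\<in>{1..8}. y k * pr (c k) (xs j)) = (\<Sum>k\<in>{1..8}. \<Sum>l\<in>{1..8}. y k * A (c k) (c l) * xs j (c l))"
      unfolding prJ by (simp add: sum_distrib_left mult.assoc)
    also have "\<dots> = (\<Sum>l\<in>{1..8}. (\<Sum>k\<in>{1..8}. y k * A (c k) (c l)) * xs j (c l))"
      by (subst sum.swap) (simp only: sum_distrib_right)
    also have "\<dots> = (\<Sum>l\<in>{1..8}. xs j (c l))" using col by (intro sum.cong) auto
    also have "\<dots> = (\<Sum>t\<in>J. xs j t)" by (rule sum.reindex_bij_betw[OF c])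
    also have "\<dots> \<ge> xs j j" using j xs_nn[OF j(2)] by (intro member_le_sum) auto
    finally have "(\<Sum>k\<in>{1..8}. y k * pr (c k) (xs j)) \<ge> 2" using xs_j[OF j(2)] by simp
    moreover have "(\<Sum>k\<in>{1..8}. y k * pr (c k) (xs j)) \<le> 0"
    proof (rule sum_nonpos)
      fix k :: nat assume k: "k \<in> {1..8}"
      have "y k \<ge> 0" using k unfolding r8 by (auto simp: y_def)
      then show "y k * pr (c k) (xs j) \<le> 0" using anti cJ[OF k] by (simp add: mult_nonneg_nonpos)
    qed
    ultimately show False by simp
  qed
  ultimately show ?thesis using that Je by blast
qed

text \<open>If \<open>t\<close> were adjacent to \<open>j\<close>, then
  \<open>theta j + \<alpha> t\<close> would be antidominant and so could only grow under
  \<open>v\<close>. As \<open>v (\<alpha> t)\<close> is the simple root \<open>\<alpha> s\<close>,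
  the positive root \<open>- v (theta j)\<close> would then be at most \<open>\<alpha> s\<close>,
  hence equal to it, and \<open>v\<close> would kill a nonzero vector.\<close>

lemma not_nn_theta_commutes:
  assumes t: "t \<in> I2" and j: "E8_node j" and v: "v \<in> W" "v (\<alpha> t) = \<alpha> s" "\<not> nn (v (theta j))"
  shows "A t j = 0"
proof (rule ccontr)
  assume ne: "A t j \<noteq> 0"
  have tj: "t \<noteq> j" using t E8_node_not_I2[OF j] by blast
  have tI: "t \<notin> I1" using t I2_disjoint by blast
  have le: "A t j \<le> -1" "A j t \<le> -1" using ne A_off[of t j] A_off[of j t] tj A_zero_sym[of t j] by auto
  define x where "x = theta j + \<alpha> t"
  have anti: "pr i x \<le> 0" for i
  proof (cases "i \<in> I1")
    case True then show ?thesis using I2_zero(2)[OF t] pr_theta_I1[OF j] by (simp add: x_def pr_add)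
  next
    case False
    show ?thesis
    proof (cases "i = j")
      case True then show ?thesis using pr_theta_j[OF j] le by (simp add: x_def pr_add)
    next
      case ij: False
      have off: "A i (b (Suc 0)) \<le> 0" "A i (b 2) \<le> 0" "A i (b 3) \<le> 0" "A i (b 4) \<le> 0" "A i (b 5) \<le> 0"
        "A i (b 6) \<le> 0" "A i (b 7) \<le> 0" "A i j \<le> 0"
        using False ij b_in by (metis A_off)+
      have th: "pr i (theta j) \<le> 2 * A i j"
        using off by (simp add: theta_def v7_def pr_add pr_smul)
      show ?thesis
      proof (cases "i = t")
        case True then show ?thesis using th le by (simp add: x_def pr_add)
      next
        case False
        then have "A i t \<le> 0" by (rule A_off)
        then show ?thesis using th off by (simp add: x_def pr_add)
      qed
    qed
  qed
  have "nn (v x - x)" using antidominant[of v UNIV x] v(1) anti by (simp add: weyl_group_def)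
  moreover have xnn: "nn x" using theta_nn nn_simple unfolding x_def plus_fun_apply by (metis add_nonneg_nonneg)
  ultimately have vx: "nn (v x)" unfolding minus_apply by (metis diff_ge_0_iff_ge order_trans)
  have vx_eq: "v x = v (theta j) + \<alpha> s" using v by (simp add: x_def W_add)
  define \<beta> where "\<beta> = - v (theta j)"
  have b: "\<beta> \<in> \<Phi>" "nn \<beta>" using v(1,3) theta_root[OF j] root_nn_or_neg[of "v (theta j)"] by (auto simp: \<beta>_def)
  have "\<beta> u = 0" if "u \<noteq> s" for u
  proof -
    have "0 \<le> v x u" using vx by blast
    then have "\<beta> u \<le> 0" using that unfolding vx_eq by (simp add: \<beta>_def vec)
    then show ?thesis using b(2) by (simp add: antisym)
  qed
  then have "\<beta> = \<alpha> s" using root_multiple_simple b by blast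
  then have "v x = 0" unfolding vx_eq \<beta>_def by (metis add.commute add.right_inverse)
  then have "x = 0" using W_eq_zero[OF v(1)] by blast
  moreover have "x j = 2" using theta_j[of j] j tj by (simp add: x_def vec E8_node_def)
  ultimately show False by (simp add: zero_fun_apply)
qed

text \<open>If \<open>s\<close> with \<open>g\<alpha>\<^sub>s < 0\<close> were no \<open>E8_node\<close>, then \<open>xs s\<close> would be antidominant for \<open>I\<^sub>1 \<union> {s}\<close>, so the
  parabolic part of \<open>g\<close> could only increase it.\<close>

lemma normalizer_descent:
  assumes g: "g \<in> mcr II" "g \<noteq> id" and simple: "\<And>i. i \<in> I1 \<Longrightarrow> \<exists>r. g (\<alpha> i) = \<alpha> r"
  obtains j where "E8_node j" "\<not> nn (g (theta j))"
proof -
  have gW: "g \<in> W" using mcr_W[OF g(1)] .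
  obtain s where s: "\<not> nn (g (\<alpha> s))" using nn_all_id[OF gW] g(2) by blast
  have sI: "s \<notin> II" using s g(1) by (auto simp: mcr_iff)
  define L where "L = insert s I1"
  obtain v u where vu: "v \<in> mcr L" "u \<in> par L" "g = v \<circ> u" using gW by (rule coset_decomp)
  have uW: "u \<in> W" and vW: "v \<in> W" using vu mcr_W parabolic_W by auto
  have usup: "u x k = 0" if "\<And>k. k \<notin> L \<Longrightarrow> x k = 0" "k \<notin> L" for x k
    using parabolic_coeff[OF vu(2) that(2)] that by simp
  have pos: "nn (u \<beta>)" if "\<beta> \<in> \<Phi>" "\<And>k. k \<notin> L \<Longrightarrow> \<beta> k = 0" "nn (g \<beta>)" for \<beta>
  proof (rule ccontr)
    assume "\<not> nn (u \<beta>)"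
    then have "nn (- u \<beta>)" using root_nn_or_neg[of "u \<beta>"] that(1) uW by auto
    then have "nn (v (- u \<beta>))" using usup[OF that(2)] by (intro mcr_nn[OF vu(1)]) (auto simp: vec)
    then have "nn (- g \<beta>)" using vu(3) vW by (simp add: W_uminus)
    then show False using root_not_both[of "g \<beta>"] that(1,3) gW by auto
  qed
  have sL: "\<alpha> i k = 0" if "i \<in> L" "k \<notin> L" for i k using that by (auto simp: simple_root_def)
  have "\<exists>t\<in>L. u (\<alpha> i) = \<alpha> t" if i: "i \<in> I1" for i
  proof -
    have iL: "i \<in> L" using i by (simp add: L_def)
    obtain r where r: "g (\<alpha> i) = \<alpha> r" using simple i by blast
    then have "nn (g (\<alpha> i))" using nn_simple by simp
    then have n: "nn (u (\<alpha> i))" using pos[OF root_simple sL[OF iL]] by blast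
    have "v (u (\<alpha> i)) = \<alpha> r" using r vu(3) by simp
    then show ?thesis using coset_simple[OF vu(1) n usup[OF sL[OF iL]]] by metis
  qed
  then obtain l where l: "\<And>i. i \<in> I1 \<Longrightarrow> l i \<in> L" "\<And>i. i \<in> I1 \<Longrightarrow> u (\<alpha> i) = \<alpha> (l i)" by metis
  have inj: "inj_on l I1"
    by (rule inj_onI) (metis W_inv_left_apply l(2) simple_inject uW)
  have "card (l ` I1) = 7" using inj card_I1 by (simp add: card_image)
  moreover have "card L = 8" using sI card_I1 by (simp add: L_def)
  moreover have lL: "l ` I1 \<subseteq> L" using l(1) by blast
  ultimately have "card (L - l ` I1) = 1" by (simp add: card_Diff_subset)
  \<comment> \<open>The images of the seven simple roots of \<open>I1\<close> miss exactly one
    element \<open>s'\<close> of \<open>L\<close>. The coefficient of \<open>u x\<close> at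
    \<open>s'\<close> therefore depends only on the coefficient of \<open>x\<close> at
    \<open>s\<close>.\<close>
  then obtain s' where s': "L - l ` I1 = {s'}" by (auto simp: card_1_singleton_iff)
  have un: "nn (- u (\<alpha> s))"
  proof -
    have "\<not> nn (u (\<alpha> s))"
    proof
      assume "nn (u (\<alpha> s))"
      then have "nn (v (u (\<alpha> s)))" using usup[OF sL[of s]] by (intro mcr_nn[OF vu(1)]) (auto simp: L_def)
      then show False using s vu(3) by simp
    qed
    then show ?thesis using nn_or_neg[OF uW] by blast
  qed
  \<comment> \<open>Otherwise \<open>u (\<alpha> s)\<close> would lie in the span of the images of
    \<open>I1\<close>, and applying \<open>winv u\<close> would put \<open>\<alpha> s\<close> in the
    span of the simple roots of \<open>I1\<close>.\<close>
  have "u (\<alpha> s) s' \<noteq> 0"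
  proof
    assume z: "u (\<alpha> s) s' = 0"
    have "\<alpha> s = winv u (u (\<alpha> s))" using uW by simp
    also have "\<dots> = (\<Sum>k\<in>UNIV. u (\<alpha> s) k \<cdot> winv u (\<alpha> k))" using uW by (intro W_expand) simp
    finally have "\<alpha> s s = (\<Sum>k\<in>UNIV. u (\<alpha> s) k * winv u (\<alpha> k) s)"
      by (metis (no_types, lifting) sum_fun_apply smul_apply sum.cong)
    also have "\<dots> = 0"
    proof (intro sum.neutral ballI)
      fix k
      show "u (\<alpha> s) k * winv u (\<alpha> k) s = 0"
      proof (cases "k \<in> l ` I1")
        case True
        then obtain i where i: "i \<in> I1" "k = l i" by blast
        then have "winv u (\<alpha> k) = \<alpha> i" using l(2) uW by (metis W_inv_left_apply)
        then show ?thesis using i sI by (auto simp: simple_root_def)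
      next
        case False
        then have "k = s' \<or> k \<notin> L" using s' by blast
        then have "u (\<alpha> s) k = 0" using z usup[OF sL[of s]] by (auto simp: L_def)
        then show ?thesis by simp
      qed
    qed
    finally show False by simp
  qed
  then have neg: "u (\<alpha> s) s' < 0" using un by (simp add: vec) (meson le_neq_trans)
  have ui: "u (\<alpha> (b i)) s' = 0" if "i \<in> {1..7}" for i
  proof -
    have "b i \<in> I1" using that b_bij by (auto simp: bij_betw_def)
    moreover have "s' \<notin> l ` I1" using s' by blast
    ultimately show ?thesis using l(2) by (auto simp: simple_root_def)
  qed
  have ux: "u (v7 c1 c2 c3 c4 c5 c6 c7 + 2 \<cdot> \<alpha> s) s' < 0" for c1 c2 c3 c4 c5 c6 c7
    using neg ui[of 1] ui[of 2] ui[of 3] ui[of 4] ui[of 5] ui[of 6] ui[of 7] uW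
    by (simp add: v7_def W_add W_smul vec)
  have "E8_node s"
  proof (rule ccontr)
    assume "\<not> E8_node s"
    then have "\<forall>i\<in>L. pr i (xs s) \<le> 0" using E8_node_or_antidominant[OF sI] by (simp add: L_def)
    then have "nn (u (xs s) - xs s)" using antidominant[OF vu(2)] by blast
    moreover have "nn (xs s)" using xs_nn sI by blast
    ultimately have "u (xs s) s' \<ge> 0" by (simp add: vec) (meson order_trans)
    then show False using ux unfolding xs_def by (meson not_less)
  qed
  moreover have "\<not> nn (g (theta s))"
  proof
    assume "nn (g (theta s))"
    then have "nn (u (theta s))"
      using pos[OF theta_root[OF \<open>E8_node s\<close>]] theta_off by (simp add: L_def)
    then show False using ux unfolding theta_def by (meson not_less)
  qed
  ultimately show ?thesis using that by blast
qed

text \<open>For an \<open>E8_node\<close> this is the set of simple reflections in \<open>I2\<close>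
  commuting with all of \<open>insert j I1\<close>.\<close>

definition CJ :: "'s \<Rightarrow> 's set" where
  "CJ j = {t \<in> I2. A t j = 0}"

lemma CJ_I2: "par (CJ j) \<subseteq> par I2"
  by (rule parabolic_mono) (auto simp: CJ_def)

lemma CJ_theta: assumes "E8_node j" "v \<in> par (CJ j)" shows "v (theta j) = theta j"
proof (rule parabolic_fix[OF assms(2)])
  fix t assume t: "t \<in> CJ j"
  then have "A t (b i) = 0" if "i \<in> {1..7}" for i
    using I2_zero(1) b_bij that by (auto simp: CJ_def bij_betw_def)
  then have "A t (b (Suc 0)) = 0" "A t (b 2) = 0" "A t (b 3) = 0" "A t (b 4) = 0" "A t (b 5) = 0"
    "A t (b 6) = 0" "A t (b 7) = 0" by auto
  then show "pr t (theta j) = 0" using t by (simp add: theta_def v7_def pr_add pr_smul CJ_def)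
qed

text \<open>The sets \<open>J\<close> of the definition are exactly the sets
  \<open>insert j I1\<close> for an \<open>E8_node\<close>. Elements of \<open>I2\<close> commute
  with \<open>I1\<close> anyway, so the condition on the support of \<open>v2\<close> concerns
  \<open>j\<close> alone.\<close>

lemma valid_iff:
  "(v1, v2) \<in> valid_pairs A I1 \<longleftrightarrow> v1 \<in> mcr II \<and> v2 \<in> par I2 \<and>
     (\<forall>j. E8_node j \<longrightarrow> v2 \<in> par (CJ j) \<longrightarrow> nn (v1 (theta j)))"
proof -
  have comm: "(\<forall>s\<in>insert j I1. \<forall>t\<in>supp A v2. commuting A s t) \<longleftrightarrow> v2 \<in> par (CJ j)"
    if "E8_node j" "v2 \<in> par I2" for j
  proof -
    have W: "v2 \<in> W" using that(2) parabolic_W by blast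
    have s: "supp A v2 \<subseteq> I2" using that(2) supp_subset_iff[OF W] by blast
    have "(\<forall>s\<in>insert j I1. \<forall>t\<in>supp A v2. commuting A s t) \<longleftrightarrow> supp A v2 \<subseteq> CJ j"
      using s E8_node_not_I2[OF that(1)] I2_zero(2) A_zero_sym by (fastforce simp: commuting_iff CJ_def)
    then show ?thesis using supp_subset_iff[OF W] by blast
  qed
  have pos: "v1 (theta j) \<in> pos_roots A \<longleftrightarrow> nn (v1 (theta j))" if "E8_node j" "v1 \<in> mcr II" for j
    using that mcr_W theta_root by (auto simp: pos_roots_def)
  have "(\<forall>J. card J = 8 \<and> I1 \<subset> J \<and> type_E 8 A J \<and> (\<forall>s\<in>J. \<forall>t\<in>supp A v2. commuting A s t)
           \<longrightarrow> v1 (highest_root A J) \<in> pos_roots A) \<longleftrightarrow>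
        (\<forall>j. E8_node j \<longrightarrow> v2 \<in> par (CJ j) \<longrightarrow> nn (v1 (theta j)))"
    if v: "v1 \<in> mcr II" "v2 \<in> par I2"
  proof (rule iffI; (rule allI)+; (rule impI)+)
    fix j assume all: "\<forall>J. card J = 8 \<and> I1 \<subset> J \<and> type_E 8 A J \<and> (\<forall>s\<in>J. \<forall>t\<in>supp A v2. commuting A s t)
           \<longrightarrow> v1 (highest_root A J) \<in> pos_roots A" and j: "E8_node j" and c: "v2 \<in> par (CJ j)"
    have "j \<notin> I1" using j by (simp add: E8_node_def)
    then have "card (insert j I1) = 8" "I1 \<subset> insert j I1" using card_I1 by auto
    then have "v1 (highest_root A (insert j I1)) \<in> pos_roots A"
      using all E8_node_type_E8[OF j] comm[OF j v(2)] c by blast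
    then show "nn (v1 (theta j))" using highest_theta[OF j] pos[OF j v(1)] by simp
  next
    fix J assume all: "\<forall>j. E8_node j \<longrightarrow> v2 \<in> par (CJ j) \<longrightarrow> nn (v1 (theta j))"
      and J: "card J = 8 \<and> I1 \<subset> J \<and> type_E 8 A J \<and> (\<forall>s\<in>J. \<forall>t\<in>supp A v2. commuting A s t)"
    obtain j where j: "E8_node j" "J = insert j I1" using type_E8_E8_node J by blast
    then have "nn (v1 (theta j))" using all comm[OF j(1) v(2)] J by blast
    then show "v1 (highest_root A J) \<in> pos_roots A"
      using highest_theta[OF j(1)] pos[OF j(1) v(1)] j(2) by simp
  qed
  then show ?thesis unfolding valid_pairs_def by blast
qed

section \<open>Valid pairs\<close>

abbreviation "valid \<equiv> valid_pairs A I1"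

fun wt :: "'s weyl_elt \<times> 's weyl_elt \<Rightarrow> 's weyl_elt" where
  "wt (v1, v2) = v1 \<circ> v2 \<circ> w0 \<circ> winv v1"

lemma I12_commute: "x \<in> par I1 \<Longrightarrow> y \<in> par I2 \<Longrightarrow> x \<circ> y = y \<circ> x"
  by (rule parabolic_commute) (auto intro: I2_zero)

text \<open>On the roots of \<open>I1\<close> the element \<open>w0\<close> is -1, hence it commutes
  with each reflection there; with \<open>I2\<close> it commutes because the two sets of generators
  do.\<close>

lemma w0_commute: assumes "u \<in> par II" shows "w0 \<circ> u = u \<circ> w0"
proof -
  obtain ss where "u = wp ss" "set ss \<subseteq> II" using assms by (rule parabolicE)
  moreover have "set ss \<subseteq> II \<Longrightarrow> w0 \<circ> wp ss = wp ss \<circ> w0" for ss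
  proof (induction ss)
    case (Cons s ss)
    have "w0 \<circ> sr s = sr s \<circ> w0"
    proof (cases "s \<in> I1")
      case True then show ?thesis using neg_commute[OF w0_W w0(2)] sr_parabolic by blast
    next
      case False then show ?thesis using Cons.prems I12_commute[OF w0(1)] sr_parabolic by auto
    qed
    note e = this
    have IH: "w0 \<circ> wp ss = wp ss \<circ> w0" by (rule Cons.IH) (use Cons.prems in simp)
    have "w0 \<circ> wp (s # ss) = (w0 \<circ> sr s) \<circ> wp ss" by (simp only: wp_Cons comp_assoc)
    also have "\<dots> = sr s \<circ> (w0 \<circ> wp ss)" unfolding e by (simp only: comp_assoc)
    also have "\<dots> = wp (s # ss) \<circ> w0" unfolding IH by (simp only: wp_Cons comp_assoc)
    finally show ?case .
  qed simp
  ultimately show ?thesis by simp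
qed

lemma w0_involution: "w0 \<circ> w0 = id"
  by (rule neg_involution[OF w0(1)]) (rule w0(2))

lemma par_II_decomp:
  assumes "u \<in> par II" obtains u1 u2 where "u1 \<in> par I1" "u2 \<in> par I2" "u = u1 \<circ> u2"
proof -
  obtain ss where "u = wp ss" "set ss \<subseteq> II" using assms by (rule parabolicE)
  moreover have "set ss \<subseteq> II \<Longrightarrow> \<exists>u1\<in>par I1. \<exists>u2\<in>par I2. wp ss = u1 \<circ> u2" for ss
  proof (induction ss)
    case Nil then show ?case using id_parabolic by (intro bexI[of _ id]) auto
  next
    case (Cons s ss)
    then have "set ss \<subseteq> II" by simp
    then obtain u1 u2 where u: "u1 \<in> par I1" "u2 \<in> par I2" "wp ss = u1 \<circ> u2" using Cons.IH by blast
    show ?case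
    proof (cases "s \<in> I1")
      case True
      have "wp (s # ss) = (sr s \<circ> u1) \<circ> u2" using u(3) by (metis comp_assoc wp_Cons)
      then show ?thesis using u True comp_parabolic sr_parabolic by blast
    next
      case False
      then have s: "sr s \<in> par I2" using Cons.prems sr_parabolic by auto
      have "sr s \<circ> u1 = u1 \<circ> sr s" using I12_commute[OF u(1) s] by simp
      then have "wp (s # ss) = u1 \<circ> (sr s \<circ> u2)" using u(3) by (metis comp_assoc wp_Cons)
      then show ?thesis using u s comp_parabolic by blast
    qed
  qed
  ultimately show ?thesis using that by blast
qed

lemma par_I1_II: "x \<in> par I1 \<Longrightarrow> x \<in> par II" and par_I2_II: "x \<in> par I2 \<Longrightarrow> x \<in> par II"
  using parabolic_mono[of I1 II] parabolic_mono[of I2 II] by blast+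

lemma mcr_par_id: assumes "v \<in> mcr K" "v \<in> par K" shows "v = id"
proof (rule ccontr)
  assume "v \<noteq> id"
  obtain ss where ss: "reduced_word A v ss" "set ss \<subseteq> K" using assms(2) by (rule parabolic_reduced)
  then have "ss \<noteq> []" using \<open>v \<noteq> id\<close> by (auto simp: reduced_word_def)
  then obtain rs s where "ss = rs @ [s]" by (metis rev_exhaust)
  then have "\<not> nn (v (\<alpha> s))" "s \<in> K" using ss reduced_snocD(2) by auto
  then show False using assms(1) by (auto simp: mcr_iff)
qed

text \<open>By \<open>sr_pos\<close>, multiplying by \<open>sr s\<close> can spoil the positivity of
  \<open>v1 (theta j)\<close> only if that root is \<open>\<alpha> s\<close>.\<close>

lemma invalid_step:
  assumes "(v1, v2) \<in> valid" "sr s \<circ> v1 \<in> mcr II" "(sr s \<circ> v1, v2) \<notin> valid"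
  obtains j where "E8_node j" "v2 \<in> par (CJ j)" "v1 (theta j) = \<alpha> s"
proof -
  obtain j where j: "E8_node j" "v2 \<in> par (CJ j)" "\<not> nn (sr s (v1 (theta j)))"
    using assms unfolding valid_iff by auto
  moreover have "nn (v1 (theta j))" using assms(1) j unfolding valid_iff by blast
  moreover have "v1 (theta j) \<in> \<Phi>" using assms(1) j mcr_W unfolding valid_iff by auto
  ultimately show ?thesis using that sr_pos by blast
qed

text \<open>Factors \<open>sr t\<close> do not affect membership in \<open>par (CJ j)\<close> when
  \<open>t\<close> commutes with \<open>j\<close>; when it does not,
  \<open>not_nn_theta_commutes\<close> shows \<open>v1 (theta j)\<close> to be positive, so that
  \<open>j\<close> imposes no condition.\<close>

lemma valid_sr_I2:
  assumes v: "v1 \<in> mcr II" "t \<in> I2" "v1 (\<alpha> t) = \<alpha> s" and x: "x \<in> {id, sr t}" "y \<in> {id, sr t}"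
  shows "(v1, x \<circ> v2 \<circ> y) \<in> valid \<longleftrightarrow> (v1, v2) \<in> valid"
proof -
  have xx: "x \<circ> x = id" "y \<circ> y = id" using x by auto
  have iff: "x \<circ> v2 \<circ> y \<in> par K \<longleftrightarrow> v2 \<in> par K" if "t \<in> K" for K
  proof -
    have xy: "x \<in> par K" "y \<in> par K" using x sr_parabolic[OF that] by auto
    have "x \<circ> (x \<circ> v2 \<circ> y) \<circ> y = v2" using xx by (metis comp_assoc comp_id id_comp)
    then show ?thesis using xy comp_parabolic by metis
  qed
  have "nn (v1 (theta j)) \<or> (x \<circ> v2 \<circ> y \<in> par (CJ j) \<longleftrightarrow> v2 \<in> par (CJ j))" if "E8_node j" for j
    using iff[of "CJ j"] not_nn_theta_commutes[OF v(2) that mcr_W[OF v(1)] v(3)] v(2) by (auto simp: CJ_def)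
  then show ?thesis unfolding valid_iff using iff[OF v(2)] by blast
qed

text \<open>\<open>phi s\<close> lifts conjugation by \<open>s\<close> through \<open>wt\<close>.\<close>

fun phi :: "'s \<Rightarrow> 's weyl_elt \<times> 's weyl_elt \<Rightarrow> 's weyl_elt \<times> 's weyl_elt" where
  "phi s (v1, v2) =
     (if sr s \<circ> v1 \<in> mcr II then (if (sr s \<circ> v1, v2) \<in> valid then (sr s \<circ> v1, v2) else (v1, v2))
      else (v1, (winv v1 \<circ> sr s \<circ> v1) \<circ> v2 \<circ> (winv v1 \<circ> sr s \<circ> v1)))"

lemma phi:
  assumes "p \<in> valid"
  shows "phi s p \<in> valid" "phi s (phi s p) = p" "wt (phi s p) = sr s \<circ> wt p \<circ> sr s"
proof -
  obtain v1 v2 where p: "p = (v1, v2)" by fastforce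
  have v: "v1 \<in> mcr II" "v2 \<in> par I2" using assms unfolding p valid_iff by auto
  have W: "v1 \<in> W" "v2 \<in> W" using v mcr_W parabolic_W by auto
  have "phi s p \<in> valid \<and> phi s (phi s p) = p \<and> wt (phi s p) = sr s \<circ> wt p \<circ> sr s"
  proof (cases "sr s \<circ> v1 \<in> mcr II")
    case True
    show ?thesis
    proof (cases "(sr s \<circ> v1, v2) \<in> valid")
      case T: True
      have "sr s \<circ> (sr s \<circ> v1) = v1" by simp
      then have "phi s (sr s \<circ> v1, v2) = (v1, v2)" using v assms unfolding p phi.simps by metis
      moreover have "wt (sr s \<circ> v1, v2) = sr s \<circ> wt (v1, v2) \<circ> sr s"
        using W by (simp only: wt.simps inv_comp[OF sr_W W(1)] inv_sr comp_assoc)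
      ultimately show ?thesis using True T unfolding p by auto
    next
      case F: False
      then obtain j where j: "E8_node j" "v2 \<in> par (CJ j)" "v1 (theta j) = \<alpha> s"
        using invalid_step assms True unfolding p by metis
      \<comment> \<open>Here \<open>phi s\<close> fixes the pair. This lifts conjugation by
        \<open>sr s\<close> because \<open>g\<close> fixes \<open>v1 (theta j)\<close>, which is
        \<open>\<alpha> s\<close>, and hence commutes with \<open>sr s\<close>.\<close>
      define g where "g = wt (v1, v2)"
      have gW: "g \<in> W" using W by (simp add: g_def)
      have "winv v1 (\<alpha> s) = theta j" using j(3) W by (metis W_inv_left_apply)
      then have "g (\<alpha> s) = \<alpha> s" using w0_theta[OF j(1)] CJ_theta[OF j(1,2)] j(3) by (simp add: g_def)
      then have "g \<circ> sr s = sr s \<circ> g" by (rule reflection_eq[OF gW])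
      then have "sr s \<circ> g \<circ> sr s = g" by (metis comp_assoc sr_comp_self_assoc(1))
      moreover have "phi s p = p" using True F unfolding p by simp
      ultimately show ?thesis using assms p g_def by simp
    qed
  next
    case False
    then obtain t where t: "t \<in> II" "v1 (\<alpha> t) = \<alpha> s" using deodhar[OF v(1)] by blast
    have c: "v1 \<circ> sr t = sr s \<circ> v1" using reflection_eq[OF W(1) t(2)] .
    have "winv v1 \<circ> (v1 \<circ> sr t) = sr t" using W(1) by (simp add: comp_assoc[symmetric])
    then have T: "winv v1 \<circ> sr s \<circ> v1 = sr t" unfolding c by (simp only: comp_assoc)
    have ph: "phi s (v1, x) = (v1, sr t \<circ> x \<circ> sr t)" for x unfolding phi.simps T using False by simp
    have valid: "(v1, sr t \<circ> v2 \<circ> sr t) \<in> valid"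
    proof (cases "t \<in> I1")
      case True
      then have "sr t \<circ> v2 = v2 \<circ> sr t" using I12_commute[OF sr_parabolic v(2)] by blast
      then have "sr t \<circ> v2 \<circ> sr t = v2" by (metis comp_assoc sr_comp_self_assoc(1))
      then show ?thesis using assms p by simp
    next
      case False
      then have "t \<in> I2" using t by blast
      then show ?thesis using valid_sr_I2[OF v(1) _ t(2), of "sr t" "sr t" v2] assms p by simp
    qed
    have "sr t \<circ> (sr t \<circ> v2 \<circ> sr t) \<circ> sr t = v2" by (metis comp_assoc sr_comp_self_assoc(1) sr_comp_self id_comp)
    then have inv: "phi s (phi s p) = p" unfolding p ph by simp
    have w0t: "sr t \<circ> w0 = w0 \<circ> sr t" using w0_commute[OF sr_parabolic[OF t(1)]] by simp
    have ct: "sr t \<circ> winv v1 = winv v1 \<circ> sr s"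
      using c inv_comp[OF W(1) sr_W[of t]] inv_comp[OF sr_W[of s] W(1)] by (metis inv_sr)
    have "wt (v1, sr t \<circ> v2 \<circ> sr t) = (v1 \<circ> sr t) \<circ> v2 \<circ> (sr t \<circ> w0) \<circ> winv v1"
      by (simp only: wt.simps comp_assoc)
    also have "\<dots> = sr s \<circ> v1 \<circ> v2 \<circ> w0 \<circ> (sr t \<circ> winv v1)"
      unfolding c w0t by (simp only: comp_assoc)
    also have "\<dots> = sr s \<circ> wt (v1, v2) \<circ> sr s"
      unfolding ct by (simp only: wt.simps comp_assoc)
    finally have "wt (v1, sr t \<circ> v2 \<circ> sr t) = sr s \<circ> wt (v1, v2) \<circ> sr s" .
    then show ?thesis using valid inv unfolding p ph by simp
  qed
  then show "phi s p \<in> valid" "phi s (phi s p) = p" "wt (phi s p) = sr s \<circ> wt p \<circ> sr s" by auto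
qed

text \<open>Let \<open>b'\<close> be the minimal representative of the double coset of
  \<open>v1\<close>. The equation forces \<open>b'\<close> to send every letter of
  \<open>v2' \<circ> w0\<close> to a simple root. If \<open>b'\<close> were not the identity,
  \<open>normalizer_descent\<close> would make some \<open>theta j\<close> negative under
  \<open>b'\<close>; the parabolic factor \<open>a\<close> cannot undo this, and validity is
  violated.\<close>

lemma valid_over_w0:
  assumes valid: "(v1, v2') \<in> valid" and v2: "v2 \<in> par I2" and eq: "v2 \<circ> w0 \<circ> v1 = v1 \<circ> (v2' \<circ> w0)"
  shows "v1 = id \<and> v2' = v2"
proof -
  have v: "v1 \<in> mcr II" "v2' \<in> par I2" using valid unfolding valid_iff by auto
  obtain a b' where ab: "v1 = a \<circ> b'" "a \<in> par II" "b' \<in> mcr II" "winv b' \<in> mcr II"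
    using double_coset_rep[OF v(1)] by blast
  have W: "a \<in> W" "b' \<in> W" "v2 \<in> W" "v2' \<in> W" using ab v v2 parabolic_W mcr_W by auto
  define g where "g = winv a \<circ> (v2 \<circ> w0) \<circ> a"
  have g: "g \<in> par II" unfolding g_def
    using ab(2) v2 w0(1) by (intro comp_parabolic inv_parabolic) (auto intro: par_I1_II par_I2_II)
  have g': "v2' \<circ> w0 \<in> par II" using v(2) w0(1) comp_parabolic par_I1_II par_I2_II by blast
  have gb: "g \<circ> b' = b' \<circ> (v2' \<circ> w0)"
  proof -
    have "a \<circ> (g \<circ> b') = v2 \<circ> w0 \<circ> v1" unfolding g_def ab(1) using W(1) by (metis W_inv_right comp_assoc id_comp)
    also note eq
    also have "v1 \<circ> (v2' \<circ> w0) = a \<circ> (b' \<circ> (v2' \<circ> w0))" unfolding ab(1) by (simp only: comp_assoc)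
    finally show ?thesis using W_cancel_left[OF W(1)] by blast
  qed
  obtain ss where ss: "reduced_word A (v2' \<circ> w0) ss" using reduced_exists[of "v2' \<circ> w0"] W by auto
  define K where "K = set ss"
  have gK: "v2' \<circ> w0 \<in> par K" using ss wp_in_parabolic[of ss K] by (auto simp: K_def reduced_word_def)
  have simple: "\<exists>r. b' (\<alpha> k) = \<alpha> r" if "k \<in> K" for k
    using double_coset_simple[OF ab(3,4) g g' gb ss] that K_def by metis
  \<comment> \<open>A letter \<open>k\<close> of \<open>I1\<close> missing from the word would leave
    the coefficient of \<open>\<alpha> k\<close> at \<open>k\<close> unchanged, but
    \<open>v2' \<circ> w0\<close> negates \<open>\<alpha> k\<close>.\<close>
  have I1K: "I1 \<subseteq> K"
  proof
    fix k assume k: "k \<in> I1"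
    show "k \<in> K"
    proof (rule ccontr)
      assume "k \<notin> K"
      then have "(v2' \<circ> w0) (\<alpha> k) k = 1" using parabolic_coeff[OF gK] by simp
      moreover have "v2' (\<alpha> k) = \<alpha> k" using parabolic_fix[OF v(2)] I2_zero k by simp
      ultimately show False using w0(2)[OF k] W by (simp add: W_uminus vec)
    qed
  qed
  have "v2' = (v2' \<circ> w0) \<circ> w0" using w0_involution by (metis comp_assoc comp_id)
  moreover have "w0 \<in> par K" using w0(1) parabolic_mono[OF I1K] by blast
  ultimately have "v2' \<in> par K" using gK comp_parabolic by metis
  then have v2K: "v2' \<in> par (K \<inter> I2)" using v(2) supp_subset_iff[OF W(4)] by (metis Int_subset_iff)
  have "b' = id"
  proof (rule ccontr)
    assume "b' \<noteq> id"
    then obtain j where j: "E8_node j" "\<not> nn (b' (theta j))"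
      using normalizer_descent[OF ab(3)] simple I1K by blast
    \<comment> \<open>Each such letter goes to a simple root under \<open>b'\<close> while
      \<open>theta j\<close> becomes negative, so it commutes with \<open>j\<close>; thus
      \<open>v2'\<close> falls under the validity condition for \<open>j\<close>.\<close>
    have "K \<inter> I2 \<subseteq> CJ j"
      using not_nn_theta_commutes[OF _ j(1) W(2) _ j(2)] simple by (fastforce simp: CJ_def)
    then have "v2' \<in> par (CJ j)" using v2K parabolic_mono by blast
    then have pos: "nn (v1 (theta j))" using valid j(1) unfolding valid_iff by blast
    define \<beta> where "\<beta> = - b' (theta j)"
    have \<beta>: "\<beta> \<in> \<Phi>" "nn \<beta>"
      using root_nn_or_neg[of "b' (theta j)"] j W(2) by (auto simp: \<beta>_def)
    have inv\<beta>: "winv b' \<beta> = - theta j" using W(2) by (simp add: \<beta>_def W_uminus)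
    \<comment> \<open>A positive root supported in \<open>II\<close> would stay positive under the
      minimal element \<open>winv b'\<close>, which sends \<open>\<beta>\<close> to
      \<open>- theta j\<close>. The coordinate outside \<open>II\<close> survives under
      \<open>a\<close>.\<close>
    have "\<exists>u. u \<notin> II \<and> \<beta> u \<noteq> 0"
    proof (rule ccontr)
      assume "\<nexists>u. u \<notin> II \<and> \<beta> u \<noteq> 0"
      then have "nn (winv b' \<beta>)" using mcr_nn[OF ab(4) \<beta>(2)] by blast
      then show False using inv\<beta> root_not_both[OF theta_root[OF j(1)] theta_nn] by simp
    qed
    then have "nn (a \<beta>)" using parabolic_off_nn[OF ab(2) \<beta>] by blast
    moreover have "a \<beta> = - v1 (theta j)" using W by (simp add: \<beta>_def ab(1) W_uminus)
    ultimately show False using root_not_both[of "v1 (theta j)"] pos W j(1) by (auto simp: ab(1))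
  qed
  then have "v1 \<in> par II" using ab by simp
  then have "v1 = id" using mcr_par_id[OF v(1)] by blast
  moreover from this have "v2 = v2'" using eq W_cancel_right[OF w0_W] by auto
  ultimately show ?thesis by simp
qed

lemma wt_eq_iff: assumes "v1 \<in> W" shows "w = wt (v1, v2) \<longleftrightarrow> w \<circ> v1 = v1 \<circ> (v2 \<circ> w0)"
proof
  assume w: "w = wt (v1, v2)"
  have "w \<circ> v1 = v1 \<circ> (v2 \<circ> w0) \<circ> (winv v1 \<circ> v1)" unfolding w by (simp only: wt.simps comp_assoc)
  then show "w \<circ> v1 = v1 \<circ> (v2 \<circ> w0)" using assms by simp
next
  assume w: "w \<circ> v1 = v1 \<circ> (v2 \<circ> w0)"
  have "w = (w \<circ> v1) \<circ> winv v1" using assms by (simp add: comp_assoc)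
  then show "w = wt (v1, v2)" unfolding w by (simp only: wt.simps comp_assoc)
qed

text \<open>Induction on the length of the first component. For a left descent \<open>s\<close> of
  \<open>v1\<close>, the pair with \<open>sr s \<circ> v1\<close> is again valid: otherwise
  \<open>winv v1 (\<alpha> s)\<close> would be a simple root or some \<open>theta j\<close>, hence
  positive. So \<open>phi s\<close> shortens the first pair, and it conjugates both weights in the
  same way.\<close>

theorem valid_unique:
  assumes "p \<in> valid" "p' \<in> valid" "wt p = wt p'"
  shows "p = p'"
  using assms
proof (induction "ell (fst p)" arbitrary: p p' rule: less_induct)
  case less
  obtain v1 v2 where p: "p = (v1, v2)" by fastforce
  have v: "v1 \<in> mcr II" "v2 \<in> par I2" using less.prems unfolding p valid_iff by auto
  have W: "v1 \<in> W" using v mcr_W by auto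
  show ?case
  proof (cases "v1 = id")
    case True
    obtain u1 u2 where p': "p' = (u1, u2)" by fastforce
    have u: "u1 \<in> W" using less.prems mcr_W unfolding p' valid_iff by auto
    have "wt p = v2 \<circ> w0" unfolding p True by (simp add: inv_id[unfolded id_def] fun_eq_iff)
    then have "v2 \<circ> w0 \<circ> u1 = u1 \<circ> (u2 \<circ> w0)"
      using wt_eq_iff[OF u] less.prems(3) unfolding p' by metis
    then have "u1 = id \<and> u2 = v2" using valid_over_w0[OF _ v(2)] less.prems(2) unfolding p' by blast
    then show ?thesis unfolding p p' True by blast
  next
    case False
    then obtain s where s: "ell (winv v1 \<circ> sr s) < ell (winv v1)"
      using last_letter[of "winv v1"] W by (metis inv_W inv_id inv_inv_W)
    then have neg: "\<not> nn (winv v1 (\<alpha> s))" using len_right_iff[of "winv v1" s] W by simp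
    have "sr s \<circ> v1 \<in> mcr II"
    proof (rule ccontr)
      assume "sr s \<circ> v1 \<notin> mcr II"
      then obtain t where "v1 (\<alpha> t) = \<alpha> s" using deodhar[OF v(1)] by blast
      then have "winv v1 (\<alpha> s) = \<alpha> t" using W by (metis W_inv_left_apply)
      then show False using neg nn_simple by simp
    qed
    moreover have "(sr s \<circ> v1, v2) \<in> valid"
    proof (rule ccontr)
      assume "(sr s \<circ> v1, v2) \<notin> valid"
      then obtain j where "v1 (theta j) = \<alpha> s" using invalid_step calculation less.prems(1) p by metis
      then have "winv v1 (\<alpha> s) = theta j" using W by (metis W_inv_left_apply)
      then show False using neg theta_nn by simp
    qed
    ultimately have ph: "phi s p = (sr s \<circ> v1, v2)" unfolding p by simp
    have "ell (sr s \<circ> v1) < ell v1"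
      using s W len_inv[of "sr s \<circ> v1"] len_inv[OF W] by (simp add: inv_comp)
    then have "phi s p = phi s p'"
      using less.hyps[of "phi s p" "phi s p'"] phi[OF less.prems(1), of s] phi[OF less.prems(2), of s]
        less.prems(3) ph p by simp
    then show ?thesis using phi(2)[OF less.prems(1), of s] phi(2)[OF less.prems(2), of s] by metis
  qed
qed

text \<open>If the minimal representative \<open>v1\<close> is invalid because of \<open>j\<close>,
  multiply it by the reflection in \<open>theta j\<close>. This commutes with
  \<open>w2' \<circ> w0\<close>, so the conjugate is unchanged, and it shortens \<open>v1\<close>
  because \<open>v1 (theta j)\<close> is negative. The conjugating element \<open>y\<close> is
  recorded for the later comparison of the values of \<open>f\<close> at \<open>v2\<close> and
  \<open>w2\<close>.\<close>

theorem valid_exists: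
  assumes "w2 \<in> par I2" "x \<in> W"
  shows "\<exists>v1 v2 y. (v1, v2) \<in> valid \<and> wt (v1, v2) = x \<circ> w2 \<circ> w0 \<circ> winv x \<and> y \<in> par I2 \<and> v2 = y \<circ> w2 \<circ> winv y"
  using assms
proof (induction "ell x" arbitrary: x w2 rule: less_induct)
  case less
  obtain v1 u where vu: "v1 \<in> mcr II" "u \<in> par II" "x = v1 \<circ> u" using coset_decomp less.prems(2) by blast
  obtain u1 u2 where u: "u1 \<in> par I1" "u2 \<in> par I2" "u = u1 \<circ> u2" using par_II_decomp[OF vu(2)] by blast
  have W: "v1 \<in> W" "u \<in> W" "u1 \<in> W" "u2 \<in> W" "w2 \<in> W"
    using vu u less.prems mcr_W parabolic_W by auto
  define w2' where "w2' = u2 \<circ> w2 \<circ> winv u2"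
  have w2': "w2' \<in> par I2" unfolding w2'_def
    using u(2) less.prems(1) by (intro comp_parabolic inv_parabolic)
  have "u \<circ> (w2 \<circ> w0) \<circ> winv u = w2' \<circ> w0"
  proof -
    have 1: "u1 \<circ> w2' = w2' \<circ> u1" by (rule I12_commute[OF u(1) w2'])
    have 2: "w0 \<circ> winv u2 = winv u2 \<circ> w0" by (rule w0_commute) (rule par_I2_II[OF inv_parabolic[OF u(2)]])
    have 3: "u1 \<circ> w0 = w0 \<circ> u1" using w0_commute[OF par_I1_II[OF u(1)]] by simp
    have "u \<circ> (w2 \<circ> w0) \<circ> winv u = u1 \<circ> (u2 \<circ> w2 \<circ> (w0 \<circ> winv u2)) \<circ> winv u1"
      unfolding u(3) inv_comp[OF W(3,4)] by (simp only: comp_assoc)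
    also have "\<dots> = (u1 \<circ> w2') \<circ> w0 \<circ> winv u1" unfolding 2 w2'_def by (simp only: comp_assoc)
    also have "\<dots> = w2' \<circ> (u1 \<circ> w0) \<circ> winv u1" unfolding 1 by (simp only: comp_assoc)
    also have "\<dots> = w2' \<circ> w0 \<circ> (u1 \<circ> winv u1)" unfolding 3 by (simp only: comp_assoc)
    finally show ?thesis using W by simp
  qed
  then have wt1: "x \<circ> w2 \<circ> w0 \<circ> winv x = wt (v1, w2')"
    unfolding vu(3) inv_comp[OF W(1,2)] wt.simps by (metis comp_assoc)
  show ?case
  proof (cases "(v1, w2') \<in> valid")
    case True
    then show ?thesis using wt1 u(2) w2'_def by metis
  next
    case False
    then obtain j where j: "E8_node j" "w2' \<in> par (CJ j)" "\<not> nn (v1 (theta j))"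
      using vu(1) w2' unfolding valid_iff by blast
    obtain y where y: "y \<in> par (insert j I1)" "theta j = y (\<alpha> j)" using theta_par j(1) by metis
    have yW: "y \<in> W" using y parabolic_W by blast
    define r where "r = y \<circ> sr j \<circ> winv y"
    have rW: "r \<in> W" using yW by (simp add: r_def)
    have rr: "r \<circ> r = id"
    proof -
      have "r \<circ> r = y \<circ> sr j \<circ> (winv y \<circ> y) \<circ> sr j \<circ> winv y" unfolding r_def by (simp only: comp_assoc)
      then show ?thesis using yW by simp
    qed
    have short: "ell (v1 \<circ> r) < ell v1"
      using reflection_shorter[OF W(1) yW, of j] y(2) theta_nn[of j] j(3) by (simp add: r_def comp_assoc)
    have "ell v1 \<le> ell x" using len_coset_add[OF vu(1,2)] vu(3) by simp
    then have lt: "ell (v1 \<circ> r) < ell x" using short by simp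
    define g where "g = w2' \<circ> w0"
    have gW: "g \<in> W" using w2' parabolic_W by (simp add: g_def)
    have "g (y (\<alpha> j)) = y (\<alpha> j)"
      using w0_theta[OF j(1)] CJ_theta[OF j(1,2)] by (simp add: g_def y(2)[symmetric])
    then have "(winv y \<circ> g \<circ> y) (\<alpha> j) = \<alpha> j" using yW by simp
    moreover have "winv y \<circ> g \<circ> y \<in> W" using gW yW by simp
    ultimately have c: "winv y \<circ> g \<circ> y \<circ> sr j = sr j \<circ> (winv y \<circ> g \<circ> y)"
      using reflection_eq[of "winv y \<circ> g \<circ> y" j j] by blast
    have gr: "g \<circ> r = r \<circ> g"
    proof -
      have "g \<circ> r = y \<circ> (winv y \<circ> g \<circ> y \<circ> sr j) \<circ> winv y" using yW
        unfolding r_def by (metis W_inv_right comp_assoc id_comp)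
      also have "\<dots> = r \<circ> g" using yW unfolding c r_def by (metis W_inv_right comp_assoc comp_id)
      finally show ?thesis .
    qed
    have "winv r = r" using rr by (rule inv_unique_comp) (rule rr)
    then have "wt (v1 \<circ> r, w2') = v1 \<circ> (r \<circ> g \<circ> r) \<circ> winv v1"
      unfolding wt.simps inv_comp[OF W(1) rW] g_def by (simp only: comp_assoc)
    also have "r \<circ> g \<circ> r = g" using gr rr by (metis comp_assoc comp_id)
    finally have eq: "v1 \<circ> r \<circ> w2' \<circ> w0 \<circ> winv (v1 \<circ> r) = x \<circ> w2 \<circ> w0 \<circ> winv x"
      unfolding wt1 by (simp only: wt.simps g_def comp_assoc)
    obtain z1 z2 z where z: "(z1, z2) \<in> valid" "wt (z1, z2) = x \<circ> w2 \<circ> w0 \<circ> winv x"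
        "z \<in> par I2" "z2 = z \<circ> w2' \<circ> winv z"
      using less.hyps[OF lt w2'] W(1) rW eq by (metis comp_W)
    have zW: "z \<in> W" using z(3) parabolic_W by blast
    have "z2 = (z \<circ> u2) \<circ> w2 \<circ> winv (z \<circ> u2)"
      unfolding z(4) w2'_def inv_comp[OF zW W(4)] by (simp only: comp_assoc)
    then show ?thesis using z comp_parabolic[OF z(3) u(2)] by blast
  qed
qed

end

lemma qpow_mult: "qpow a * qpow b = qpow (a + b)"
  by (simp add: qpow_def mult_single)

lemma qpow_0 [simp]: "qpow 0 = 1"
  by (simp add: qpow_def)

context gcm
begin

section \<open>The two-sided regular representation\<close>

text \<open>A function \<open>m\<close> on \<open>W\<close> stands for \<open>\<Sum>\<^sub>w m(w) T\<^sub>w\<close>; \<open>lam s\<close> and \<open>rho s\<close> are left and right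
  multiplication by \<open>T\<^sub>s\<close>.\<close>

definition lam :: "'s \<Rightarrow> ('s weyl_elt \<Rightarrow> laurent) \<Rightarrow> 's weyl_elt \<Rightarrow> laurent" where
  "lam s m = (\<lambda>w. if w \<notin> W then 0
     else if ell w < ell (sr s \<circ> w) then qvar * m (sr s \<circ> w) else m (sr s \<circ> w) + (qvar - 1) * m w)"

definition rho :: "'s \<Rightarrow> ('s weyl_elt \<Rightarrow> laurent) \<Rightarrow> 's weyl_elt \<Rightarrow> laurent" where
  "rho s m = (\<lambda>w. if w \<notin> W then 0
     else if ell w < ell (w \<circ> sr s) then qvar * m (w \<circ> sr s) else m (w \<circ> sr s) + (qvar - 1) * m w)"

definition dl :: "'s weyl_elt \<Rightarrow> 's weyl_elt \<Rightarrow> laurent" where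
  "dl x = (\<lambda>w. if w = x then 1 else 0)"

lemma lam_add: "lam s (m + n) = lam s m + lam s n"
  and lam_smul: "lam s (c \<cdot> m) = c \<cdot> lam s m"
  and rho_add: "rho s (m + n) = rho s m + rho s n"
  and rho_smul: "rho s (c \<cdot> m) = c \<cdot> rho s m"
  by (rule ext, simp add: lam_def rho_def vec algebra_simps)+

lemma len_right_cases:
  assumes "w \<in> W"
  shows "ell (w \<circ> sr s) = ell w + 1 \<or> ell w = ell (w \<circ> sr s) + 1"
  using len_right_pos[OF assms] len_right_neg[OF assms] by blast

lemma len_left:
  assumes "w \<in> W"
  shows "ell (sr s \<circ> w) = ell (winv w \<circ> sr s)"
  using len_inv[of "sr s \<circ> w"] assms by (simp add: inv_comp)

lemma len_left_cases:
  assumes "w \<in> W"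
  shows "ell (sr s \<circ> w) = ell w + 1 \<or> ell w = ell (sr s \<circ> w) + 1"
  using len_right_cases[of "winv w" s] assms by (simp add: len_left)

lemma len_left_pos: "w \<in> W \<Longrightarrow> nn (winv w (\<alpha> s)) \<Longrightarrow> ell (sr s \<circ> w) = ell w + 1"
  using len_right_pos[of "winv w" s] by (simp add: len_left)

text \<open>The letter \<open>t\<close> lengthens \<open>w\<close> but shortens
  \<open>sr s \<circ> w\<close>, so \<open>sr s\<close> turns the positive root
  \<open>w (\<alpha> t)\<close> negative, and this root must be \<open>\<alpha> s\<close>.\<close>

lemma exotic:
  assumes w: "w \<in> W" and l: "ell w < ell (w \<circ> sr t)" "ell (sr s \<circ> (w \<circ> sr t)) < ell (sr s \<circ> w)"
  shows "sr s \<circ> w = w \<circ> sr t"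
proof -
  have "nn (w (\<alpha> t))" using l(1) len_right_iff[OF w] by blast
  moreover have "\<not> nn (sr s (w (\<alpha> t)))"
    using l(2) len_right_iff[of "sr s \<circ> w" t] w by (metis comp_W comp_apply comp_assoc less_asym sr_W)
  ultimately have "w (\<alpha> t) = \<alpha> s" using sr_pos[of "w (\<alpha> t)" s] w by auto
  then show ?thesis using reflection_eq[OF w] by simp
qed

text \<open>The heart of associativity. Among \<open>w\<close>, \<open>sr s \<circ> w\<close>,
  \<open>w \<circ> sr t\<close> and \<open>sr s \<circ> (w \<circ> sr t)\<close>, the length
  comparisons for the left and the right letter are independent of each other except when
  \<open>sr s \<circ> w = w \<circ> sr t\<close>, where both sides agree outright.\<close>

lemma lam_rho: "lam s (rho t m) = rho t (lam s m)"
proof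
  fix w
  show "lam s (rho t m) w = rho t (lam s m) w"
  proof (cases "w \<in> W")
    case False then show ?thesis by (simp add: lam_def rho_def)
  next
    case w: True
    define x y z where "x = sr s \<circ> w" and "y = w \<circ> sr t" and "z = sr s \<circ> (w \<circ> sr t)"
    have xz: "x \<circ> sr t = z" and yz: "sr s \<circ> y = z" by (simp_all add: x_def y_def z_def comp_assoc)
    have W: "x \<in> W" "y \<in> W" "z \<in> W" using w by (simp_all add: x_def y_def z_def)
    have l: "ell x = ell w + 1 \<or> ell w = ell x + 1" "ell y = ell w + 1 \<or> ell w = ell y + 1"
      "ell z = ell x + 1 \<or> ell x = ell z + 1" "ell z = ell y + 1 \<or> ell y = ell z + 1"
      using len_left_cases[OF w, of s] len_right_cases[OF w, of t] len_right_cases[OF W(1), of t]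
        len_left_cases[OF W(2), of s] by (simp_all add: xz yz, simp_all add: x_def y_def)
    have e1: "x = y" if "ell w < ell y" "ell z < ell x"
      using exotic[OF w, of t s] that by (simp add: x_def y_def z_def)
    have e2: "x = y" if "ell y < ell w" "ell x < ell z"
    proof -
      have yt: "y \<circ> sr t = w" by (simp add: y_def)
      have st: "sr s \<circ> (y \<circ> sr t) = x" using yt by (simp add: x_def)
      have "sr s \<circ> y = y \<circ> sr t" using exotic[OF W(2), of t s] that yt st yz by metis
      then have "z = w" using yt yz by simp
      then show ?thesis using that l by (metis xz yt comp_assoc sr_comp_self_assoc(1))
    qed
    have L: "lam s (rho t m) w =
        (if ell w < ell x then qvar * rho t m x else rho t m x + (qvar - 1) * rho t m w)"
      using w by (simp add: lam_def x_def)
    have R: "rho t (lam s m) w =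
        (if ell w < ell y then qvar * lam s m y else lam s m y + (qvar - 1) * lam s m w)"
      using w by (simp add: rho_def y_def)
    have rx: "rho t m x = (if ell x < ell z then qvar * m z else m z + (qvar - 1) * m x)"
      using W by (simp add: rho_def xz)
    have rw: "rho t m w = (if ell w < ell y then qvar * m y else m y + (qvar - 1) * m w)"
      using w by (simp add: rho_def y_def)
    have ly: "lam s m y = (if ell y < ell z then qvar * m z else m z + (qvar - 1) * m y)"
      using W by (simp add: lam_def yz)
    have lw: "lam s m w = (if ell w < ell x then qvar * m x else m x + (qvar - 1) * m w)"
      using w by (simp add: lam_def x_def)
    show ?thesis
    proof (cases "ell w < ell y \<and> ell z < ell x \<or> ell y < ell w \<and> ell x < ell z")
      case True
      then have "x = y" using e1 e2 by blast
      then show ?thesis unfolding L R rx rw ly lw by simp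
    next
      case False
      then have c: "ell x < ell z \<longleftrightarrow> ell w < ell y" "ell y < ell z \<longleftrightarrow> ell w < ell x" using l by linarith+
      show ?thesis unfolding L R rx rw ly lw c by (simp add: algebra_simps)
    qed
  qed
qed

definition supported :: "('s weyl_elt \<Rightarrow> laurent) \<Rightarrow> bool" where
  "supported m \<longleftrightarrow> (\<forall>w. w \<notin> W \<longrightarrow> m w = 0)"

lemma supported_lam [simp]: "supported (lam s m)" and supported_rho [simp]: "supported (rho s m)"
  by (simp_all add: supported_def lam_def rho_def)

lemma supported_dl [simp]: "x \<in> W \<Longrightarrow> supported (dl x)"
  by (auto simp: supported_def dl_def)

lemma lam_quadratic:
  assumes "supported m" shows "lam s (lam s m) = (qvar - 1) \<cdot> lam s m + qvar \<cdot> m"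
proof
  fix w
  show "lam s (lam s m) w = ((qvar - 1) \<cdot> lam s m + qvar \<cdot> m) w"
  proof (cases "w \<in> W")
    case False then show ?thesis using assms by (simp add: lam_def supported_def vec)
  next
    case True
    then have "ell (sr s \<circ> w) < ell w \<longleftrightarrow> \<not> ell w < ell (sr s \<circ> w)"
      using len_left_cases[OF True, of s] by linarith
    then show ?thesis using True by (simp add: lam_def vec algebra_simps)
  qed
qed

lemma rho_quadratic:
  assumes "supported m" shows "rho s (rho s m) = (qvar - 1) \<cdot> rho s m + qvar \<cdot> m"
proof
  fix w
  show "rho s (rho s m) w = ((qvar - 1) \<cdot> rho s m + qvar \<cdot> m) w"
  proof (cases "w \<in> W")
    case False then show ?thesis using assms by (simp add: rho_def supported_def vec)
  next
    case True
    then have "ell (w \<circ> sr s) < ell w \<longleftrightarrow> \<not> ell w < ell (w \<circ> sr s)"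
      using len_right_cases[OF True, of s] by linarith
    then show ?thesis using True by (simp add: rho_def vec algebra_simps)
  qed
qed

lemma sr_left_eq: "sr s \<circ> w = x \<longleftrightarrow> w = sr s \<circ> x"
  and sr_right_eq: "w \<circ> sr s = x \<longleftrightarrow> w = x \<circ> sr s"
  by auto

lemma lam_dl:
  assumes "x \<in> W"
  shows "lam s (dl x) = (if ell x < ell (sr s \<circ> x) then dl (sr s \<circ> x)
            else qvar \<cdot> dl (sr s \<circ> x) + (qvar - 1) \<cdot> dl x)"
proof
  fix w
  have ne: "sr s \<circ> x \<noteq> x" using len_left_cases[OF assms, of s] by force
  have ss: "sr s \<circ> (sr s \<circ> x) = x" by simp
  consider "w = x" | "w = sr s \<circ> x" | "w \<noteq> x" "w \<noteq> sr s \<circ> x" by blast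
  then show "lam s (dl x) w = (if ell x < ell (sr s \<circ> x) then dl (sr s \<circ> x)
            else qvar \<cdot> dl (sr s \<circ> x) + (qvar - 1) \<cdot> dl x) w"
  proof cases
    case 1 then show ?thesis using ne assms by (simp add: lam_def dl_def vec)
  next
    case 2
    have "lam s (dl x) w = (if ell w < ell x then qvar else 1)"
      unfolding 2 lam_def ss using assms ne by (simp add: dl_def)
    moreover have "ell w < ell x \<longleftrightarrow> \<not> ell x < ell w"
      using len_left_cases[OF assms, of s] unfolding 2 by linarith
    ultimately show ?thesis using ne unfolding 2 by (simp add: dl_def vec)
  next
    case 3
    have "sr s \<circ> w \<noteq> x" using 3(2) sr_left_eq by metis
    then show ?thesis using 3 by (simp add: lam_def dl_def vec)
  qed
qed

lemma rho_dl:
  assumes "x \<in> W"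
  shows "rho s (dl x) = (if ell x < ell (x \<circ> sr s) then dl (x \<circ> sr s)
            else qvar \<cdot> dl (x \<circ> sr s) + (qvar - 1) \<cdot> dl x)"
proof
  fix w
  have ne: "x \<circ> sr s \<noteq> x" using len_right_cases[OF assms, of s] by force
  have ss: "x \<circ> sr s \<circ> sr s = x" by simp
  consider "w = x" | "w = x \<circ> sr s" | "w \<noteq> x" "w \<noteq> x \<circ> sr s" by blast
  then show "rho s (dl x) w = (if ell x < ell (x \<circ> sr s) then dl (x \<circ> sr s)
            else qvar \<cdot> dl (x \<circ> sr s) + (qvar - 1) \<cdot> dl x) w"
  proof cases
    case 1 then show ?thesis using ne assms by (simp add: rho_def dl_def vec)
  next
    case 2
    have "rho s (dl x) w = (if ell w < ell x then qvar else 1)"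
      unfolding 2 rho_def ss using assms ne by (simp add: dl_def)
    moreover have "ell w < ell x \<longleftrightarrow> \<not> ell x < ell w"
      using len_right_cases[OF assms, of s] unfolding 2 by linarith
    ultimately show ?thesis using ne unfolding 2 by (simp add: dl_def vec)
  next
    case 3
    have "w \<circ> sr s \<noteq> x" using 3(2) sr_right_eq by metis
    then show ?thesis using 3 by (simp add: rho_def dl_def vec)
  qed
qed

lemma lam_rho_dl_commute:
  assumes "x \<in> W" "sr s \<circ> x = x \<circ> sr s" shows "lam s (dl x) = rho s (dl x)"
  unfolding lam_dl[OF assms(1)] rho_dl[OF assms(1)] assms(2) ..

fun lamL :: "'s list \<Rightarrow> ('s weyl_elt \<Rightarrow> laurent) \<Rightarrow> 's weyl_elt \<Rightarrow> laurent" where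
  "lamL [] m = m"
| "lamL (s # ss) m = lam s (lamL ss m)"

fun rhoL :: "'s list \<Rightarrow> ('s weyl_elt \<Rightarrow> laurent) \<Rightarrow> 's weyl_elt \<Rightarrow> laurent" where
  "rhoL [] m = m"
| "rhoL (s # ss) m = rhoL ss (rho s m)"

lemma lamL_append: "lamL (xs @ ys) m = lamL xs (lamL ys m)"
  by (induction xs) auto

lemma rhoL_append: "rhoL (xs @ ys) m = rhoL ys (rhoL xs m)"
  by (induction xs arbitrary: m) auto

lemma lamL_add: "lamL ss (m + n) = lamL ss m + lamL ss n"
  and lamL_smul: "lamL ss (c \<cdot> m) = c \<cdot> lamL ss m"
  by (induction ss) (simp_all only: lamL.simps lam_add lam_smul)

lemma rhoL_add: "rhoL ss (m + n) = rhoL ss m + rhoL ss n"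
  and rhoL_smul: "rhoL ss (c \<cdot> m) = c \<cdot> rhoL ss m"
  by (induction ss arbitrary: m n) (simp_all only: rhoL.simps rho_add rho_smul)

lemma lamL_rho: "lamL ss (rho t m) = rho t (lamL ss m)"
  by (induction ss) (simp_all only: lamL.simps lam_rho)

lemma lamL_rhoL: "lamL ss (rhoL ts m) = rhoL ts (lamL ss m)"
  by (induction ts arbitrary: m) (simp_all only: rhoL.simps lamL_rho)

lemma supported_lamL: "supported m \<Longrightarrow> supported (lamL ss m)"
  by (cases ss) auto

lemma supported_rhoL: "supported m \<Longrightarrow> supported (rhoL ss m)"
  by (induction ss arbitrary: m) auto

lemma lamL_dl:
  "x \<in> W \<Longrightarrow> ell (wp ss \<circ> x) = length ss + ell x \<Longrightarrow> lamL ss (dl x) = dl (wp ss \<circ> x)"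
proof (induction ss)
  case (Cons s ss)
  have le: "ell (wp ss \<circ> x) \<le> length ss + ell x"
    using len_comp_le[of "wp ss" x] len_le[of ss "wp ss"] Cons.prems(1) by simp
  have eq: "wp (s # ss) \<circ> x = sr s \<circ> (wp ss \<circ> x)" by (simp only: wp_Cons comp_assoc)
  have "ell (sr s \<circ> (wp ss \<circ> x)) \<le> ell (wp ss \<circ> x) + 1"
    using len_left_cases[of "wp ss \<circ> x" s] Cons.prems(1) by auto
  then have l: "ell (wp ss \<circ> x) = length ss + ell x" "ell (wp ss \<circ> x) < ell (sr s \<circ> (wp ss \<circ> x))"
    using le Cons.prems(2)[unfolded eq length_Cons] by linarith+
  have "lamL ss (dl x) = dl (wp ss \<circ> x)" using Cons.IH[OF Cons.prems(1) l(1)] .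
  moreover have "lam s (dl (wp ss \<circ> x)) = dl (sr s \<circ> (wp ss \<circ> x))"
    using lam_dl[of "wp ss \<circ> x" s] l(2) Cons.prems(1) by simp
  ultimately show ?case by (simp only: lamL.simps eq)
qed simp

lemma rhoL_dl:
  "x \<in> W \<Longrightarrow> ell (x \<circ> wp ss) = length ss + ell x \<Longrightarrow> rhoL ss (dl x) = dl (x \<circ> wp ss)"
proof (induction ss arbitrary: x)
  case (Cons s ss)
  have eq: "x \<circ> wp (s # ss) = (x \<circ> sr s) \<circ> wp ss" by (simp only: wp_Cons comp_assoc)
  have le: "ell (x \<circ> wp (s # ss)) \<le> ell (x \<circ> sr s) + length ss"
    unfolding eq using len_comp_le[of "x \<circ> sr s" "wp ss"] len_le[of ss "wp ss"] Cons.prems(1) by simp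
  then have l: "ell (x \<circ> sr s) = ell x + 1"
    using len_right_cases[OF Cons.prems(1), of s] Cons.prems(2)[unfolded length_Cons] by linarith
  have "rho s (dl x) = dl (x \<circ> sr s)" using rho_dl[OF Cons.prems(1), of s] l by simp
  moreover have "rhoL ss (dl (x \<circ> sr s)) = dl (x \<circ> sr s \<circ> wp ss)"
  proof (rule Cons.IH)
    show "x \<circ> sr s \<in> W" using Cons.prems(1) by simp
    show "ell (x \<circ> sr s \<circ> wp ss) = length ss + ell (x \<circ> sr s)"
      using Cons.prems(2)[unfolded eq length_Cons] l by linarith
  qed
  ultimately show ?case by (simp only: rhoL.simps eq)
qed simp

definition rw :: "'s weyl_elt \<Rightarrow> 's list" where
  "rw w = (SOME ss. reduced_word A w ss)"

lemma rw_reduced: "w \<in> W \<Longrightarrow> reduced_word A w (rw w)"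
  unfolding rw_def using reduced_exists by (rule someI_ex)

lemma rw_wp [simp]: "w \<in> W \<Longrightarrow> wp (rw w) = w" and rw_length [simp]: "w \<in> W \<Longrightarrow> length (rw w) = ell w"
  using rw_reduced by (auto simp: reduced_word_def)

abbreviation "Lm x \<equiv> lamL (rw x)"
abbreviation "Rm x \<equiv> rhoL (rw x)"

lemma rhoL_dl_id: "reduced_word A x xs \<Longrightarrow> rhoL xs (dl id) = dl x"
  using rhoL_dl[of id xs] by (simp add: reduced_word_def)

lemma lamL_dl_id: "reduced_word A x xs \<Longrightarrow> lamL xs (dl id) = dl x"
  using lamL_dl[of id xs] by (simp add: reduced_word_def)

text \<open>Start from the identity function and interchange left and right operators. The result
  depends on the word \<open>xs\<close> only through \<open>x\<close>, so two reduced words of one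
  element act alike; in particular the braid relators will act as zero.\<close>

lemma lamL_dl_reduced:
  assumes "reduced_word A x xs" "reduced_word A y ys"
  shows "lamL xs (dl y) = rhoL ys (dl x)"
proof -
  have "lamL xs (dl y) = lamL xs (rhoL ys (dl id))" using rhoL_dl_id[OF assms(2)] by simp
  also have "\<dots> = rhoL ys (lamL xs (dl id))" by (rule lamL_rhoL)
  finally show ?thesis using lamL_dl_id[OF assms(1)] by simp
qed

lemma Lm_Rm: "x \<in> W \<Longrightarrow> y \<in> W \<Longrightarrow> Lm x (dl y) = Rm y (dl x)"
  using lamL_dl_reduced rw_reduced by blast

lemma lamL_indep:
  assumes "reduced_word A x xs" "y \<in> W" shows "lamL xs (dl y) = Lm x (dl y)"
  using lamL_dl_reduced[OF assms(1) rw_reduced[OF assms(2)]] Lm_Rm[OF reduced_W[OF assms(1)] assms(2)] by simp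

lemma rhoL_indep:
  assumes "reduced_word A y ys" "x \<in> W" shows "rhoL ys (dl x) = Rm y (dl x)"
  using lamL_dl_reduced[OF rw_reduced[OF assms(2)] assms(1)] Lm_Rm[OF assms(2) reduced_W[OF assms(1)]] by simp

lemma reduced_append:
  assumes "x \<in> W" "u \<in> W" "ell (x \<circ> u) = ell x + ell u"
  shows "reduced_word A (x \<circ> u) (rw x @ rw u)"
  using assms by (simp add: reduced_word_def)

lemma Lm_comp:
  assumes "x \<in> W" "u \<in> W" "y \<in> W" "ell (x \<circ> u) = ell x + ell u"
  shows "Lm (x \<circ> u) (dl y) = Lm x (Lm u (dl y))"
  using lamL_indep[OF reduced_append[OF assms(1,2,4)] assms(3)] by (simp add: lamL_append)

lemma Lm_dl: "x \<in> W \<Longrightarrow> y \<in> W \<Longrightarrow> ell (x \<circ> y) = ell x + ell y \<Longrightarrow> Lm x (dl y) = dl (x \<circ> y)"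
  using lamL_dl[of y "rw x"] by simp

lemma Lm_sr:
  assumes "x \<in> W" "y \<in> W" "ell (sr s \<circ> x) = ell x + 1"
  shows "Lm (sr s \<circ> x) (dl y) = lam s (Lm x (dl y))"
proof -
  have "reduced_word A (sr s \<circ> x) (s # rw x)" using assms by (simp add: reduced_word_def)
  from lamL_indep[OF this assms(2)] show ?thesis by simp
qed

lemma Lm_snoc:
  assumes "x \<in> W" "y \<in> W" "ell (x \<circ> sr s) = ell x + 1"
  shows "Lm (x \<circ> sr s) (dl y) = Lm x (lam s (dl y))"
proof -
  have "reduced_word A (x \<circ> sr s) (rw x @ [s])" using assms by (simp add: reduced_word_def)
  from lamL_indep[OF this assms(2)] show ?thesis by (simp add: lamL_append)
qed

lemma Rm_snoc:
  assumes "x \<in> W" "y \<in> W" "ell (x \<circ> sr s) = ell x + 1"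
  shows "Rm (x \<circ> sr s) (dl y) = rho s (Rm x (dl y))"
proof -
  have "reduced_word A (x \<circ> sr s) (rw x @ [s])" using assms by (simp add: reduced_word_def)
  from rhoL_indep[OF this assms(2)] show ?thesis by (simp add: rhoL_append)
qed

lemma Rm_sr:
  assumes "x \<in> W" "y \<in> W" "ell (sr s \<circ> x) = ell x + 1"
  shows "Rm (sr s \<circ> x) (dl y) = Rm x (rho s (dl y))"
proof -
  have "reduced_word A (sr s \<circ> x) (s # rw x)" using assms by (simp add: reduced_word_def)
  from rhoL_indep[OF this assms(2)] show ?thesis by simp
qed

text \<open>Both sides are \<open>qvar\<close> times the coefficient at \<open>sr s\<close>; this is
  the symmetry of \<open>tau\<close> for one generator.\<close>

lemma lam_rho_at_id: "lam s m id = rho s m id"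
proof -
  have "ell (sr s) > ell id" using len_right_cases[of id s] by simp
  then show ?thesis by (simp add: lam_def rho_def)
qed

lemma lamL_rhoL_at_id: "lamL ss m id = rhoL ss m id"
proof (induction ss arbitrary: m)
  case (Cons s ss)
  have "lamL (s # ss) m id = rho s (lamL ss m) id" by (simp add: lam_rho_at_id)
  also have "\<dots> = rhoL ss (rho s m) id" unfolding lamL_rho[symmetric] by (rule Cons.IH)
  finally show ?case by (simp only: rhoL.simps)
qed simp

end

section \<open>Alternating words and Matsumoto's theorem\<close>

lemma alternating_append:
  "alternating (n + k) s t = alternating n s t @ (if even n then alternating k s t else alternating k t s)"
  by (induction n arbitrary: s t) auto

lemma alternating_snoc: "alternating (Suc n) s t = alternating n s t @ [if even n then s else t]"
  using alternating_append[of n 1 s t] by simp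

lemma rev_alternating: "rev (alternating n s t) = (if even n then alternating n t s else alternating n s t)"
proof (induction n arbitrary: s t)
  case (Suc n)
  have "rev (alternating (Suc n) s t) = rev (alternating n t s) @ [s]" by simp
  also have "\<dots> = (if even n then alternating n s t else alternating n t s) @ [s]"
    by (simp only: Suc.IH)
  also have "\<dots> = (if even (Suc n) then alternating (Suc n) t s else alternating (Suc n) s t)"
    unfolding alternating_snoc by simp
  finally show ?case .
qed simp

lemma length_alternating [simp]: "length (alternating n s t) = n"
  by (induction n arbitrary: s t) auto

context gcm
begin

lemma wp_alternating_even: "wp (alternating (2 * k) s t) = (sr s \<circ> sr t) ^^ k"
  by (induction k) (simp_all add: comp_assoc)

lemma wp_rev_id: "wp ss = id \<Longrightarrow> wp (rev ss) = id"
  using wp_rev[of ss] by (simp only: comp_id)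

text \<open>If appending a letter did not lengthen the word, exchange would delete an earlier one. A
  deleted letter other than the first contradicts the reducedness of the alternating word without
  its first letter; the first one gives a power of \<open>sr s \<circ> sr t\<close> below
  \<open>m\<close> equal to the identity.\<close>

lemma alternating_reduced:
  assumes st: "s \<noteq> t" and m: "braid_order A s t m" and k: "k \<le> m"
  shows "reduced_word A (wp (alternating k s t)) (alternating k s t) \<and>
         reduced_word A (wp (alternating k t s)) (alternating k t s)"
  using k
proof (induction k)
  case 0
  have "reduced_word A (wp []) []"
    unfolding reduced_word_def by (simp only: wp_Nil len_id list.size simp_thms)
  then show ?case by (simp only: alternating.simps simp_thms)
next
  case (Suc k)
  have IH: "reduced_word A (wp (alternating k x y)) (alternating k x y)" if "{x, y} = {s, t}" for x y
    using Suc that by (auto simp: doubleton_eq_iff)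
  have "reduced_word A (wp (alternating (Suc k) x y)) (alternating (Suc k) x y)" if xy: "{x, y} = {s, t}" for x y
  proof -
    define c where "c = (if even k then x else y)"
    have yx: "{y, x} = {s, t}" using xy by blast
    have snoc: "alternating (Suc k) x y = alternating k x y @ [c]" by (simp only: alternating_snoc c_def)
    have "nn (wp (alternating k x y) (\<alpha> c))"
    proof (rule ccontr)
      assume no: "\<not> nn (wp (alternating k x y) (\<alpha> c))"
      then obtain xs u ys where e: "alternating k x y = xs @ u # ys" "wp ys (\<alpha> c) = \<alpha> u"
        using exchange_root[OF root_simple nn_simple no] by blast
      have r: "wp ys \<circ> sr c = sr u \<circ> wp ys" using reflection_eq e(2) by simp
      have del: "wp (u # ys @ [c]) = wp ys"
      proof -
        have "wp (u # ys @ [c]) = sr u \<circ> (wp ys \<circ> sr c)" by simp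
        then show ?thesis unfolding r by simp
      qed
      show False
      proof (cases xs)
        case (Cons a xs')
        have "x # alternating k y x = a # xs' @ u # ys @ [c]"
          using snoc unfolding e(1) Cons by (simp only: alternating.simps append_Cons append_assoc)
        then have "alternating k y x = xs' @ u # ys @ [c]" by blast
        then have "wp (alternating k y x) = wp (xs' @ ys)" using del by (metis wp_append)
        then have "ell (wp (alternating k y x)) \<le> length (xs' @ ys)" using len_le by metis
        then show False using IH[OF yx] e(1) Cons length_alternating[of k x y] by (simp add: reduced_word_def)
      next
        case Nil
        then obtain k' where k': "k = Suc k'" using e(1) by (cases k) auto
        have "x # alternating k' y x = u # ys"
          using e(1) unfolding Nil k' by (simp only: alternating.simps append_Nil)
        then have ys: "ys = alternating k' y x" by blast
        have "alternating (Suc k) x y = u # ys @ [c]"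
          using snoc unfolding e(1) Nil by (simp only: append_Nil append_Cons)
        then have eq: "wp (alternating (Suc k) x y) = wp (alternating k' y x)" using del ys by metis
        have "wp (rev (alternating k' y x) @ alternating (Suc k) x y) = id"
          unfolding wp_append eq by simp
        moreover have "rev (alternating k' y x) @ alternating (Suc k) x y = alternating (2 * k) x y \<or>
            rev (alternating k' y x) @ alternating (Suc k) x y = alternating (2 * k) y x"
          unfolding rev_alternating using alternating_append[of k' "Suc k" x y] alternating_append[of k' "Suc k" y x] k'
          by (auto simp: mult_2 simp del: alternating.simps)
        ultimately have "wp (alternating (2 * k) x y) = id \<or> wp (alternating (2 * k) y x) = id" by metis
        then have "wp (alternating (2 * k) s t) = id"
          using wp_rev_id[of "alternating (2 * k) t s"] xy by (auto simp: rev_alternating doubleton_eq_iff)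
        then have "(sr s \<circ> sr t) ^^ k = id" by (simp only: wp_alternating_even)
        moreover have "0 < k" "k < m" using k' Suc.prems by auto
        ultimately show False using m unfolding braid_order_def by blast
      qed
    qed
    then show ?thesis using reduced_snoc[OF IH[OF xy]] unfolding snoc wp_append by simp
  qed
  then show ?case by blast
qed

lemma braid_order_wp:
  assumes "braid_order A s t m" shows "wp (alternating m s t) = wp (alternating m t s)"
proof -
  have "wp (alternating (m + m) s t) = id"
    using assms wp_alternating_even[of m s t] by (simp add: braid_order_def mult_2)
  then have id: "wp (alternating m s t) \<circ> wp (if even m then alternating m s t else alternating m t s) = id"
    unfolding alternating_append wp_append .
  have e: "wp (rev (alternating m t s)) = wp (if even m then alternating m s t else alternating m t s)"
    by (simp add: rev_alternating)
  have "wp (alternating m s t) \<circ> wp (rev (alternating m t s)) = wp (alternating m t s) \<circ> wp (rev (alternating m t s))"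
    unfolding wp_rev' unfolding e by (rule id)
  then show ?thesis using W_cancel_right wp_in_W by blast
qed

lemma reduced_alternating:
  assumes r: "reduced_word A w (s # r)" "set (s # r) \<subseteq> {s, t}"
  shows "s # r = alternating (ell w) s t"
proof -
  have w: "wp (s # r) = w" "length (s # r) = ell w" using r(1) by (auto simp: reduced_word_def)
  have "\<not> (\<exists>xs y zs. rev (s # r) = xs @ y # y # zs)"
  proof
    assume "\<exists>xs y zs. rev (s # r) = xs @ y # y # zs"
    then obtain xs y zs where "rev (s # r) = xs @ y # y # zs" by blast
    then have e: "s # r = rev zs @ y # y # rev xs" by (metis append.assoc append_Cons append_Nil rev.simps(2) rev_append rev_rev_ident)
    have "wp (rev zs @ rev xs) = w" unfolding w(1)[symmetric] e by (simp add: comp_assoc)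
    then have "ell w \<le> length (rev zs @ rev xs)" using len_le by blast
    moreover have "length (s # r) = length (rev zs @ rev xs) + 2" unfolding e by simp
    ultimately show False using w(2) by simp
  qed
  moreover have "set (rev (s # r)) \<subseteq> {s, t}" using r(2) by simp
  ultimately obtain n where "rev (s # r) = ralt n s t \<or> rev (s # r) = ralt n t s"
    using word_alternating_or_repeats by blast
  then have "s # r = rev (ralt n s t) \<or> s # r = rev (ralt n t s)" by (metis rev_rev_ident)
  then have or: "s # r = alternating n t s \<or> s # r = alternating n s t" by (simp add: ralt_def)
  then have n: "n = ell w" using w(2) length_alternating by metis
  have "s # r = alternating n s t"
    using or by (cases n) auto
  then show ?thesis using n by simp
qed

text \<open>Both generators are left descents, so \<open>d\<close> has two alternating reduced
  words. They give the relation with exponent \<open>ell d\<close>, and a smaller exponent would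
  produce a shorter word for \<open>d\<close>.\<close>

lemma left_descents_alternating:
  assumes st: "s \<noteq> t" and d: "d \<in> par {s, t}" and l: "ell (sr s \<circ> d) < ell d" "ell (sr t \<circ> d) < ell d"
  shows "d = wp (alternating (ell d) s t)" "d = wp (alternating (ell d) t s)" "braid_order A s t (ell d)"
proof -
  have dW: "d \<in> W" using d parabolic_W by blast
  have alt: "d = wp (alternating (ell d) x y) \<and> reduced_word A d (alternating (ell d) x y)"
    if xy: "{x, y} = {s, t}" "ell (sr x \<circ> d) < ell d" for x y
  proof -
    have d': "d \<in> par {x, y}" using d xy by simp
    have xd: "sr x \<circ> d \<in> par {x, y}" using d' sr_parabolic[of x "{x, y}"] comp_parabolic by blast
    then obtain r where r: "reduced_word A (sr x \<circ> d) r" "set r \<subseteq> {x, y}" by (rule parabolic_reduced)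
    have "wp (x # r) = d" using r(1) by (simp add: reduced_word_def)
    moreover have "ell d = ell (sr x \<circ> d) + 1" using len_left_cases[OF dW, of x] xy(2) by linarith
    ultimately have red: "reduced_word A d (x # r)" using r(1) by (simp add: reduced_word_def)
    then have "x # r = alternating (ell d) x y" using reduced_alternating r(2) by simp
    then show ?thesis using red by (simp add: reduced_word_def)
  qed
  have a: "d = wp (alternating (ell d) s t)" "reduced_word A d (alternating (ell d) s t)"
    and b: "d = wp (alternating (ell d) t s)" using alt[of s t] alt[of t s] l by (auto simp: insert_commute)
  define n where "n = ell d"
  show "d = wp (alternating (ell d) s t)" "d = wp (alternating (ell d) t s)" using a b by auto
  have n0: "n > 0" using l by (simp add: n_def)
  \<comment> \<open>The reverse of an alternating word is one of the two alternating words of that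
    length, and both represent \<open>d\<close>.\<close>
  have sq: "d \<circ> d = id"
  proof -
    have "wp (rev (alternating n s t)) = d" unfolding rev_alternating n_def using a b by simp
    then show ?thesis using wp_rev[of "alternating n s t"] a(1) by (simp add: n_def)
  qed
  have app: "wp (alternating (n + k) s t) = d \<circ> wp (if even n then alternating k s t else alternating k t s)" for k
    unfolding alternating_append wp_append using a(1) by (simp add: n_def)
  have "wp (alternating (2 * n) s t) = d \<circ> d"
    unfolding mult_2 app using a b by (simp add: n_def)
  then have "(sr s \<circ> sr t) ^^ n = id" using sq wp_alternating_even by metis
  moreover have "(sr s \<circ> sr t) ^^ k \<noteq> id" if k: "0 < k" "k < n" for k
  proof
    assume id: "(sr s \<circ> sr t) ^^ k = id"
    then have id2: "wp (alternating (2 * k) s t) = id" by (simp only: wp_alternating_even)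
    show False
    proof (cases "2 * k \<le> n")
      case True
      then obtain j where j: "n = 2 * k + j" using le_Suc_ex by blast
      have "d = wp (alternating j s t)"
        using a(1) id2 alternating_append[of "2 * k" j s t] by (simp add: j n_def[symmetric])
      then have "ell d \<le> j" using len_le[of "alternating j s t"] by simp
      then show False using j k by (simp add: n_def)
    next
      case False
      then obtain j where j: "2 * k = n + j" using le_Suc_ex by (metis nat_le_linear)
      define r where "r = (if even n then alternating j s t else alternating j t s)"
      have "d \<circ> wp r = id" using id2 unfolding j app r_def .
      then have "d = wp r" using sq dW W_cancel_left by metis
      then have "n \<le> j" using len_le[of r] unfolding n_def r_def by (auto split: if_splits)
      then show False using j k by simp
    qed
  qed
  ultimately show "braid_order A s t (ell d)" using n0 by (auto simp: braid_order_def n_def)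
qed

text \<open>Decomposing \<open>winv w\<close> and inverting puts the dihedral factor
  \<open>d\<close> on the left. Length additivity transfers the two left descents of
  \<open>w\<close> to \<open>d\<close>, whose two alternating words are the initial
  segments.\<close>

lemma braid_decomposition:
  assumes w: "w \<in> W" and st: "s \<noteq> t" and l: "ell (sr s \<circ> w) < ell w" "ell (sr t \<circ> w) < ell w"
  obtains n vs where "braid_order A s t (Suc n)"
    "reduced_word A w (alternating (Suc n) s t @ vs)" "reduced_word A w (alternating (Suc n) t s @ vs)"
proof -
  obtain v' d' where vd: "v' \<in> mcr {s, t}" "d' \<in> par {s, t}" "winv w = v' \<circ> d'"
    using coset_decomp[of "winv w" "{s, t}"] w by auto
  have W: "v' \<in> W" "d' \<in> W" using vd mcr_W parabolic_W by auto
  define d v where "d = winv d'" and "v = winv v'"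
  have dv: "w = d \<circ> v" using w vd(3) inv_comp[OF W] by (metis d_def inv_inv_W v_def)
  have dp: "d \<in> par {s, t}" using vd(2) inv_parabolic by (simp add: d_def)
  have add: "ell (e \<circ> v) = ell e + ell v" if "e \<in> par {s, t}" for e
  proof -
    have eW: "e \<in> W" using that parabolic_W by blast
    have "ell (v' \<circ> winv e) = ell v' + ell (winv e)" using len_coset_add[OF vd(1) inv_parabolic[OF that]] .
    moreover have "winv (e \<circ> v) = v' \<circ> winv e" using inv_comp[OF eW, of v] W by (simp add: v_def)
    ultimately show ?thesis using len_inv[of "e \<circ> v"] eW W by (simp add: v_def)
  qed
  have desc: "ell (sr x \<circ> d) < ell d" if "x \<in> {s, t}" "ell (sr x \<circ> w) < ell w" for x
  proof -
    have "sr x \<circ> d \<in> par {s, t}" using dp that(1) comp_parabolic sr_parabolic by blast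
    then have "ell (sr x \<circ> d \<circ> v) = ell (sr x \<circ> d) + ell v" by (rule add)
    then show ?thesis using that(2) add[OF dp] dv by (simp add: comp_assoc)
  qed
  note alt = left_descents_alternating[OF st dp desc desc, simplified, OF l]
  have vW: "v \<in> W" using W by (simp add: v_def)
  have red: "reduced_word A w (alternating (ell d) x y @ rw v)" if "d = wp (alternating (ell d) x y)" for x y
    using that add[OF dp] vW by (simp add: reduced_word_def dv)
  have "ell d \<noteq> 0" using alt(3) by (simp add: braid_order_def)
  then obtain n where "ell d = Suc n" by (cases "ell d") auto
  then show ?thesis using that alt red by metis
qed

text \<open>Matsumoto's theorem, for any congruence on words that is stable under left multiplication by
  a letter and under replacing an initial braid word.\<close>

lemma matsumoto:
  assumes refl: "\<And>x. R x x" and sym: "\<And>x y. R x y \<Longrightarrow> R y x" and trans: "\<And>x y z. R x y \<Longrightarrow> R y z \<Longrightarrow> R x z"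
    and cons: "\<And>s x y. R x y \<Longrightarrow> R (s # x) (s # y)"
    and braid: "\<And>s t m vs. s \<noteq> t \<Longrightarrow> braid_order A s t m \<Longrightarrow> R (alternating m s t @ vs) (alternating m t s @ vs)"
    and r: "reduced_word A w xs" "reduced_word A w ys"
  shows "R xs ys"
  using r
proof (induction "length xs" arbitrary: xs ys w)
  case 0
  then show ?case using refl by (simp add: reduced_word_def)
next
  case (Suc n)
  have tail: "reduced_word A (sr s \<circ> w) a" "ell (sr s \<circ> w) < ell w" if "reduced_word A w (s # a)" for s a w
  proof -
    have a: "w = sr s \<circ> wp a" "ell w = length a + 1" using that by (auto simp: reduced_word_def)
    have e: "sr s \<circ> w = wp a" using a(1) by simp
    have "ell w \<le> ell (wp a) + 1" using len_left_cases[of "wp a" s] unfolding a(1) by auto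
    moreover have "ell (wp a) \<le> length a" by (rule len_le) simp
    ultimately show "reduced_word A (sr s \<circ> w) a" "ell (sr s \<circ> w) < ell w"
      using a(2) unfolding e by (auto simp: reduced_word_def)
  qed
  have same: "R (s # a) (s # b)" if "reduced_word A w (s # a)" "reduced_word A w (s # b)" "length a = n" for s a b
    by (rule cons) (rule Suc.hyps(1)[OF that(3)[symmetric] tail(1)[OF that(1)] tail(1)[OF that(2)]])
  have len: "length xs = Suc n" "length ys = Suc n" using Suc by (auto simp: reduced_word_def)
  then obtain s a t b where sa: "xs = s # a" "ys = t # b" by (metis length_Suc_conv)
  have w: "w \<in> W" using Suc.prems(1) reduced_W by blast
  show ?case
  proof (cases "s = t")
    case True then show ?thesis using same Suc.prems len sa by simp
  next
    case False
    obtain k vs where k: "braid_order A s t (Suc k)"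
      "reduced_word A w (alternating (Suc k) s t @ vs)" "reduced_word A w (alternating (Suc k) t s @ vs)"
      using braid_decomposition[OF w False] tail(2) Suc.prems sa by metis
    have "R xs (alternating (Suc k) s t @ vs)"
      using same[of s a "alternating k t s @ vs"] Suc.prems(1) k(2) sa len by simp
    moreover have "R (alternating (Suc k) s t @ vs) (alternating (Suc k) t s @ vs)" by (rule braid[OF False k(1)])
    moreover have "R ys (alternating (Suc k) t s @ vs)"
      using same[of t b "alternating k s t @ vs"] Suc.prems(2) k(3) sa len by simp
    ultimately show ?thesis using sym trans by blast
  qed
qed

end

section \<open>The Hecke algebra as a quotient of the free algebra\<close>

lemma ring_free_alg: "ring (free_alg :: 's falg ring)"
proof (rule ringI)
  show "abelian_group (free_alg :: 's falg ring)"
  proof (rule abelian_groupI)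
    fix x :: "'s falg" show "\<exists>y\<in>carrier free_alg. y \<oplus>\<^bsub>free_alg\<^esub> x = \<zero>\<^bsub>free_alg\<^esub>"
      by (rule bexI[of _ "- x"]) (simp_all add: free_alg_def)
  qed (simp_all add: free_alg_def algebra_simps)
  show "Group.monoid (free_alg :: 's falg ring)"
    by (rule Group.monoidI) (simp_all add: free_alg_def algebra_simps)
qed (simp_all add: free_alg_def algebra_simps)

lemma free_alg_simps [simp]: "carrier free_alg = UNIV" "add free_alg = (+)" "mult free_alg = (*)"
  "zero free_alg = 0" "one free_alg = 1"
  by (simp_all add: free_alg_def)

lemma free_alg_uminus: "\<ominus>\<^bsub>free_alg\<^esub> x = - (x :: 's falg)"
  using abelian_group.minus_equality[OF ring.is_abelian_group[OF ring_free_alg], of "- x" x] by simp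

lemma ideal_free_algI:
  fixes I :: "'s falg set"
  assumes "0 \<in> I" "\<And>x y. x \<in> I \<Longrightarrow> y \<in> I \<Longrightarrow> x + y \<in> I" "\<And>x. x \<in> I \<Longrightarrow> - x \<in> I"
    "\<And>x y. x \<in> I \<Longrightarrow> y * x \<in> I" "\<And>x y. x \<in> I \<Longrightarrow> x * y \<in> I"
  shows "ideal I free_alg"
proof (rule idealI[OF ring_free_alg])
  show "subgroup I (add_monoid free_alg)"
  proof (rule group.subgroupI)
    show "Group.group (add_monoid (free_alg :: 's falg ring))"
      using abelian_group.a_group ring.is_abelian_group ring_free_alg by blast
    fix x assume "x \<in> I"
    then show "inv\<^bsub>add_monoid free_alg\<^esub> x \<in> I"
      using assms(3) free_alg_uminus[of x] by (simp add: a_inv_def)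
  qed (use assms in auto)
qed (use assms in auto)

lemma scalar_add: "scalar (a + b) = scalar a + scalar b"
  and scalar_mult: "scalar (a * b) = scalar a * scalar b"
  and scalar_1 [simp]: "scalar 1 = 1" and scalar_0 [simp]: "scalar 0 = 0"
  and scalar_diff: "scalar (a - b) = scalar a - scalar b"
  and scalar_uminus: "scalar (- a) = - scalar a"
  by (simp_all add: scalar_def single_add mult_single single_diff single_uminus)

lemma poly_mapping_sum_single: "x = (\<Sum>k\<in>Poly_Mapping.keys x. Poly_Mapping.single k (Poly_Mapping.lookup x k))"
proof (rule poly_mapping_eqI)
  fix i
  have "(\<Sum>k\<in>Poly_Mapping.keys x. Poly_Mapping.lookup (Poly_Mapping.single k (Poly_Mapping.lookup x k)) i) =
     (\<Sum>k\<in>Poly_Mapping.keys x. if k = i then Poly_Mapping.lookup x i else 0)"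
    by (rule sum.cong) (auto simp: lookup_single when_def)
  also have "\<dots> = Poly_Mapping.lookup x i" by (simp add: in_keys_iff)
  finally show "Poly_Mapping.lookup x i = Poly_Mapping.lookup (\<Sum>k\<in>Poly_Mapping.keys x. Poly_Mapping.single k (Poly_Mapping.lookup x k)) i"
    by (simp add: lookup_sum)
qed

lemma falg_induct [case_names single add]:
  fixes x :: "'s falg"
  assumes "\<And>ss c. P (scalar c * word_monomial ss)" "\<And>x y. P x \<Longrightarrow> P y \<Longrightarrow> P (x + y)"
  shows "P x"
proof -
  have s: "P (Poly_Mapping.single k c)" for k c
  proof (cases k)
    case (Word ss)
    have "scalar c * word_monomial ss = Poly_Mapping.single k c"
      by (simp add: scalar_def word_monomial_def mult_single Word zero_free_monoid_def)
    then show ?thesis using assms(1) by metis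
  qed
  have "P (\<Sum>k\<in>K. Poly_Mapping.single k (Poly_Mapping.lookup x k))" for K
  proof (induction K rule: infinite_finite_induct)
    case (insert k K) then show ?case using s assms(2) by simp
  qed (use s[of 0 0] in simp_all)
  then show ?thesis using poly_mapping_sum_single[of x] by metis
qed

lemma word_monomial_append: "word_monomial (u @ v) = word_monomial u * word_monomial v"
  by (simp add: word_monomial_def mult_single)

lemma word_monomial_Cons: "word_monomial (s # v) = word_monomial [s] * word_monomial v"
  using word_monomial_append[of "[s]" v] by simp

lemma word_monomial_Nil [simp]: "word_monomial [] = 1"
  by (simp add: word_monomial_def flip: zero_free_monoid_def)

lemma scalar_central: "scalar c * x = x * scalar c"
proof (induction x rule: falg_induct)
  case (single ss d)
  have "scalar c * word_monomial ss = word_monomial ss * scalar c"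
    by (simp add: scalar_def word_monomial_def mult_single zero_free_monoid_def)
  note wc = this
  have "scalar c * (scalar d * word_monomial ss) = scalar d * (scalar c * word_monomial ss)"
    by (simp only: mult.assoc[symmetric] scalar_mult[symmetric] mult.commute[of c d])
  then show ?case by (simp only: wc mult.assoc)
qed (simp add: algebra_simps)

fun unw :: "'s free_monoid \<Rightarrow> 's list" where "unw (Word ss) = ss"

context gcm
begin

abbreviation "HI \<equiv> hecke_ideal A"

lemma HI_ideal: "ideal HI free_alg"
  unfolding hecke_ideal_def by (rule ring.genideal_ideal[OF ring_free_alg]) simp

lemma HI_zero [simp]: "0 \<in> HI"
  using additive_subgroup.zero_closed[OF ideal.axioms(1)[OF HI_ideal]] by simp

lemma HI_add: "x \<in> HI \<Longrightarrow> y \<in> HI \<Longrightarrow> x + y \<in> HI"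
  using additive_subgroup.a_closed[OF ideal.axioms(1)[OF HI_ideal]] by simp

lemma HI_left: "x \<in> HI \<Longrightarrow> y * x \<in> HI"
  using ideal.I_l_closed[OF HI_ideal] by simp

lemma HI_right: "x \<in> HI \<Longrightarrow> x * y \<in> HI"
  using ideal.I_r_closed[OF HI_ideal] by simp

lemma HI_uminus: "x \<in> HI \<Longrightarrow> - x \<in> HI"
  using HI_left[of x "- 1"] by simp

lemma HI_relator: "x \<in> hecke_relators A \<Longrightarrow> x \<in> HI"
  unfolding hecke_ideal_def using ring.genideal_self[OF ring_free_alg] by fastforce

definition hc :: "'s falg \<Rightarrow> 's falg \<Rightarrow> bool"  (infix "\<approx>" 50) where
  "x \<approx> y \<longleftrightarrow> x - y \<in> HI"

lemma hc_refl [simp]: "x \<approx> x" by (simp add: hc_def)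

lemma hc_sym: "x \<approx> y \<Longrightarrow> y \<approx> x" using HI_uminus[of "x - y"] by (simp add: hc_def)

lemma hc_trans [trans]: "x \<approx> y \<Longrightarrow> y \<approx> z \<Longrightarrow> x \<approx> z"
  using HI_add[of "x - y" "y - z"] by (simp add: hc_def)

lemma hc_add: "x \<approx> y \<Longrightarrow> x' \<approx> y' \<Longrightarrow> x + x' \<approx> y + y'"
  using HI_add[of "x - y" "x' - y'"] by (simp add: hc_def algebra_simps)

lemma hc_left: "x \<approx> y \<Longrightarrow> z * x \<approx> z * y"
  using HI_left[of "x - y" z] by (simp add: hc_def algebra_simps)

lemma hc_right: "x \<approx> y \<Longrightarrow> x * z \<approx> y * z"
  using HI_right[of "x - y" z] by (simp add: hc_def algebra_simps)

abbreviation "Ts s \<equiv> word_monomial [s]"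

lemma Ts_quadratic: "Ts s * Ts s \<approx> scalar (qvar - 1) * Ts s + scalar qvar"
proof -
  have "(Ts s + 1) * (Ts s - scalar qvar) \<in> HI"
    by (rule HI_relator) (auto simp: hecke_relators_def)
  moreover have "(Ts s + 1) * (Ts s - scalar qvar) = Ts s * Ts s - (scalar (qvar - 1) * Ts s + scalar qvar)"
    by (simp add: algebra_simps scalar_diff scalar_central[of qvar "Ts s"])
  ultimately show ?thesis by (simp only: hc_def)
qed

lemma reduced_words_hc:
  assumes "reduced_word A w xs" "reduced_word A w ys"
  shows "word_monomial xs \<approx> word_monomial ys"
proof (rule matsumoto[where R = "\<lambda>x y. word_monomial x \<approx> word_monomial y", OF _ _ _ _ _ assms])
  fix s x y assume "word_monomial x \<approx> word_monomial y"
  then show "word_monomial (s # x) \<approx> word_monomial (s # y)"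
    unfolding word_monomial_Cons[of s x] word_monomial_Cons[of s y] by (rule hc_left)
next
  fix s t m vs assume "s \<noteq> t" "braid_order A s t m"
  then have "word_monomial (alternating m s t) - word_monomial (alternating m t s) \<in> HI"
    by (intro HI_relator) (auto simp: hecke_relators_def)
  then show "word_monomial (alternating m s t @ vs) \<approx> word_monomial (alternating m t s @ vs)"
    unfolding word_monomial_append by (intro hc_right) (simp add: hc_def)
qed (auto intro: hc_sym hc_trans)

definition Tm :: "'s weyl_elt \<Rightarrow> 's falg" where "Tm w = word_monomial (rw w)"

lemma Ts_Tm_up:
  assumes "w \<in> W" "ell w < ell (sr s \<circ> w)" shows "Ts s * Tm w \<approx> Tm (sr s \<circ> w)"
proof -
  have "ell (sr s \<circ> w) = ell w + 1" using len_left_cases[OF assms(1), of s] assms(2) by linarith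
  then have "reduced_word A (sr s \<circ> w) (s # rw w)" using assms(1) by (simp add: reduced_word_def)
  moreover have "reduced_word A (sr s \<circ> w) (rw (sr s \<circ> w))" using assms(1) by (intro rw_reduced) simp
  ultimately show ?thesis unfolding Tm_def using reduced_words_hc word_monomial_Cons by metis
qed

lemma Ts_Tm_down:
  assumes "w \<in> W" "\<not> ell w < ell (sr s \<circ> w)"
  shows "Ts s * Tm w \<approx> scalar qvar * Tm (sr s \<circ> w) + scalar (qvar - 1) * Tm w"
proof -
  define x where "x = sr s \<circ> w"
  have x: "x \<in> W" "w = sr s \<circ> x" using assms(1) by (simp_all add: x_def)
  have "ell x < ell (sr s \<circ> x)" using len_left_cases[OF assms(1), of s] assms(2)
    unfolding x(2)[symmetric] by (simp add: x_def)
  then have up: "Ts s * Tm x \<approx> Tm w" using Ts_Tm_up[OF x(1), of s] x(2) by simp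
  have "Ts s * Tm w \<approx> Ts s * (Ts s * Tm x)" using up hc_left hc_sym by blast
  also have "Ts s * (Ts s * Tm x) \<approx> (scalar (qvar - 1) * Ts s + scalar qvar) * Tm x"
    using hc_right[OF Ts_quadratic[of s], of "Tm x"] by (simp add: mult.assoc)
  also have "(scalar (qvar - 1) * Ts s + scalar qvar) * Tm x = scalar (qvar - 1) * (Ts s * Tm x) + scalar qvar * Tm x"
    by (simp add: algebra_simps)
  also have "\<dots> \<approx> scalar (qvar - 1) * Tm w + scalar qvar * Tm x"
    by (intro hc_add hc_left up hc_refl)
  finally show ?thesis by (simp add: x_def add.commute)
qed

section \<open>Action on functions\<close>

text \<open>The left regular representation before passing to the quotient, extended linearly from
  words.\<close>

definition act :: "'s falg \<Rightarrow> ('s weyl_elt \<Rightarrow> laurent) \<Rightarrow> 's weyl_elt \<Rightarrow> laurent" where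
  "act x m = (\<Sum>k\<in>Poly_Mapping.keys x. Poly_Mapping.lookup x k \<cdot> lamL (unw k) m)"

lemma act_superset:
  assumes "finite K" "Poly_Mapping.keys x \<subseteq> K"
  shows "act x m = (\<Sum>k\<in>K. Poly_Mapping.lookup x k \<cdot> lamL (unw k) m)"
  unfolding act_def
proof (rule sum.mono_neutral_left[OF assms], rule ballI)
  fix k assume "k \<in> K - Poly_Mapping.keys x"
  then have "Poly_Mapping.lookup x k = 0" by (simp add: in_keys_iff)
  then show "Poly_Mapping.lookup x k \<cdot> lamL (unw k) m = 0" by (simp add: smul_def zero_fun_def)
qed

lemma smul_add_left: "(a + b) \<cdot> m = a \<cdot> m + b \<cdot> m" for a b :: "'b::semiring"
  by (rule ext) (simp add: vec distrib_right)

lemma smul_add_right: "a \<cdot> (m + n) = a \<cdot> m + a \<cdot> n" for a :: "'b::semiring"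
  by (rule ext) (simp add: vec distrib_left)

lemma smul_smul: "a \<cdot> (b \<cdot> m) = (a * b) \<cdot> m" for a b :: "'b::semigroup_mult"
  by (rule ext) (simp add: vec mult.assoc)

lemma act_add: "act (x + y) m = act x m + act y m"
proof -
  define K where "K = Poly_Mapping.keys x \<union> Poly_Mapping.keys y"
  have K: "finite K" "Poly_Mapping.keys x \<subseteq> K" "Poly_Mapping.keys y \<subseteq> K" "Poly_Mapping.keys (x + y) \<subseteq> K"
    using keys_add[of x y] by (auto simp: K_def)
  show ?thesis
    unfolding act_superset[OF K(1,2)] act_superset[OF K(1,3)] act_superset[OF K(1,4)]
      lookup_add smul_add_left sum.distrib ..
qed

lemma act_single: "act (scalar c * word_monomial ss) m = c \<cdot> lamL ss m"
proof -
  have e: "scalar c * word_monomial ss = Poly_Mapping.single (Word ss) c"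
    by (simp add: scalar_def word_monomial_def mult_single zero_free_monoid_def)
  show ?thesis unfolding e by (subst act_superset[of "{Word ss}"]) (auto simp: plus_fun_def zero_fun_def)
qed

lemma act_word: "act (word_monomial ss) m = lamL ss m"
  using act_single[of 1 ss m] by (simp add: smul_def)

lemma act_scalar: "act (scalar c) m = c \<cdot> m"
  using act_single[of c "[]" m] by simp

lemma act_0 [simp]: "act 0 m = 0"
  by (simp add: act_def)

lemma act_madd: "act x (m + n) = act x m + act x n"
  unfolding act_def by (simp only: lamL_add smul_add_right sum.distrib)

lemma smul_sum: "c \<cdot> (\<Sum>k\<in>K. g k) = (\<Sum>k\<in>K. c \<cdot> g k)" for c :: "'b::comm_ring_1"
  by (rule ext) (simp add: sum_fun_apply smul_apply sum_distrib_left)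

lemma act_msmul: "act x (c \<cdot> m) = c \<cdot> act x m"
  unfolding act_def smul_sum by (simp only: lamL_smul smul_smul mult.commute)

lemma act_m0: "act x 0 = 0"
  using act_msmul[of x 0 0] by (simp add: smul_def zero_fun_def)

lemma act_mult: "act (x * y) m = act x (act y m)"
proof (induction x arbitrary: m rule: falg_induct)
  case (single ss c)
  show ?case
  proof (induction y rule: falg_induct)
    case (single ts d)
    have "scalar c * word_monomial ss * (scalar d * word_monomial ts) =
        scalar (c * d) * word_monomial (ss @ ts)"
      by (simp only: mult.assoc[symmetric] scalar_mult word_monomial_append
          mult.assoc[of "scalar c" "word_monomial ss" "scalar d"]
          scalar_central[of d "word_monomial ss", symmetric])
    then show ?case by (simp only: act_single lamL_append lamL_smul smul_smul)
  next
    case (add x y)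
    then show ?case by (simp only: distrib_left act_add act_madd)
  qed
next
  case (add x y)
  then show ?case by (simp only: distrib_right act_add)
qed

lemma act_rho: "act x (rho s m) = rho s (act x m)"
proof (induction x rule: falg_induct)
  case (single ss c)
  show ?case by (simp only: act_single lamL_rho rho_smul)
next
  case (add x y)
  then show ?case by (simp only: act_add rho_add)
qed

lemma act_rhoL: "act x (rhoL ss m) = rhoL ss (act x m)"
  by (induction ss arbitrary: m) (simp_all only: rhoL.simps act_rho)

lemma act_uminus: "act (- x) m = - act x m"
proof -
  have "act (- x) m + act x m = 0" by (simp only: act_add[symmetric]) simp
  then show ?thesis by (simp only: eq_neg_iff_add_eq_0)
qed

lemma act_diff: "act (x - y) m = act x m - act y m"
  using act_add[of x "- y" m] by (simp only: act_uminus add_uminus_conv_diff)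

definition fin :: "('s weyl_elt \<Rightarrow> laurent) \<Rightarrow> bool" where
  "fin m \<longleftrightarrow> finite {w. m w \<noteq> 0} \<and> supported m"

lemma fin_dl [simp]: "w \<in> W \<Longrightarrow> fin (dl w)"
  by (simp add: fin_def) (simp add: dl_def)

lemma fin_add: assumes "fin m" "fin n" shows "fin (m + n)"
proof -
  have "{w. (m + n) w \<noteq> 0} \<subseteq> {w. m w \<noteq> 0} \<union> {w. n w \<noteq> 0}" by (auto simp: vec)
  then show ?thesis using assms by (auto simp: fin_def supported_def vec intro: finite_subset)
qed

lemma fin_smul: assumes "fin m" shows "fin (c \<cdot> m)"
proof -
  have "{w. (c \<cdot> m) w \<noteq> 0} \<subseteq> {w. m w \<noteq> 0}" by (auto simp: vec)
  then show ?thesis using assms by (auto simp: fin_def supported_def vec intro: finite_subset)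
qed

lemma fin_0 [simp]: "fin 0" by (simp add: fin_def supported_def vec)

lemma fin_induct [consumes 1, case_names zero dl add]:
  assumes m: "fin m" and "P 0" "\<And>w c. w \<in> W \<Longrightarrow> P (c \<cdot> dl w)"
    "\<And>m n. fin m \<Longrightarrow> fin n \<Longrightarrow> P m \<Longrightarrow> P n \<Longrightarrow> P (m + n)"
  shows "P m"
proof -
  define X where "X = {w. m w \<noteq> 0}"
  have X: "finite X" "X \<subseteq> W" using m by (auto simp: X_def fin_def supported_def)
  have e: "m = (\<Sum>w\<in>X. m w \<cdot> dl w)"
  proof
    fix v
    have "(\<Sum>w\<in>X. m w * dl w v) = (\<Sum>w\<in>X. if w = v then m v else 0)"
      by (rule sum.cong) (auto simp: dl_def)
    also have "\<dots> = m v" using X(1) by (simp add: X_def)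
    finally show "m v = (\<Sum>w\<in>X. m w \<cdot> dl w) v" by (simp add: sum_fun_apply smul_apply)
  qed
  have "Y \<subseteq> X \<Longrightarrow> fin (\<Sum>w\<in>Y. m w \<cdot> dl w) \<and> P (\<Sum>w\<in>Y. m w \<cdot> dl w)" if "finite Y" for Y
    using that
  proof (induction Y rule: finite_induct)
    case empty
    show ?case unfolding sum.empty using assms(2) fin_0 by blast
  next
    case (insert w Y)
    then have w: "w \<in> W" using X by blast
    have IH: "fin (\<Sum>w\<in>Y. m w \<cdot> dl w)" "P (\<Sum>w\<in>Y. m w \<cdot> dl w)" using insert by simp_all
    show ?case
      unfolding sum.insert[OF insert.hyps]
      by (intro conjI fin_add assms(4) assms(3)[OF w] fin_smul[OF fin_dl[OF w]] IH)
  qed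
  then have "P (\<Sum>w\<in>X. m w \<cdot> dl w)" using X(1) by blast
  then show ?thesis unfolding e[symmetric] .
qed

lemma fin_lam: assumes "fin m" shows "fin (lam s m)"
  using assms
proof (induction m rule: fin_induct)
  case zero
  have "lam s 0 = 0" by (rule ext) (simp add: lam_def vec)
  then show ?case by (simp only: fin_0)
next
  case (dl w c)
  then have "fin (dl (sr s \<circ> w))" "fin (dl w)" by simp_all
  then have "fin (lam s (dl w))" unfolding lam_dl[OF dl] by (simp add: fin_add fin_smul)
  then show ?case unfolding lam_smul by (rule fin_smul)
next
  case (add m n)
  then show ?case unfolding lam_add by (intro fin_add)
qed

lemma fin_lamL: "fin m \<Longrightarrow> fin (lamL ss m)"
  by (induction ss) (auto intro: fin_lam)

lemma fin_act: "fin m \<Longrightarrow> fin (act x m)"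
proof (induction x rule: falg_induct)
  case (single ss c)
  then show ?case unfolding act_single by (intro fin_smul fin_lamL)
next
  case (add x y)
  then show ?case unfolding act_add by (intro fin_add) auto
qed

text \<open>The elements annihilating all \<open>dl w\<close> form a two-sided ideal that contains
  the relators: the quadratic ones by \<open>lam_quadratic\<close>, the braid ones because reduced
  words of one element act alike.\<close>

lemma HI_act_dl:
  assumes "x \<in> HI" shows "\<forall>w\<in>W. act x (dl w) = 0"
proof -
  define I where "I = {x. \<forall>w\<in>W. act x (dl w) = 0}"
  have fin0: "act x m = 0" if "x \<in> I" "fin m" for x m
    using that(2)
  proof (induction m rule: fin_induct)
    case zero
    show ?case by (rule act_m0)
  next
    case (dl w c)
    then have "act x (dl w) = 0" using that(1) by (simp only: I_def mem_Collect_eq)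
    then show ?case unfolding act_msmul by (simp add: smul_def zero_fun_def)
  next
    case (add m n)
    then show ?case by (simp only: act_madd add_0)
  qed
  have "ideal I free_alg"
  proof (rule ideal_free_algI)
    show "0 \<in> I" by (simp add: I_def)
    show "x + y \<in> I" if "x \<in> I" "y \<in> I" for x y using that by (simp only: I_def mem_Collect_eq act_add add_0) simp
    show "- x \<in> I" if "x \<in> I" for x using that by (simp only: I_def mem_Collect_eq act_uminus) simp
    show "y * x \<in> I" if "x \<in> I" for x y
      unfolding I_def mem_Collect_eq act_mult
    proof
      fix w assume "w \<in> W"
      then have "act x (dl w) = 0" using that by (simp only: I_def mem_Collect_eq)
      then show "act y (act x (dl w)) = 0" by (simp only: act_m0)
    qed
    \<comment> \<open>Membership in \<open>I\<close> is tested on the functions \<open>dl w\<close>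
      only, and \<open>act y\<close> turns such a function into a finite combination of
      them.\<close>
    show "x * y \<in> I" if "x \<in> I" for x y
      unfolding I_def mem_Collect_eq act_mult using fin0[OF that] fin_act fin_dl by blast
  qed
  moreover have "hecke_relators A \<subseteq> I"
  proof
    fix x assume "x \<in> hecke_relators A"
    then consider s where "x = (Ts s + 1) * (Ts s - scalar qvar)"
      | s t m where "s \<noteq> t" "braid_order A s t m" "x = word_monomial (alternating m s t) - word_monomial (alternating m t s)"
      unfolding hecke_relators_def by blast
    then show "x \<in> I"
    proof cases
      case 1
      show ?thesis unfolding I_def mem_Collect_eq
      proof
        fix w assume w: "w \<in> W"
        have e: "x = Ts s * Ts s - scalar qvar * Ts s + Ts s - scalar qvar"
          unfolding 1 by (simp add: algebra_simps scalar_central[of qvar "Ts s"])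
        have "act x (dl w) = lam s (lam s (dl w)) - qvar \<cdot> lam s (dl w) + lam s (dl w) - qvar \<cdot> dl w"
          unfolding e by (simp only: act_diff act_add act_mult act_word act_scalar lamL.simps)
        also have "\<dots> = 0" unfolding lam_quadratic[OF supported_dl[OF w]]
          by (rule ext) (simp add: vec algebra_simps)
        finally show "act x (dl w) = 0" .
      qed
    next
      case 2
      show ?thesis unfolding I_def mem_Collect_eq
      proof
        fix w assume w: "w \<in> W"
        have r: "reduced_word A (wp (alternating m s t)) (alternating m s t)"
          "reduced_word A (wp (alternating m s t)) (alternating m t s)"
          using alternating_reduced[OF 2(1,2), of m] braid_order_wp[OF 2(2)] by auto
        have "lamL (alternating m s t) (dl w) = lamL (alternating m t s) (dl w)"
          using lamL_indep[OF r(1) w] lamL_indep[OF r(2) w] by simp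
        then show "act x (dl w) = 0" unfolding 2 act_diff act_word by simp
      qed
    qed
  qed
  ultimately have "HI \<subseteq> I" unfolding hecke_ideal_def
    using ring.genideal_minimal[OF ring_free_alg] by blast
  then show ?thesis using assms unfolding I_def by blast
qed

definition lin :: "('s weyl_elt \<Rightarrow> laurent) \<Rightarrow> 's falg" where
  "lin m = (\<Sum>w\<in>{w. m w \<noteq> 0}. scalar (m w) * Tm w)"

lemma lin_superset:
  assumes "finite X" "{w. m w \<noteq> 0} \<subseteq> X" shows "lin m = (\<Sum>w\<in>X. scalar (m w) * Tm w)"
  unfolding lin_def by (rule sum.mono_neutral_left[OF assms]) auto

lemma lin_add: assumes "fin m" "fin n" shows "lin (m + n) = lin m + lin n"
proof -
  define X where "X = {w. m w \<noteq> 0} \<union> {w. n w \<noteq> 0}"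
  have X: "finite X" "{w. m w \<noteq> 0} \<subseteq> X" "{w. n w \<noteq> 0} \<subseteq> X" "{w. (m + n) w \<noteq> 0} \<subseteq> X"
    using assms by (auto simp: X_def fin_def vec)
  show ?thesis
    unfolding lin_superset[OF X(1,2)] lin_superset[OF X(1,3)] lin_superset[OF X(1,4)]
    by (simp only: plus_fun_apply scalar_add distrib_right sum.distrib)
qed

lemma lin_smul: assumes "fin m" shows "lin (c \<cdot> m) = scalar c * lin m"
proof -
  have X: "finite {w. m w \<noteq> 0}" "{w. (c \<cdot> m) w \<noteq> 0} \<subseteq> {w. m w \<noteq> 0}"
    using assms by (auto simp: fin_def vec)
  show ?thesis unfolding lin_superset[OF X] unfolding lin_def
    by (simp only: smul_apply scalar_mult sum_distrib_left mult.assoc)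
qed

lemma lin_dl [simp]: "lin (dl w) = Tm w"
  by (subst lin_superset[of "{w}"]) (auto simp: dl_def)

lemma lin_0 [simp]: "lin 0 = 0" by (simp add: lin_def zero_fun_apply)

lemma Ts_lin: "fin m \<Longrightarrow> Ts s * lin m \<approx> lin (lam s m)"
proof (induction m rule: fin_induct)
  case zero
  have "lam s 0 = 0" by (rule ext) (simp add: lam_def vec)
  then show ?case by (simp only: lin_0) simp
next
  case (dl w c)
  have "Ts s * Tm w \<approx> lin (lam s (dl w))"
  proof (cases "ell w < ell (sr s \<circ> w)")
    case True
    then show ?thesis using Ts_Tm_up[OF dl True] unfolding lam_dl[OF dl] by simp
  next
    case False
    have "lin (qvar \<cdot> dl (sr s \<circ> w) + (qvar - 1) \<cdot> dl w) = scalar qvar * Tm (sr s \<circ> w) + scalar (qvar - 1) * Tm w"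
      using dl fin_smul fin_dl by (simp only: lin_add lin_smul lin_dl comp_W sr_W)
    then show ?thesis using Ts_Tm_down[OF dl False] unfolding lam_dl[OF dl] using False by simp
  qed
  then have "scalar c * (Ts s * Tm w) \<approx> scalar c * lin (lam s (dl w))" by (rule hc_left)
  moreover have "Ts s * lin (c \<cdot> dl w) = scalar c * (Ts s * Tm w)"
    unfolding lin_smul[OF fin_dl[OF dl]] lin_dl
    by (simp only: mult.assoc[symmetric] scalar_central[of c "Ts s"])
  ultimately show ?case unfolding lam_smul lin_smul[OF fin_lam[OF fin_dl[OF dl]]] by simp
next
  case (add m n)
  then show ?case unfolding lam_add lin_add[OF add(1,2)] lin_add[OF fin_lam[OF add(1)] fin_lam[OF add(2)]] distrib_left
    by (intro hc_add)
qed

lemma Tm_id [simp]: "Tm id = 1"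
proof -
  have "rw id = []" using rw_length[OF id_W] by (simp only: len_id length_0_conv)
  then show ?thesis by (simp only: Tm_def word_monomial_Nil)
qed

abbreviation ev :: "'s falg \<Rightarrow> 's weyl_elt \<Rightarrow> laurent" where "ev x \<equiv> act x (dl id)"

lemma fin_ev [simp]: "fin (ev x)" by (simp add: fin_act)

text \<open>Multiplication by a generator keeps the span of the elements \<open>Tm w\<close> up to
  congruence, so every word reduces to a combination of them, and \<open>ev\<close> computes its
  coefficients.\<close>

lemma hc_lin_ev: "x \<approx> lin (ev x)"
proof (induction x rule: falg_induct)
  case (single ss c)
  have "word_monomial ss \<approx> lin (lamL ss (dl id))"
  proof (induction ss)
    case (Cons s ss)
    have "word_monomial (s # ss) \<approx> Ts s * lin (lamL ss (dl id))"
      unfolding word_monomial_Cons[of s ss] by (rule hc_left[OF Cons.IH])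
    also have "Ts s * lin (lamL ss (dl id)) \<approx> lin (lamL (s # ss) (dl id))"
      using Ts_lin[OF fin_lamL[OF fin_dl[OF id_W]]] by simp
    finally show ?case .
  next
    case Nil
    show ?case by (simp only: lamL.simps lin_dl Tm_id word_monomial_Nil hc_refl)
  qed
  then show ?case unfolding act_single lin_smul[OF fin_lamL[OF fin_dl[OF id_W]]] by (rule hc_left)
next
  case (add x y)
  then show ?case unfolding act_add lin_add[OF fin_ev fin_ev] by (rule hc_add)
qed

text \<open>The basis theorem: \<open>HI_act_dl\<close> gives linear independence of the standard
  basis, \<open>hc_lin_ev\<close> gives spanning. Equality in the quotient becomes equality of
  functions on the Weyl group.\<close>

lemma HI_iff_ev: "x \<in> HI \<longleftrightarrow> ev x = 0"
proof
  assume "x \<in> HI"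
  from HI_act_dl[OF this] show "ev x = 0" using id_W by (rule bspec)
next
  assume "ev x = 0"
  then show "x \<in> HI" using hc_lin_ev[of x] by (simp only: lin_0) (simp add: hc_def)
qed

lemma hc_iff_ev: "x \<approx> y \<longleftrightarrow> ev x = ev y"
  unfolding hc_def HI_iff_ev act_diff by (rule right_minus_eq)

section \<open>The quotient algebra and its canonical trace\<close>

abbreviation "HH \<equiv> hecke A"
abbreviation "cls \<equiv> hecke_class A"

lemma hecke_ring: "ring HH"
  unfolding hecke_def by (rule ideal.quotient_is_ring[OF HI_ideal])

lemma cls_mult: "cls x \<otimes>\<^bsub>HH\<^esub> cls y = cls (x * y)"
  unfolding hecke_def hecke_class_def FactRing_def
  using ideal.rcoset_mult_add[OF HI_ideal, of x y] by simp

lemma cls_add: "cls x \<oplus>\<^bsub>HH\<^esub> cls y = cls (x + y)"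
  unfolding hecke_def hecke_class_def FactRing_def
  using ideal.a_rcos_sum[OF HI_ideal, of x y] by simp

lemma cls_eq_iff: "cls x = cls y \<longleftrightarrow> ev x = ev y"
proof -
  have mem: "cls x = {i + x | i. i \<in> HI}" for x
    unfolding hecke_class_def a_r_coset_def' by auto
  have "cls x = cls y \<longleftrightarrow> x \<approx> y"
  proof
    assume "cls x = cls y"
    moreover have "x \<in> cls x" unfolding mem using HI_zero by (metis (mono_tags, lifting) add_0 mem_Collect_eq)
    ultimately obtain i where "i \<in> HI" "x = i + y" unfolding mem by blast
    then show "x \<approx> y" by (simp add: hc_def)
  next
    have sub: "cls x \<subseteq> cls y" if "x \<approx> y" for x y
    proof
      fix z assume "z \<in> cls x"
      then obtain i where "i \<in> HI" "z = i + x" unfolding mem by blast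
      then have "i + (x - y) \<in> HI" "z = (i + (x - y)) + y" using that HI_add by (auto simp: hc_def)
      then show "z \<in> cls y" unfolding mem by blast
    qed
    assume "x \<approx> y" then show "cls x = cls y" using sub hc_sym by blast
  qed
  then show ?thesis using hc_iff_ev by simp
qed

lemma cls_eqI: "x \<approx> y \<Longrightarrow> cls x = cls y"
  by (simp only: cls_eq_iff hc_iff_ev)

lemma carrier_hecke: "carrier HH = range cls"
  unfolding hecke_def hecke_class_def FactRing_def A_RCOSETS_def' by auto

lemma cls_carrier [simp]: "cls x \<in> carrier HH"
  by (simp add: carrier_hecke)

lemma carrierE: assumes "h \<in> carrier HH" obtains x where "h = cls x"
  using assms by (auto simp: carrier_hecke)

lemma cls_zero: "\<zero>\<^bsub>HH\<^esub> = cls 0"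
proof -
  have "cls 0 = HI" unfolding hecke_class_def a_r_coset_def' by auto
  then show ?thesis by (simp add: hecke_def FactRing_def)
qed

lemma cls_uminus: "\<ominus>\<^bsub>HH\<^esub> cls x = cls (- x)"
  by (rule abelian_group.minus_equality[OF ring.is_abelian_group[OF hecke_ring]])
     (simp_all add: cls_add cls_zero)

lemma cls_minus: "cls x \<ominus>\<^bsub>HH\<^esub> cls y = cls (x - y)"
  unfolding a_minus_def cls_uminus cls_add by simp

lemma cls_smult: "hecke_smult A c (cls x) = cls (scalar c * x)"
  by (simp add: hecke_smult_def cls_mult)

lemma hecke_T_cls: "hecke_T A w = cls (Tm w)"
  by (simp add: hecke_T_def Tm_def rw_def)

lemma ev_Tm: "w \<in> W \<Longrightarrow> ev (Tm w) = dl w"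
  unfolding Tm_def act_word by (rule lamL_dl_id) (rule rw_reduced)

lemma cls_lin_ev: "cls x = cls (lin (ev x))"
  by (rule cls_eqI) (rule hc_lin_ev)

lemma linear_functional_unique:
  assumes g: "laurent_linear_on A (carrier HH) g" "\<And>w. w \<in> W \<Longrightarrow> g (hecke_T A w) = (if w = id then 1 else 0)"
  shows "g (cls x) = ev x id"
proof -
  have add: "g (cls (x + y)) = g (cls x) + g (cls y)" for x y
    using g(1) cls_add cls_carrier unfolding laurent_linear_on_def by metis
  have smul: "g (cls (scalar c * x)) = c * g (cls x)" for c x
    using g(1) cls_smult cls_carrier unfolding laurent_linear_on_def by metis
  have "g (cls (lin m)) = m id" if "fin m" for m
    using that
  proof (induction m rule: fin_induct)
    case zero
    have "g (cls 0) = 0" using smul[of 0 0] by simp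
    then show ?case unfolding lin_0 zero_fun_apply[of id] .
  next
    case (dl w c)
    have "g (cls (Tm w)) = dl w id" using g(2)[OF dl] by (auto simp: hecke_T_cls dl_def)
    then show ?case unfolding lin_smul[OF fin_dl[OF dl]] smul lin_dl smul_apply[of c "dl w" id] by simp
  next
    case (add m n)
    then show ?case unfolding lin_add[OF add(1,2)] plus_fun_apply[of m n id]
      by (simp only: \<open>\<And>x y. g (cls (x + y)) = g (cls x) + g (cls y)\<close>)
  qed
  then have "g (cls (lin (ev x))) = ev x id" by simp
  then show ?thesis using cls_lin_ev by metis
qed

text \<open>Evaluation of \<open>ev x\<close> at the identity is well defined on classes and
  satisfies the characterization of \<open>tau\<close>; \<open>linear_functional_unique\<close>
  leaves no other candidate.\<close>

lemma tau_cls: "tau A (cls x) = ev x id"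
proof -
  \<comment> \<open>A chosen representative is harmless because \<open>ev\<close> is constant on
    classes; the value \<open>undefined\<close> off the carrier makes \<open>g\<close>
    extensional.\<close>
  define g where "g = (\<lambda>h. if h \<in> carrier HH then ev (SOME x. h = cls x) id else undefined)"
  have gc: "g (cls x) = ev x id" for x
  proof -
    have "cls x = cls (SOME y. cls x = cls y)" by (rule someI) (rule refl)
    then have "ev x = ev (SOME y. cls x = cls y)" using cls_eq_iff by blast
    then show ?thesis unfolding g_def by (simp only: cls_carrier if_True)
  qed
  have P: "g \<in> extensional (carrier HH) \<and> laurent_linear_on A (carrier HH) g \<and>
     (\<forall>w\<in>W. g (hecke_T A w) = (if w = id then 1 else 0))"
  proof (intro conjI ballI)
    show "g \<in> extensional (carrier HH)" by (simp add: extensional_def g_def)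
    show "laurent_linear_on A (carrier HH) g"
      unfolding laurent_linear_on_def
    proof (intro conjI ballI allI)
      fix h k assume "h \<in> carrier HH" "k \<in> carrier HH"
      then obtain x y where "h = cls x" "k = cls y" by (metis carrierE)
      then show "g (h \<oplus>\<^bsub>HH\<^esub> k) = g h + g k" by (simp only: cls_add gc act_add plus_fun_apply)
    next
      fix c h assume "h \<in> carrier HH"
      then obtain x where "h = cls x" by (metis carrierE)
      then show "g (hecke_smult A c h) = c * g h"
        by (simp only: cls_smult gc act_mult act_scalar smul_apply)
    qed
    fix w assume "w \<in> W"
    then show "g (hecke_T A w) = (if w = id then 1 else 0)"
      unfolding hecke_T_cls gc by (simp only: ev_Tm) (auto simp: dl_def)
  qed
  have "tau A = g"
    unfolding tau_def
  proof (rule the_equality[where P = "\<lambda>g. g \<in> extensional (carrier HH) \<and> laurent_linear_on A (carrier HH) g \<and>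
     (\<forall>w\<in>W. g (hecke_T A w) = (if w = id then 1 else 0))", OF P])
    fix k assume k: "k \<in> extensional (carrier HH) \<and> laurent_linear_on A (carrier HH) k \<and>
     (\<forall>w\<in>W. k (hecke_T A w) = (if w = id then 1 else 0))"
    show "k = g"
    proof (rule extensionalityI[of _ "carrier HH"])
      fix h assume "h \<in> carrier HH"
      then obtain x where x: "h = cls x" by (rule carrierE)
      show "k h = g h" unfolding x gc by (rule linear_functional_unique) (use k in auto)
    qed (use k P in auto)
  qed
  then show ?thesis using gc by simp
qed

section \<open>Spans\<close>

lemma span_carrier:
  assumes "X \<subseteq> carrier HH" "h \<in> hecke_span A X" shows "h \<in> carrier HH"
  using assms(2)
proof (induction rule: hecke_span.induct)
  case zero then show ?case by (simp add: cls_zero)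
next
  case (step x y c)
  then obtain u v where "x = cls u" "y = cls v" using assms(1) by (meson carrierE subsetD)
  then show ?case by (simp add: cls_smult cls_add)
qed

lemma span_add:
  assumes X: "X \<subseteq> carrier HH" and h: "h \<in> hecke_span A X" "k \<in> hecke_span A X"
  shows "h \<oplus>\<^bsub>HH\<^esub> k \<in> hecke_span A X"
  using h(1)
proof (induction rule: hecke_span.induct)
  case zero
  obtain v where "k = cls v" using span_carrier[OF X h(2)] by (rule carrierE)
  then show ?case using h(2) by (simp add: cls_zero cls_add)
next
  case (step x y c)
  obtain u v w where e: "x = cls u" "y = cls v" "k = cls w"
    using span_carrier[OF X] step(1,2) h(2) X by (meson carrierE subsetD)
  have "hecke_smult A c x \<oplus>\<^bsub>HH\<^esub> y \<oplus>\<^bsub>HH\<^esub> k = hecke_smult A c x \<oplus>\<^bsub>HH\<^esub> (y \<oplus>\<^bsub>HH\<^esub> k)"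
    unfolding e cls_smult cls_add by (simp add: add.assoc)
  then show ?case using hecke_span.step[OF step(1,3)] by simp
qed

lemma span_base:
  assumes X: "X \<subseteq> carrier HH" and h: "h \<in> X" shows "hecke_smult A c h \<in> hecke_span A X"
proof -
  obtain u where u: "h = cls u" using X h by (meson carrierE subsetD)
  have "hecke_smult A c h \<oplus>\<^bsub>HH\<^esub> \<zero>\<^bsub>HH\<^esub> \<in> hecke_span A X"
    by (rule hecke_span.step[OF h hecke_span.zero])
  then show ?thesis unfolding u cls_smult cls_zero cls_add by simp
qed

lemma span_base1:
  assumes X: "X \<subseteq> carrier HH" and h: "h \<in> X" shows "h \<in> hecke_span A X"
proof -
  obtain u where u: "h = cls u" using X h by (meson carrierE subsetD)
  show ?thesis using span_base[OF X h, of 1] unfolding u cls_smult by simp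
qed

lemma Ts_Tm_lin: "w \<in> W \<Longrightarrow> Ts s * Tm w \<approx> lin (lam s (dl w))"
  using Ts_lin[OF fin_dl, of w s] by simp

lemma reduced_sr: "reduced_word A (sr s) [s]"
proof -
  have "ell (sr s) = 1" using len_right_cases[of id s] by simp
  then show ?thesis by (simp add: reduced_word_def)
qed

lemma Ts_Tm: "Ts s \<approx> Tm (sr s)"
  unfolding Tm_def using reduced_words_hc[OF reduced_sr rw_reduced[OF sr_W]] .

text \<open>\<open>Lm_Rm\<close> exchanges left multiplication acting on \<open>dl (sr s)\<close>
  for right multiplication acting on \<open>dl w\<close>; this identifies \<open>rho s\<close> with
  right multiplication in the algebra.\<close>

lemma Tm_Ts_ev: assumes "w \<in> W" shows "ev (Tm w * Ts s) = rho s (dl w)"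
proof -
  have "ev (Ts s) = dl (sr s)" unfolding act_word by (rule lamL_dl_id) (rule reduced_sr)
  then have "ev (Tm w * Ts s) = Lm w (dl (sr s))" unfolding act_mult Tm_def act_word by (simp only:)
  also have "\<dots> = Rm (sr s) (dl w)" using assms by (rule Lm_Rm) simp
  also have "\<dots> = rhoL [s] (dl w)" using rhoL_indep[OF reduced_sr assms] by simp
  finally show ?thesis by (simp only: rhoL.simps)
qed

lemma Tm_Ts_lin: assumes "w \<in> W" shows "Tm w * Ts s \<approx> lin (rho s (dl w))"
  using hc_lin_ev[of "Tm w * Ts s"] Tm_Ts_ev[OF assms] by (simp only:)

end

section \<open>Traces on a parabolic subalgebra\<close>

locale hecke_trace = gcm A for A :: "'s::finite \<Rightarrow> 's \<Rightarrow> int" +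
  fixes K :: "'s set" and f :: "'s falg set \<Rightarrow> laurent"
  assumes f_linear: "laurent_linear_on A (hecke_parabolic A K) f"
    and f_trace: "\<forall>h\<in>commutator_span A (hecke_parabolic A K). f h = 0"
begin

definition ff :: "'s weyl_elt \<Rightarrow> laurent" where "ff w = f (hecke_T A w)"

abbreviation "HP \<equiv> hecke_parabolic A K"

lemma T_subset: "hecke_T A ` par K \<subseteq> carrier HH"
  by (auto simp: hecke_T_cls)

lemma HP_add: "h \<in> HP \<Longrightarrow> k \<in> HP \<Longrightarrow> h \<oplus>\<^bsub>HH\<^esub> k \<in> HP"
  unfolding hecke_parabolic_def by (rule span_add[OF T_subset])

lemma HP_T: "w \<in> par K \<Longrightarrow> cls (Tm w) \<in> HP"
  unfolding hecke_parabolic_def using span_base1[OF T_subset, of "hecke_T A w"] by (simp add: hecke_T_cls)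

lemma HP_smult_T: "w \<in> par K \<Longrightarrow> cls (scalar c * Tm w) \<in> HP"
  unfolding hecke_parabolic_def using span_base[OF T_subset, of "hecke_T A w" c]
  by (simp add: hecke_T_cls cls_smult)

lemma f_smult_T: "w \<in> par K \<Longrightarrow> f (cls (scalar c * Tm w)) = c * ff w"
  using f_linear HP_T unfolding laurent_linear_on_def ff_def hecke_T_cls cls_smult[symmetric] by blast

lemma f_comb:
  assumes "u \<in> par K" "v \<in> par K"
  shows "f (cls (scalar a * Tm u + scalar c * Tm v)) = a * ff u + c * ff v"
  using f_linear HP_smult_T[OF assms(1)] HP_smult_T[OF assms(2)] f_smult_T[OF assms(1)] f_smult_T[OF assms(2)]
  unfolding laurent_linear_on_def cls_add[symmetric] by metis

text \<open>The value of \<open>f\<close> on \<open>T\<^sub>t T\<^sub>v\<close>, expanded in the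
  standard basis; \<open>step_right\<close> does the same for
  \<open>T\<^sub>v T\<^sub>t\<close>.\<close>

definition step_left where
  "step_left t v = (if ell v < ell (sr t \<circ> v) then ff (sr t \<circ> v) else qvar * ff (sr t \<circ> v) + (qvar - 1) * ff v)"

definition step_right where
  "step_right t v = (if ell v < ell (v \<circ> sr t) then ff (v \<circ> sr t) else qvar * ff (v \<circ> sr t) + (qvar - 1) * ff v)"

lemma step_value:
  assumes "u \<in> par K" "v \<in> par K" "x \<approx> lin (if b then dl u else qvar \<cdot> dl u + (qvar - 1) \<cdot> dl v)"
  shows "cls x \<in> HP" "f (cls x) = (if b then ff u else qvar * ff u + (qvar - 1) * ff v)"
proof -
  have W: "u \<in> W" "v \<in> W" using assms parabolic_W by auto
  have l: "lin (if b then dl u else qvar \<cdot> dl u + (qvar - 1) \<cdot> dl v) =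
    (if b then scalar 1 * Tm u else scalar qvar * Tm u + scalar (qvar - 1) * Tm v)"
    using W fin_smul fin_dl by (simp add: lin_add lin_smul)
  have c: "cls x = cls (if b then scalar 1 * Tm u else scalar qvar * Tm u + scalar (qvar - 1) * Tm v)"
    using cls_eqI[OF assms(3)] unfolding l .
  show "cls x \<in> HP" unfolding c
    using HP_smult_T[OF assms(1), of 1] HP_add[OF HP_smult_T[OF assms(1)] HP_smult_T[OF assms(2)]]
    unfolding cls_add by presburger
  show "f (cls x) = (if b then ff u else qvar * ff u + (qvar - 1) * ff v)"
    unfolding c using f_smult_T[OF assms(1), of 1] f_comb[OF assms(1,2)] by simp
qed

text \<open>The trace property for the commutator of \<open>T\<^sub>t\<close> and
  \<open>T\<^sub>v\<close>. Since \<open>f\<close> is known to be linear only on the parabolic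
  subalgebra, the expansions also have to show that the products lie in it.\<close>

lemma step_left_right:
  assumes t: "t \<in> K" and v: "v \<in> par K" shows "step_left t v = step_right t v"
proof -
  have W: "v \<in> W" using v parabolic_W by blast
  have tv: "sr t \<circ> v \<in> par K" "v \<circ> sr t \<in> par K" using t v sr_parabolic comp_parabolic by blast+
  have L: "cls (Ts t * Tm v) \<in> HP" "f (cls (Ts t * Tm v)) = step_left t v"
    unfolding step_left_def
    using step_value[OF tv(1) v, of "Ts t * Tm v" "ell v < ell (sr t \<circ> v)"] Ts_Tm_lin[OF W, of t]
    unfolding lam_dl[OF W] by blast+
  have R: "cls (Tm v * Ts t) \<in> HP" "f (cls (Tm v * Ts t)) = step_right t v"
    unfolding step_right_def
    using step_value[OF tv(2) v, of "Tm v * Ts t" "ell v < ell (v \<circ> sr t)"] Tm_Ts_lin[OF W, of t]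
    unfolding rho_dl[OF W] by blast+
  have T: "cls (Ts t) \<in> HP" using HP_T[OF sr_parabolic[OF t]] cls_eqI[OF Ts_Tm[of t]] by simp
  define c where "c = cls (Ts t) \<otimes>\<^bsub>HH\<^esub> cls (Tm v) \<ominus>\<^bsub>HH\<^esub> cls (Tm v) \<otimes>\<^bsub>HH\<^esub> cls (Ts t)"
  have HPc: "HP \<subseteq> carrier HH" using span_carrier[OF T_subset] by (auto simp: hecke_parabolic_def)
  have X: "{x \<otimes>\<^bsub>HH\<^esub> y \<ominus>\<^bsub>HH\<^esub> y \<otimes>\<^bsub>HH\<^esub> x | x y. x \<in> HP \<and> y \<in> HP} \<subseteq> carrier HH"
  proof
    fix z assume "z \<in> {x \<otimes>\<^bsub>HH\<^esub> y \<ominus>\<^bsub>HH\<^esub> y \<otimes>\<^bsub>HH\<^esub> x | x y. x \<in> HP \<and> y \<in> HP}"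
    then obtain x y where "z = x \<otimes>\<^bsub>HH\<^esub> y \<ominus>\<^bsub>HH\<^esub> y \<otimes>\<^bsub>HH\<^esub> x" "x \<in> carrier HH" "y \<in> carrier HH" using HPc by blast
    then show "z \<in> carrier HH" by (metis carrierE cls_mult cls_minus cls_carrier)
  qed
  have "c \<in> commutator_span A HP" unfolding commutator_span_def
    by (rule span_base1[OF X]) (use T HP_T[OF v] c_def in blast)
  then have fc: "f c = 0" using f_trace by blast
  have ce: "c = cls (Ts t * Tm v + scalar (- 1) * (Tm v * Ts t))"
    by (simp add: c_def cls_mult cls_minus scalar_uminus)
  \<comment> \<open>Linearity is given for sums and multiples, so the difference is written as a sum
    with a multiple by -1, whose membership needs its own expansion.\<close>
  have sm: "cls (scalar (- 1) * (Tm v * Ts t)) \<in> HP \<and> f (cls (scalar (- 1) * (Tm v * Ts t))) = - step_right t v"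
  proof -
    have "f (hecke_smult A (- 1) (cls (Tm v * Ts t))) = - 1 * f (cls (Tm v * Ts t))"
      using f_linear R(1) unfolding laurent_linear_on_def by blast
    moreover have "cls (scalar (- 1) * (Tm v * Ts t)) \<in> HP"
    proof (cases "ell v < ell (v \<circ> sr t)")
      case True
      have "scalar (- 1) * (Tm v * Ts t) \<approx> scalar (- 1) * Tm (v \<circ> sr t)"
        using hc_left[OF Tm_Ts_lin[OF W, of t], of "scalar (- 1)"] True unfolding rho_dl[OF W] by simp
      then show ?thesis using HP_smult_T[OF tv(2), of "- 1"] cls_eqI by metis
    next
      case False
      have "scalar (- 1) * (Tm v * Ts t) \<approx> scalar (- 1) * lin (qvar \<cdot> dl (v \<circ> sr t) + (qvar - 1) \<cdot> dl v)"
        using hc_left[OF Tm_Ts_lin[OF W, of t], of "scalar (- 1)"] False unfolding rho_dl[OF W] by simp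
      also have "scalar (- 1) * lin (qvar \<cdot> dl (v \<circ> sr t) + (qvar - 1) \<cdot> dl v) =
          scalar (- qvar) * Tm (v \<circ> sr t) + scalar (- (qvar - 1)) * Tm v"
        using W fin_smul fin_dl by (simp add: lin_add lin_smul scalar_uminus scalar_diff algebra_simps)
      finally have "cls (scalar (- 1) * (Tm v * Ts t)) = cls (scalar (- qvar) * Tm (v \<circ> sr t) + scalar (- (qvar - 1)) * Tm v)"
        by (rule cls_eqI)
      then show ?thesis using HP_add[OF HP_smult_T[OF tv(2)] HP_smult_T[OF v]] unfolding cls_add by metis
    qed
    ultimately show ?thesis using R(2) by (simp add: cls_smult)
  qed
  have "f c = f (cls (Ts t * Tm v)) + f (cls (scalar (- 1) * (Tm v * Ts t)))"
    unfolding ce using f_linear L(1) sm unfolding laurent_linear_on_def cls_add[symmetric] by blast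
  then show ?thesis using fc L(2) sm by simp
qed

end

context gcm
begin

section \<open>Conjugation by the basis element of a minimal coset representative\<close>

lemma lamL_single: "lamL [s] m = lam s m" and rhoL_single: "rhoL [s] m = rho s m"
  by simp_all

lemma lam_rhoL: "lam s (rhoL ts m) = rhoL ts (lam s m)"
  using lamL_rhoL[of "[s]" ts m] by (simp only: lamL_single)

lemma len_add_inv:
  assumes "v \<in> mcr K" "u \<in> par K" shows "ell (u \<circ> winv v) = ell u + ell v"
proof -
  have W: "v \<in> W" "u \<in> W" using assms mcr_W parabolic_W by auto
  have "ell (v \<circ> winv u) = ell v + ell (winv u)" by (rule len_coset_add[OF assms(1) inv_parabolic[OF assms(2)]])
  moreover have "winv (u \<circ> winv v) = v \<circ> winv u" using W by (simp add: inv_comp)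
  ultimately show ?thesis using len_inv[of "u \<circ> winv v"] W by simp
qed

lemma Rm_inv_dl:
  assumes "v \<in> mcr K" "u \<in> par K" shows "Rm (winv v) (dl u) = dl (u \<circ> winv v)"
proof -
  have W: "v \<in> W" "u \<in> W" using assms mcr_W parabolic_W by auto
  then have "ell (u \<circ> wp (rw (winv v))) = length (rw (winv v)) + ell u"
    using len_add_inv[OF assms] by simp
  from rhoL_dl[OF W(2) this] show ?thesis using W by simp
qed

text \<open>From \<open>v (\<alpha> t) = \<alpha> s\<close> follows
  \<open>sr s \<circ> v = v \<circ> sr t\<close>, with lengths adding on both sides, so a letter
  \<open>s\<close> outside becomes a letter \<open>t\<close> inside, and likewise on the
  right.\<close>

lemma Lm_Rm_lam:
  assumes v: "v \<in> mcr K" "t \<in> K" "v (\<alpha> t) = \<alpha> s" and u: "u \<in> par K"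
  shows "lam s (Lm v (Rm (winv v) (dl u))) = Lm v (Rm (winv v) (lam t (dl u)))"
    and "rho s (Lm v (Rm (winv v) (dl u))) = Lm v (Rm (winv v) (rho t (dl u)))"
proof -
  have W: "v \<in> W" "u \<in> W" using v u mcr_W parabolic_W by auto
  have c: "v \<circ> sr t = sr s \<circ> v" by (rule reflection_eq[OF W(1) v(3)])
  have iv: "winv v (\<alpha> s) = \<alpha> t" using v(3) W(1) by (metis W_inv_left_apply)
  have l: "ell (sr s \<circ> v) = ell v + 1" by (rule len_left_pos[OF W(1)]) (simp add: iv nn_simple)
  have y: "u \<circ> winv v \<in> W" using W by simp
  have "lam s (Lm v (dl (u \<circ> winv v))) = Lm (sr s \<circ> v) (dl (u \<circ> winv v))"
    using Lm_sr[OF W(1) y l] by simp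
  also have "\<dots> = Lm (v \<circ> sr t) (dl (u \<circ> winv v))" by (simp only: c)
  also have "\<dots> = Lm v (lam t (dl (u \<circ> winv v)))" by (rule Lm_snoc[OF W(1) y]) (simp only: c l)
  finally show "lam s (Lm v (Rm (winv v) (dl u))) = Lm v (Rm (winv v) (lam t (dl u)))"
    unfolding Rm_inv_dl[OF v(1) u, symmetric] lam_rhoL .
  have iW: "winv v \<in> W" using W by simp
  have ci: "winv v \<circ> sr s = sr t \<circ> winv v"
    using inv_comp[OF W(1) sr_W[of t]] inv_comp[OF sr_W[of s] W(1)] c by (simp only: inv_sr)
  have li: "ell (winv v \<circ> sr s) = ell (winv v) + 1" by (rule len_right_pos[OF iW]) (simp add: iv nn_simple)
  have "rho s (Rm (winv v) (dl u)) = Rm (winv v \<circ> sr s) (dl u)" using Rm_snoc[OF iW W(2) li] by simp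
  also have "\<dots> = Rm (sr t \<circ> winv v) (dl u)" by (simp only: ci)
  also have "\<dots> = Rm (winv v) (rho t (dl u))" by (rule Rm_sr[OF iW W(2)]) (simp only: ci[symmetric] li)
  finally show "rho s (Lm v (Rm (winv v) (dl u))) = Lm v (Rm (winv v) (rho t (dl u)))"
    unfolding lamL_rho[symmetric] by (simp only:)
qed

lemma Lm_Rm_up:
  assumes v: "v \<in> mcr K" "sr s \<circ> v \<in> mcr K" "ell (sr s \<circ> v) = ell v + 1" and u: "u \<in> par K"
  shows "Lm (sr s \<circ> v) (Rm (winv (sr s \<circ> v)) (dl u)) = lam s (rho s (Lm v (Rm (winv v) (dl u))))"
proof -
  have W: "v \<in> W" "u \<in> W" using v u mcr_W parabolic_W by auto
  have iW: "winv v \<in> W" using W by simp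
  have ie: "winv (sr s \<circ> v) = winv v \<circ> sr s" using inv_comp[OF sr_W W(1)] by simp
  have li: "ell (winv v \<circ> sr s) = ell (winv v) + 1"
    using v(3) len_inv[of "sr s \<circ> v"] W ie by simp
  have "Rm (winv (sr s \<circ> v)) (dl u) = rho s (Rm (winv v) (dl u))"
    unfolding ie using Rm_snoc[OF iW W(2) li] .
  moreover have "Rm (winv (sr s \<circ> v)) (dl u) = dl (u \<circ> winv (sr s \<circ> v))" by (rule Rm_inv_dl[OF v(2) u])
  moreover have "Lm (sr s \<circ> v) (dl (u \<circ> winv (sr s \<circ> v))) = lam s (Lm v (dl (u \<circ> winv (sr s \<circ> v))))"
    by (rule Lm_sr[OF W(1) _ v(3)]) (use W in simp)
  ultimately show ?thesis by (simp only: lamL_rho)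
qed

end

section \<open>The trace property\<close>

context e7
begin

text \<open>The product of \<open>w0\<close> with the reflection \<open>r\<close> in
  \<open>theta j\<close> acts as -1 on all of \<open>insert j I1\<close>, hence is the longest
  element of the E8 subgroup. On \<open>I1\<close> this means that \<open>r\<close> fixes each
  simple root.\<close>

lemma neg_theta_reflection:
  assumes j: "E8_node j" and u: "u \<in> par (insert j I1)" "u (theta j) = \<alpha> t"
  defines "r \<equiv> winv u \<circ> sr t \<circ> u"
  shows "i \<in> insert j I1 \<Longrightarrow> (r \<circ> w0) (\<alpha> i) = - \<alpha> i"
proof -
  define J where "J = insert j I1"
  have jI: "j \<notin> I1" using j by (simp add: E8_node_def)
  have W: "u \<in> W" using u parabolic_W by blast
  have rW: "r \<in> W" using W by (simp add: r_def)
  have it: "winv u (\<alpha> t) = theta j" using u(2) W by (metis W_inv_left_apply)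
  have rx: "r x = x - pr t (u x) \<cdot> theta j" for x
  proof -
    have "r x = winv u (u x - pr t (u x) \<cdot> \<alpha> t)" by (simp add: r_def sr_eq)
    also have "\<dots> = x - pr t (u x) \<cdot> theta j"
      using W it by (simp add: W_diff[OF inv_W[OF W]] W_smul[OF inv_W[OF W]])
    finally show ?thesis .
  qed
  have rt: "r (theta j) = - theta j" using W it by (simp add: r_def u(2) W_uminus[OF inv_W[OF W]])
  have r1: "r (\<alpha> i) = \<alpha> i" if i: "i \<in> I1" for i
  proof -
    define n where "n = pr t (u (\<alpha> i))"
    define \<beta> where "\<beta> = r (\<alpha> i)"
    have b: "\<beta> = \<alpha> i - n \<cdot> theta j" by (simp add: \<beta>_def rx n_def)
    have bR: "\<beta> \<in> \<Phi>" using rW by (simp add: \<beta>_def)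
    have ij: "j \<noteq> i" using i jI by blast
    have le: "c k \<le> theta j k" if "c \<in> \<Phi>" "nn c" "\<And>k. k \<notin> J \<Longrightarrow> c k = 0" for c k
      using root_le_theta[OF j] that by (simp add: pos_roots_in_def pos_roots_def J_def)
    have off: "\<beta> k = 0" if "k \<notin> J" for k
      using that theta_off[of k j] i unfolding b J_def by (auto simp: vec simple_root_def)
    have bj: "\<beta> j = - 2 * n" using ij theta_j[OF jI] unfolding b by (simp add: vec)
    have bi: "\<beta> i = 1 - n * theta j i" unfolding b by (simp add: vec)
    \<comment> \<open>For either sign of \<open>n\<close>, maximality of the coefficient 2 of
      \<open>theta j\<close> at \<open>j\<close> leaves absolute value 1. Then
      \<open>theta j + \<alpha> i\<close> is a root, namely \<open>\<beta>\<close> itself or the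
      image of \<open>- \<beta>\<close> under \<open>sr i\<close>, and it exceeds the highest
      root.\<close>
    have "n = 0"
    proof (rule ccontr)
      assume "n \<noteq> 0"
      then consider "n < 0" | "n > 0" by linarith
      then show False
      proof cases
        case 1
        then have nn: "nn \<beta>" using bj root_pos_coeff[OF bR, of j] by simp
        have "n = - 1" using le[OF bR nn off, of j] bj theta_j[OF jI] 1 by linarith
        then show False using le[OF bR nn off, of i] bi by simp
      next
        case 2
        then have nn: "nn (- \<beta>)" using bj root_neg_coeff[OF bR, of j] by simp
        have off': "(- \<beta>) k = 0" if "k \<notin> J" for k using off[OF that] by (simp add: vec)
        have "(- \<beta>) j \<le> theta j j" using le[OF root_uminus[OF bR] nn off'] .
        then have n1: "n = 1" using bj theta_j[OF jI] 2 by (simp add: vec)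
        have sth: "sr i (theta j) = theta j" using pr_theta_I1[OF j i] by (auto simp: sr_eq vec)
        have "sr i (- \<beta>) = theta j + \<alpha> i"
        proof -
          have "- \<beta> = theta j - \<alpha> i" unfolding b n1 by (rule ext) (simp add: vec)
          then have "sr i (- \<beta>) = sr i (theta j) - sr i (\<alpha> i)" by (simp only: W_diff[OF sr_W])
          then show ?thesis unfolding sth sr_simple_self by simp
        qed
        then have "theta j + \<alpha> i \<in> \<Phi>" using root_W[OF sr_W root_uminus[OF bR]] by metis
        moreover have "nn (theta j + \<alpha> i)" using theta_nn nn_simple unfolding plus_fun_apply by (metis add_nonneg_nonneg)
        moreover have "(theta j + \<alpha> i) k = 0" if "k \<notin> J" for k
          using that theta_off[of k j] i unfolding J_def by (auto simp: vec simple_root_def)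
        ultimately have "(theta j + \<alpha> i) i \<le> theta j i" using le by blast
        then show False by (simp add: vec)
      qed
    qed
    then show ?thesis using b unfolding \<beta>_def by (simp add: smul_def vec) (rule ext, simp add: vec)
  qed
  define z where "z = r \<circ> w0"
  have zW: "z \<in> W" using rW by (simp add: z_def)
  have z1: "z (\<alpha> i) = - \<alpha> i" if "i \<in> I1" for i
    using w0(2)[OF that] r1[OF that] by (simp add: z_def W_uminus[OF rW])
  have zt: "z (theta j) = - theta j" using w0_theta[OF j] rt by (simp add: z_def)
  have zv: "z (v7 2 3 4 6 5 4 3) = - v7 2 3 4 6 5 4 3" by (rule neg_supported[OF zW z1 v7_off])
  \<comment> \<open>\<open>z\<close> negates \<open>theta j\<close> and its E7 part; the difference
    is twice \<open>\<alpha> j\<close>, and the factor 2 cancels over the integers.\<close>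
  have "2 \<cdot> z (\<alpha> j) = 2 \<cdot> (- \<alpha> j)"
  proof -
    have "z (theta j) = - v7 2 3 4 6 5 4 3 + 2 \<cdot> z (\<alpha> j)"
      unfolding theta_def W_add[OF zW] W_smul[OF zW] zv ..
    then have "2 \<cdot> z (\<alpha> j) = z (theta j) + v7 2 3 4 6 5 4 3" by simp
    also have "\<dots> = 2 \<cdot> (- \<alpha> j)" unfolding zt unfolding theta_def by (rule ext) (simp add: vec)
    finally show ?thesis .
  qed
  then have "2 * z (\<alpha> j) k = 2 * (- \<alpha> j) k" for k by (metis smul_apply)
  then have zj: "z (\<alpha> j) = - \<alpha> j" by (intro ext) simp
  show "i \<in> insert j I1 \<Longrightarrow> (r \<circ> w0) (\<alpha> i) = - \<alpha> i"
    using z1 zj unfolding z_def by blast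
qed

lemma winv_w0: "winv w0 = w0"
  by (rule inv_unique_comp) (rule w0_involution)+

text \<open>The element k of the summand: the outer factors are applied as operators so that a
  letter can enter from either side.\<close>

definition kp :: "'s weyl_elt \<times> 's weyl_elt \<Rightarrow> 's weyl_elt \<Rightarrow> laurent" where
  "kp p = Lm (fst p) (Rm (winv (fst p)) (dl (w0 \<circ> winv (snd p))))"

text \<open>Case of the trace property in which \<open>sv\<^sub>1\<close> is no longer valid: conjugating by
  \<open>v\<^sub>1\<close> turns \<open>T\<^sub>s\<close> into a factor of the central element \<open>T\<^bsub>w\<^sub>J\<^esub>\<close> of the \<open>E\<^sub>8\<close> subalgebra.\<close>

lemma kp_E8:
  assumes v1: "v1 \<in> mcr II" and j: "E8_node j" and v2: "v2 \<in> par (CJ j)" and th: "v1 (theta j) = \<alpha> s"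
  shows "lam s (kp (v1, v2)) = rho s (kp (v1, v2))"
proof -
  define J P where "J = insert j I1" and "P = CJ j"
  have v1W: "v1 \<in> W" and v2W: "v2 \<in> W" using v1 v2 mcr_W parabolic_W by auto
  \<comment> \<open>Only the factor \<open>u\<close> in the E8 subgroup matters: \<open>v\<close>
    sends the simple root \<open>\<alpha> t\<close> to \<open>\<alpha> s\<close>, so a letter
    \<open>s\<close> passes through \<open>v\<close> as a letter \<open>t\<close>.\<close>
  obtain v u where vu: "v \<in> mcr J" "u \<in> par J" "v1 = v \<circ> u" using v1W by (rule coset_decomp)
  have vW: "v \<in> W" and uW: "u \<in> W" using vu mcr_W parabolic_W by auto
  have usup: "u x k = 0" if "\<And>k. k \<notin> J \<Longrightarrow> x k = 0" "k \<notin> J" for x k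
    using parabolic_coeff[OF vu(2) that(2)] that by simp
  have pos: "nn (u \<beta>)" if "\<beta> \<in> \<Phi>" "\<And>k. k \<notin> J \<Longrightarrow> \<beta> k = 0" "nn (v1 \<beta>)" for \<beta>
  proof (rule ccontr)
    assume "\<not> nn (u \<beta>)"
    then have "nn (- u \<beta>)" using root_nn_or_neg[of "u \<beta>"] that(1) uW by auto
    then have "nn (v (- u \<beta>))" using usup[OF that(2)] by (intro mcr_nn[OF vu(1)]) (auto simp: vec)
    then have "nn (- v1 \<beta>)" using vu(3) vW by (simp add: W_uminus)
    then show False using root_not_both[of "v1 \<beta>"] that(1,3) v1W by auto
  qed
  have thJ: "theta j k = 0" if "k \<notin> J" for k using theta_off that by (simp add: J_def)
  have un: "nn (u (theta j))" using pos[OF theta_root[OF j] thJ] th nn_simple by simp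
  have vun: "v (u (theta j)) = \<alpha> s" using th vu(3) by simp
  obtain t where t: "t \<in> J" "u (theta j) = \<alpha> t"
    by (rule coset_simple[OF vu(1) un usup[OF thJ] vun])
  have vt: "v (\<alpha> t) = \<alpha> s" using th vu(3) t(2) by simp
  have uI: "u \<in> mcr I1"
  proof -
    have "nn (u (\<alpha> i))" if "i \<in> I1" for i
    proof (rule pos)
      show "\<alpha> i k = 0" if "k \<notin> J" for k using that \<open>i \<in> I1\<close> by (auto simp: J_def simple_root_def)
      show "nn (v1 (\<alpha> i))" using v1 that by (simp add: mcr_iff)
    qed simp
    then show ?thesis using uW by (simp add: mcr_iff)
  qed
  have AJP: "A i k = 0" if "i \<in> J" "k \<in> P" for i k
    using that I2_zero(2) A_zero_sym[of i k] by (auto simp: J_def P_def CJ_def)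
  have comm: "x \<circ> y = y \<circ> x" if "x \<in> par J" "y \<in> par P" for x y
    by (rule parabolic_commute[OF that AJP])
  have fixP: "z (\<alpha> k) = \<alpha> k" if "z \<in> par J" "k \<in> P" for z k
    using parabolic_fix[OF that(1)] AJP[OF _ that(2)] by simp
  have JmP: "z \<in> mcr P" if "z \<in> par J" for z
    using fixP[OF that] nn_simple parabolic_W[OF that] by (auto simp: mcr_iff)
  have vL: "v \<in> mcr (J \<union> P)"
  proof -
    have "nn (v (\<alpha> k))" if k: "k \<in> P" for k
    proof -
      have "v1 (\<alpha> k) = v (\<alpha> k)" using vu(3) fixP[OF vu(2) k] by simp
      moreover have "k \<in> II" using k by (simp add: P_def CJ_def)
      ultimately show ?thesis using v1 unfolding mcr_iff by metis
    qed
    then show ?thesis using vu(1) by (auto simp: mcr_iff)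
  qed
  have w0J: "w0 \<in> par J" using w0(1) parabolic_mono[of I1 J] by (auto simp: J_def)
  have tJ: "sr t \<in> par J" using t(1) by (rule sr_parabolic)
  have iuJ: "winv u \<in> par J" using inv_parabolic[OF vu(2)] .
  define x where "x = winv v2"
  have x: "x \<in> par P" "x \<in> W" using inv_parabolic v2 parabolic_W unfolding x_def P_def by blast+
  define u0 where "u0 = w0 \<circ> x"
  define r wJ where "r = winv u \<circ> sr t \<circ> u" and "wJ = r \<circ> w0"
  have rJ: "r \<in> par J" unfolding r_def using comp_parabolic iuJ tJ vu(2) by blast
  \<comment> \<open>\<open>wJ\<close> is the longest element of the E8 subgroup by
    \<open>neg_theta_reflection\<close>; acting as -1 there, it commutes with the whole
    subgroup.\<close>
  have wJJ: "wJ \<in> par J" unfolding wJ_def using comp_parabolic rJ w0J by blast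
  have wJW: "wJ \<in> W" using wJJ parabolic_W by blast
  have wJneg: "wJ (\<alpha> i) = - \<alpha> i" if "i \<in> J" for i
    using neg_theta_reflection[of j u t i] j t(2) vu(2) that unfolding wJ_def r_def J_def by blast
  have wJc: "wJ \<circ> z = z \<circ> wJ" if "z \<in> par J" for z by (rule neg_commute[OF wJW wJneg that])
  have tu: "sr t \<circ> u = u \<circ> r" using uW unfolding r_def by (simp add: comp_assoc[symmetric])
  have ut: "winv u \<circ> sr t = r \<circ> winv u" using uW unfolding r_def by (simp add: comp_assoc)
  have w0r: "w0 \<circ> r = wJ"
  proof -
    have "wJ \<circ> w0 = w0 \<circ> wJ" by (rule wJc[OF w0J])
    then have "r \<circ> (w0 \<circ> w0) = w0 \<circ> r \<circ> w0" unfolding wJ_def by (simp only: comp_assoc)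
    then have rr: "r = w0 \<circ> r \<circ> w0" unfolding w0_involution comp_id .
    have "w0 \<circ> r = w0 \<circ> (w0 \<circ> r \<circ> w0)" using rr by (rule arg_cong)
    also have "\<dots> = (w0 \<circ> w0) \<circ> (r \<circ> w0)" by (simp only: comp_assoc)
    finally show ?thesis unfolding w0_involution id_comp wJ_def .
  qed
  have tuw: "sr t \<circ> (u \<circ> w0) = wJ \<circ> u"
  proof -
    have "sr t \<circ> (u \<circ> w0) = (sr t \<circ> u) \<circ> w0" by (simp only: comp_assoc)
    also have "\<dots> = u \<circ> wJ" unfolding tu wJ_def by (simp only: comp_assoc)
    finally show ?thesis using wJc[OF vu(2)] by simp
  qed
  have uwu: "u \<circ> wJ \<circ> winv u = wJ" using wJc[OF vu(2)] uW by (metis W_inv_right comp_assoc comp_id)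
  have xu: "x \<circ> winv u = winv u \<circ> x" "x \<circ> sr t = sr t \<circ> x" using comm[OF iuJ x(1)] comm[OF tJ x(1)] by simp_all
  have e1: "(sr t \<circ> u) \<circ> (u0 \<circ> winv u) = wJ \<circ> x"
  proof -
    have "(sr t \<circ> u) \<circ> (u0 \<circ> winv u) = (sr t \<circ> u) \<circ> w0 \<circ> (x \<circ> winv u)" unfolding u0_def by (simp only: comp_assoc)
    also have "\<dots> = (u \<circ> wJ \<circ> winv u) \<circ> x" unfolding tu xu wJ_def by (simp only: comp_assoc)
    finally show ?thesis unfolding uwu .
  qed
  have e2: "u \<circ> (u0 \<circ> winv u \<circ> sr t) = wJ \<circ> x"
  proof -
    have "u \<circ> (u0 \<circ> winv u \<circ> sr t) = u \<circ> w0 \<circ> (x \<circ> winv u) \<circ> sr t" unfolding u0_def by (simp only: comp_assoc)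
    also have "\<dots> = u \<circ> w0 \<circ> winv u \<circ> (x \<circ> sr t)" unfolding xu(1) by (simp only: comp_assoc)
    also have "\<dots> = u \<circ> w0 \<circ> (winv u \<circ> sr t) \<circ> x" unfolding xu(2) by (simp only: comp_assoc)
    also have "\<dots> = (u \<circ> (w0 \<circ> r) \<circ> winv u) \<circ> x" unfolding ut by (simp only: comp_assoc)
    finally show ?thesis unfolding w0r uwu .
  qed
  have it: "winv u (\<alpha> t) = theta j" using t(2) uW by (metis W_inv_left_apply)
  have l1: "ell (sr t \<circ> u) = ell u + 1" by (rule len_left_pos[OF uW]) (simp add: it theta_nn)
  have l2: "ell (u \<circ> w0) = ell u + ell w0" by (rule len_coset_add[OF uI w0(1)])
  have l3: "ell (sr t \<circ> (u \<circ> w0)) = ell (u \<circ> w0) + 1"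
  proof (rule len_left_pos)
    show "u \<circ> w0 \<in> W" using uW by simp
    show "nn (winv (u \<circ> w0) (\<alpha> t))"
      unfolding inv_comp[OF uW w0_W] winv_w0 using it w0_theta[OF j] theta_nn by simp
  qed
  have l4: "ell (wJ \<circ> u) + ell u = ell wJ" by (rule neg_len[OF wJW wJneg vu(2)])
  \<comment> \<open>This count makes the factorizations \<open>e1\<close> and \<open>e2\<close> of
    \<open>wJ \<circ> x\<close> length-additive, so that they hold for basis elements as
    well.\<close>
  have lwJ: "ell wJ = 2 * ell u + 1 + ell w0" using l2 l3 l4 unfolding tuw by linarith
  have lx: "ell (z \<circ> x) = ell z + ell x" if "z \<in> par J" for z by (rule len_coset_add[OF JmP[OF that] x(1)])
  have l5: "ell (u0 \<circ> winv u) = ell u + ell w0 + ell x"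
  proof -
    have "u0 \<circ> winv u = (w0 \<circ> winv u) \<circ> x" unfolding u0_def comp_assoc xu(1) ..
    moreover have "ell (w0 \<circ> winv u) = ell (u \<circ> w0)"
      using len_inv[of "u \<circ> w0"] inv_comp[OF uW w0_W] uW unfolding winv_w0 by simp
    ultimately show ?thesis using lx[OF comp_parabolic[OF w0J iuJ]] l2 by simp
  qed
  have l6: "ell (u0 \<circ> winv u \<circ> sr t) = ell u + ell w0 + 1 + ell x"
  proof -
    have "u0 \<circ> winv u \<circ> sr t = (w0 \<circ> winv u \<circ> sr t) \<circ> x"
    proof -
      have "u0 \<circ> winv u \<circ> sr t = w0 \<circ> (x \<circ> winv u) \<circ> sr t" unfolding u0_def by (simp only: comp_assoc)
      also have "\<dots> = w0 \<circ> winv u \<circ> (x \<circ> sr t)" unfolding xu(1) by (simp only: comp_assoc)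
      finally show ?thesis unfolding xu(2) by (simp only: comp_assoc)
    qed
    moreover have "ell (w0 \<circ> winv u \<circ> sr t) = ell (sr t \<circ> (u \<circ> w0))"
    proof -
      have "winv (sr t \<circ> (u \<circ> w0)) = w0 \<circ> winv u \<circ> sr t"
        using inv_comp[OF sr_W, of "u \<circ> w0" t] inv_comp[OF uW w0_W] uW unfolding winv_w0 by simp
      then show ?thesis using len_inv[of "sr t \<circ> (u \<circ> w0)"] uW by simp
    qed
    moreover have "w0 \<circ> winv u \<circ> sr t \<in> par J" using comp_parabolic w0J iuJ tJ by blast
    ultimately show ?thesis using lx l2 l3 by simp
  qed
  have u0W: "u0 \<in> W" "u0 \<circ> winv u \<in> W" "u0 \<circ> winv u \<circ> sr t \<in> W" using x(2) uW by (simp_all add: u0_def)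
  have u0L: "u0 \<circ> winv u \<in> par (J \<union> P)" "u0 \<circ> winv u \<circ> sr t \<in> par (J \<union> P)"
  proof -
    have JL: "par J \<subseteq> par (J \<union> P)" and PL: "par P \<subseteq> par (J \<union> P)" by (rule parabolic_mono, blast)+
    then have "w0 \<in> par (J \<union> P)" "x \<in> par (J \<union> P)" "winv u \<in> par (J \<union> P)" "sr t \<in> par (J \<union> P)"
      using w0J x(1) iuJ tJ by blast+
    then show "u0 \<circ> winv u \<in> par (J \<union> P)" "u0 \<circ> winv u \<circ> sr t \<in> par (J \<union> P)"
      unfolding u0_def by (metis comp_parabolic)+
  qed
  have E1: "Lm (sr t \<circ> u) (dl (u0 \<circ> winv u)) = dl (wJ \<circ> x)"
    unfolding e1[symmetric] by (rule Lm_dl) (use u0W uW l1 l5 lwJ lx[OF wJJ] e1 in simp_all)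
  have E2: "Lm u (dl (u0 \<circ> winv u \<circ> sr t)) = dl (wJ \<circ> x)"
    unfolding e2[symmetric] by (rule Lm_dl) (use u0W uW l6 lwJ lx[OF wJJ] e2 in simp_all)
  have iv1: "winv v1 = winv u \<circ> winv v" unfolding vu(3) by (rule inv_comp[OF vW uW])
  have u0II: "u0 \<in> par II"
    using w0(1) x(1) CJ_I2 unfolding u0_def P_def by (intro comp_parabolic) (auto intro: par_I1_II par_I2_II)
  have kp: "kp (v1, v2) = Lm v1 (dl (u0 \<circ> winv v1))"
    using Rm_inv_dl[OF v1 u0II] unfolding kp_def u0_def x_def by simp
  have iv1s: "winv v1 (\<alpha> s) = theta j" using th v1W by (metis W_inv_left_apply)
  have ls: "ell (sr s \<circ> v1) = ell v1 + 1" by (rule len_left_pos[OF v1W]) (simp add: iv1s theta_nn)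
  have svt: "v \<circ> sr t = sr s \<circ> v" by (rule reflection_eq[OF vW vt])
  have "lam s (kp (v1, v2)) = Lm (sr s \<circ> v1) (dl (u0 \<circ> winv v1))"
    unfolding kp using Lm_sr[OF v1W _ ls, of "u0 \<circ> winv v1"] u0W v1W by simp
  also have "sr s \<circ> v1 = v \<circ> (sr t \<circ> u)" unfolding vu(3) comp_assoc[symmetric] svt ..
  also have "Lm (v \<circ> (sr t \<circ> u)) (dl (u0 \<circ> winv v1)) = Lm v (Lm (sr t \<circ> u) (dl (u0 \<circ> winv v1)))"
    using vW uW u0W v1W len_coset_add[OF vu(1) comp_parabolic[OF tJ vu(2)]] by (intro Lm_comp) simp_all
  also have "dl (u0 \<circ> winv v1) = Rm (winv v) (dl (u0 \<circ> winv u))"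
    unfolding Rm_inv_dl[OF vL u0L(1)] iv1 by (simp only: comp_assoc)
  finally have L: "lam s (kp (v1, v2)) = Lm v (Rm (winv v) (dl (wJ \<circ> x)))"
    unfolding lamL_rhoL[of "rw (sr t \<circ> u)"] E1 .
  have "ell ((u0 \<circ> winv v1) \<circ> sr s) = ell (u0 \<circ> winv v1) + 1"
  proof (rule len_right_pos)
    show "u0 \<circ> winv v1 \<in> W" using u0W v1W by simp
    have "x (theta j) = theta j" using CJ_theta[OF j] x(1) by (simp add: P_def)
    then have "u0 (theta j) = theta j" using w0_theta[OF j] by (simp add: u0_def)
    then show "nn ((u0 \<circ> winv v1) (\<alpha> s))" using iv1s theta_nn by simp
  qed
  then have "rho s (dl (u0 \<circ> winv v1)) = dl ((u0 \<circ> winv v1) \<circ> sr s)"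
    using rho_dl[of "u0 \<circ> winv v1" s] u0W v1W by simp
  also have "(u0 \<circ> winv v1) \<circ> sr s = (u0 \<circ> winv u \<circ> sr t) \<circ> winv v"
  proof -
    have "winv v \<circ> sr s = sr t \<circ> winv v"
      using inv_comp[OF vW sr_W[of t]] inv_comp[OF sr_W[of s] vW] svt by (simp only: inv_sr)
    then show ?thesis unfolding iv1 by (simp only: comp_assoc)
  qed
  also have "dl \<dots> = Rm (winv v) (dl (u0 \<circ> winv u \<circ> sr t))"
    using Rm_inv_dl[OF vL u0L(2)] by simp
  finally have "rho s (kp (v1, v2)) = Lm v1 (Rm (winv v) (dl (u0 \<circ> winv u \<circ> sr t)))"
    unfolding kp lamL_rho[symmetric] by (simp only:)
  also have "\<dots> = Rm (winv v) (Lm v1 (dl (u0 \<circ> winv u \<circ> sr t)))" by (rule lamL_rhoL)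
  also have "Lm v1 (dl (u0 \<circ> winv u \<circ> sr t)) = Lm v (Lm u (dl (u0 \<circ> winv u \<circ> sr t)))"
    unfolding vu(3) using vW uW u0W len_coset_add[OF vu(1,2)] by (intro Lm_comp) simp_all
  also have "Rm (winv v) (Lm v (Lm u (dl (u0 \<circ> winv u \<circ> sr t)))) = Lm v (Rm (winv v) (dl (wJ \<circ> x)))"
    unfolding E2 by (rule lamL_rhoL[symmetric])
  finally show ?thesis using L by simp
qed

end

section \<open>Grouping the valid pairs for one simple reflection\<close>

definition quad :: "('a \<Rightarrow> 'a) \<Rightarrow> ('a \<Rightarrow> 'a) \<Rightarrow> ('a \<Rightarrow> 'a) set" where
  "quad T v = {v, T \<circ> v, v \<circ> T, T \<circ> v \<circ> T}"

lemma quad_self: "v \<in> quad T v" and quad_left: "T \<circ> v \<in> quad T v" and quad_right: "v \<circ> T \<in> quad T v"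
  by (simp_all only: quad_def insert_iff simp_thms)

lemma quad_eq:
  assumes T: "T \<circ> T = id" and u: "u \<in> quad T v"
  shows "quad T u = quad T v"
proof -
  have l: "T \<circ> (T \<circ> x) = x" and r: "x \<circ> T \<circ> T = x" for x
    using T by (simp_all add: comp_assoc[symmetric], simp add: comp_assoc)
  have swap: "{y, x, w, z} = {x, y, z, w}" "{z, w, x, y} = {x, y, z, w}" "{w, z, y, x} = {x, y, z, w}"
    for x y z w :: "'a \<Rightarrow> 'a" by blast+
  have a: "T \<circ> (v \<circ> T) = T \<circ> v \<circ> T" by (simp only: comp_assoc)
  have b: "T \<circ> (T \<circ> v \<circ> T) = v \<circ> T" by (simp only: comp_assoc l)
  from u consider "u = v" | "u = T \<circ> v" | "u = v \<circ> T" | "u = T \<circ> v \<circ> T" unfolding quad_def by blast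
  then show ?thesis
  proof cases
    case 1 then show ?thesis by (simp only:)
  next
    case 2 show ?thesis unfolding 2 quad_def l by (rule swap)
  next
    case 3 show ?thesis unfolding 3 quad_def a r by (rule swap)
  next
    case 4 show ?thesis unfolding 4 quad_def b r by (rule swap)
  qed
qed

locale e7_trace = e7 A I1 b + hecke_trace A "commutant A I1" f
  for A :: "'s::finite \<Rightarrow> 's \<Rightarrow> int" and I1 b f
begin

definition cq :: "'s weyl_elt \<times> 's weyl_elt \<Rightarrow> laurent" where
  "cq p = qpow (- int (ell (fst p)) - int (ell (snd p))) * ff (snd p)"

definition G :: "'s weyl_elt \<times> 's weyl_elt \<Rightarrow> 's falg \<Rightarrow> laurent" where
  "G p x = cq p * act x (kp p) id"

lemma valid_par: assumes "(v1, v2) \<in> valid"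
  shows "v1 \<in> mcr II" "v2 \<in> par I2" "v1 \<in> W" "v2 \<in> W" "w0 \<circ> winv v2 \<in> par II"
proof -
  show v: "v1 \<in> mcr II" "v2 \<in> par I2" using assms unfolding valid_iff by auto
  then show "v1 \<in> W" "v2 \<in> W" using mcr_W parabolic_W by auto
  show "w0 \<circ> winv v2 \<in> par II"
    by (rule comp_parabolic[OF par_I1_II[OF w0(1)] par_I2_II[OF inv_parabolic[OF v(2)]]])
qed

lemma kp_dl:
  assumes "(v1, v2) \<in> valid"
  shows "kp (v1, v2) = Lm v1 (dl (winv (v1 \<circ> v2 \<circ> w0)))"
proof -
  note v = valid_par[OF assms]
  have "winv (v1 \<circ> v2 \<circ> w0) = (w0 \<circ> winv v2) \<circ> winv v1"
    using v by (simp add: inv_comp winv_w0 comp_assoc)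
  then show ?thesis unfolding kp_def fst_conv snd_conv Rm_inv_dl[OF v(1,5)] by (simp only:)
qed

lemma act_kp:
  assumes "(v1, v2) \<in> valid"
  shows "act x (kp (v1, v2)) id = rhoL (rw (winv (v1 \<circ> v2 \<circ> w0))) (act x (dl v1)) id"
proof -
  note v = valid_par[OF assms]
  have W: "winv (v1 \<circ> v2 \<circ> w0) \<in> W" using v by simp
  have "kp (v1, v2) = Rm (winv (v1 \<circ> v2 \<circ> w0)) (dl v1)" unfolding kp_dl[OF assms] by (rule Lm_Rm[OF v(3) W])
  then show ?thesis by (simp only: act_rhoL)
qed

text \<open>By \<open>lamL_rhoL_at_id\<close> the left factor of the product moves to the right end
  inside \<open>tau\<close>, where it combines with the basis element of \<open>v1\<close> to
  \<open>kp p\<close>.\<close>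

lemma F_term_G:
  assumes "p \<in> valid" shows "F_term A I1 f (cls x) p = G p x"
proof -
  obtain v1 v2 where p: "p = (v1, v2)" by fastforce
  have valid: "(v1, v2) \<in> valid" using assms p by simp
  note v = valid_par[OF valid]
  define y where "y = winv (v1 \<circ> v2 \<circ> w0)"
  have "ev (Tm y * x * Tm v1) = lamL (rw y) (act x (dl v1))"
    unfolding act_mult ev_Tm[OF v(3)] by (simp only: Tm_def act_word)
  then have "tau A (cls (Tm y) \<otimes>\<^bsub>HH\<^esub> cls x \<otimes>\<^bsub>HH\<^esub> cls (Tm v1)) = lamL (rw y) (act x (dl v1)) id"
    unfolding cls_mult tau_cls by (simp only:)
  also have "\<dots> = act x (kp (v1, v2)) id"
    unfolding act_kp[OF valid] y_def by (rule lamL_rhoL_at_id)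
  finally show ?thesis
    unfolding p F_term.simps G_def cq_def hecke_T_cls ff_def w0_def[symmetric] y_def fst_conv snd_conv
    by (simp only:)
qed

lemma act_left: "act (Ts s * x) m id = act x (rho s m) id"
proof -
  have "act (Ts s * x) m id = lam s (act x m) id" unfolding act_mult act_word lamL_single ..
  also have "\<dots> = rho s (act x m) id" by (rule lam_rho_at_id)
  finally show ?thesis by (simp only: act_rho)
qed

lemma act_right: "act (x * Ts s) m id = act x (lam s m) id"
  unfolding act_mult act_word lamL_single ..

text \<open>The weighted commutator of k with the generator of \<open>s\<close>; by
  \<open>G_defect\<close> it measures how far one summand is from being cyclic in that
  generator.\<close>

definition defect :: "'s \<Rightarrow> 's weyl_elt \<times> 's weyl_elt \<Rightarrow> 's weyl_elt \<Rightarrow> laurent" where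
  "defect s p = cq p \<cdot> (rho s (kp p) - lam s (kp p))"

lemma act_mdiff: "act x (m - n) = act x m - act x n"
  using act_madd[of x "m - n" n] by (simp only: diff_add_cancel eq_diff_eq)

lemma G_defect: "G p (Ts s * x) - G p (x * Ts s) = act x (defect s p) id"
  unfolding G_def act_left act_right defect_def act_msmul act_mdiff smul_apply[of "cq p" _ id] minus_apply[of _ _ id]
  by (simp only: right_diff_distrib)

text \<open>In the second case the conjugate of \<open>sr s\<close> by \<open>v1\<close> is the
  simple reflection \<open>sr t\<close> supplied by \<open>deodhar\<close>, written here without
  choosing \<open>t\<close>.\<close>

definition grp :: "'s \<Rightarrow> 's weyl_elt \<times> 's weyl_elt \<Rightarrow> ('s weyl_elt \<times> 's weyl_elt) set" where
  "grp s p = (if sr s \<circ> fst p \<in> mcr II then {p, (sr s \<circ> fst p, snd p)} \<inter> valid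
     else Pair (fst p) ` quad (winv (fst p) \<circ> sr s \<circ> fst p) (snd p) \<inter> valid)"

lemma grp_self: "p \<in> valid \<Longrightarrow> p \<in> grp s p"
  using quad_self[of "snd p"] by (cases p) (auto simp: grp_def)

lemma grp_finite: "finite (grp s p)"
  by (simp add: grp_def quad_def)

lemma grp_valid: "grp s p \<subseteq> valid"
  by (auto simp: grp_def)

lemma grp_eq:
  assumes p: "p \<in> valid" and p': "p' \<in> grp s p" shows "grp s p' = grp s p"
proof (cases "sr s \<circ> fst p \<in> mcr II")
  case True
  have v: "fst p \<in> mcr II" using p valid_par[of "fst p" "snd p"] by simp
  have pp: "p' = p \<or> p' = (sr s \<circ> fst p, snd p)" using p' True by (auto simp: grp_def)
  then show ?thesis
  proof
    assume e: "p' = (sr s \<circ> fst p, snd p)"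
    have "sr s \<circ> fst p' = fst p" "snd p' = snd p" unfolding e by simp_all
    then have "grp s p' = {p', p} \<inter> valid" using v unfolding grp_def by (metis prod.collapse)
    moreover have "grp s p = {p, p'} \<inter> valid" using True unfolding grp_def e by simp
    ultimately show ?thesis by blast
  qed simp
next
  case False
  define T where "T = winv (fst p) \<circ> sr s \<circ> fst p"
  have vW: "fst p \<in> W" using p valid_par[of "fst p" "snd p"] by simp
  have TT: "T \<circ> T = id"
  proof -
    have "T \<circ> T = winv (fst p) \<circ> sr s \<circ> (fst p \<circ> winv (fst p)) \<circ> sr s \<circ> fst p" unfolding T_def by (simp only: comp_assoc)
    also have "\<dots> = winv (fst p) \<circ> (sr s \<circ> sr s) \<circ> fst p" unfolding W_inv_right[OF vW] comp_id by (simp only: comp_assoc)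
    finally show ?thesis using vW by simp
  qed
  have D: "grp s q = Pair (fst q) ` quad T (snd q) \<inter> valid" if "fst q = fst p" for q
    using False that unfolding grp_def T_def by simp
  have fp: "fst p' = fst p" and sp: "snd p' \<in> quad T (snd p)"
    using p' unfolding D[OF refl] by auto
  show ?thesis unfolding D[OF fp] D[OF refl] fp quad_eq[OF TT sp] ..
qed

text \<open>Lengthening \<open>v1\<close> by \<open>s\<close> replaces k by
  \<open>T\<^sub>s k T\<^sub>s\<close> and the weight by \<open>qpow (- 1)\<close> times it. In the
  commutator of \<open>T\<^sub>s k T\<^sub>s\<close> with \<open>T\<^sub>s\<close> the quadratic
  relation leaves q times the opposite of the commutator of k.\<close>

lemma quad_sum:
  assumes m: "supported m"
  shows "c \<cdot> (rho s m - lam s m) + (qpow (- 1) * c) \<cdot> (rho s (lam s (rho s m)) - lam s (lam s (rho s m))) = 0"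
proof -
  have q: "qpow (- 1) * qvar = 1" by (simp add: qpow_mult)
  have a: "rho s (lam s (rho s m)) = (qvar - 1) \<cdot> lam s (rho s m) + qvar \<cdot> lam s m"
    unfolding lam_rho[symmetric] rho_quadratic[OF m] lam_add lam_smul ..
  have b: "lam s (lam s (rho s m)) = (qvar - 1) \<cdot> lam s (rho s m) + qvar \<cdot> rho s m"
    by (rule lam_quadratic) simp
  show ?thesis
  proof
    fix w
    have "(c \<cdot> (rho s m - lam s m) + (qpow (- 1) * c) \<cdot> (rho s (lam s (rho s m)) - lam s (lam s (rho s m)))) w
      = c * (rho s m w - lam s m w) + (qpow (- 1) * c) * (qvar * lam s m w - qvar * rho s m w)"
      unfolding a b by (simp add: vec)
    also have "(qpow (- 1) * c) * (qvar * lam s m w - qvar * rho s m w) = (qpow (- 1) * qvar) * (c * (lam s m w - rho s m w))"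
      by (simp only: right_diff_distrib mult.assoc mult.commute mult.left_commute)
    finally show "(c \<cdot> (rho s m - lam s m) + (qpow (- 1) * c) \<cdot> (rho s (lam s (rho s m)) - lam s (lam s (rho s m)))) w = 0 w"
      unfolding q by (simp add: vec algebra_simps)
  qed
qed

definition cD :: "'s weyl_elt \<Rightarrow> laurent" where "cD v = qpow (- int (ell v)) * ff v"

text \<open>The defect with the conjugation by \<open>v1\<close> stripped off, for the letter
  \<open>t\<close> into which \<open>s\<close> is transformed.\<close>

definition dD :: "'s \<Rightarrow> 's weyl_elt \<Rightarrow> 's weyl_elt \<Rightarrow> laurent" where
  "dD t v = cD v \<cdot> (rho t (dl (w0 \<circ> winv v)) - lam t (dl (w0 \<circ> winv v)))"

lemma dD_commute:
  assumes t: "t \<in> II" and v: "v \<in> par I2" "sr t \<circ> v = v \<circ> sr t" shows "dD t v = 0"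
proof -
  have W: "v \<in> W" using v parabolic_W by blast
  have "sr t \<circ> winv v = winv v \<circ> sr t"
    using inv_comp[OF W sr_W[of t]] inv_comp[OF sr_W[of t] W] v(2) by (simp only: inv_sr)
  moreover have "w0 \<circ> sr t = sr t \<circ> w0" by (rule w0_commute[OF sr_parabolic[OF t]])
  ultimately have "sr t \<circ> (w0 \<circ> winv v) = (w0 \<circ> winv v) \<circ> sr t" by (metis comp_assoc)
  then have "lam t (dl (w0 \<circ> winv v)) = rho t (dl (w0 \<circ> winv v))" using W by (intro lam_rho_dl_commute) simp_all
  then show ?thesis unfolding dD_def by (simp add: smul_def vec zero_fun_def)
qed

text \<open>If \<open>sr t\<close> commutes with \<open>v\<close>, every term vanishes. Otherwise
  the double coset has four elements, of lengths n, n+1, n+1, n+2 above its shortest element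
  \<open>d\<close>, and the trace property expresses all four values of \<open>f\<close> through
  those at \<open>d\<close> and \<open>sr t \<circ> d\<close>.\<close>

lemma dD_double_coset:
  assumes t: "t \<in> I2" and v: "v \<in> par I2"
  shows "(\<Sum>x\<in>{v, sr t \<circ> v, v \<circ> sr t, sr t \<circ> v \<circ> sr t}. dD t x) = 0"
proof (cases "sr t \<circ> v = v \<circ> sr t")
  case True
  have tI: "t \<in> II" using t by blast
  have tp: "sr t \<in> par I2" using t by (rule sr_parabolic)
  have tvt: "sr t \<circ> v \<circ> sr t = v" unfolding True by simp
  have 1: "dD t v = 0" by (rule dD_commute[OF tI v True])
  have "sr t \<circ> (sr t \<circ> v) = (sr t \<circ> v) \<circ> sr t" using tvt by simp
  from dD_commute[OF tI comp_parabolic[OF tp v] this] have 2: "dD t (sr t \<circ> v) = 0" .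
  have "{v, sr t \<circ> v, v \<circ> sr t, sr t \<circ> v \<circ> sr t} = {v, sr t \<circ> v}" unfolding tvt True[symmetric] by blast
  then show ?thesis using 1 2 by (intro sum.neutral) auto
next
  case False
  define D where "D = quad (sr t)"
  have D_def': "D u = {u, sr t \<circ> u, u \<circ> sr t, sr t \<circ> u \<circ> sr t}" for u by (simp only: D_def quad_def)
  have Tl: "sr t \<circ> (sr t \<circ> x) = x" and Tr: "x \<circ> sr t \<circ> sr t = x" for x by simp_all
  have DD: "D u = D v" if "u \<in> D v" for u
    using quad_eq[OF sr_comp_self] that unfolding D_def .
  have tp: "sr t \<in> par I2" using t by (rule sr_parabolic)
  have Dp: "D v \<subseteq> par I2" unfolding D_def' using v tp comp_parabolic by blast
  obtain d where d: "d \<in> D v" "\<And>u. u \<in> D v \<Longrightarrow> ell d \<le> ell u"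
    using ex_has_least_nat[of "\<lambda>u. u \<in> D v" v ell] quad_self unfolding D_def by blast
  have dp: "d \<in> par I2" and dW: "d \<in> W" using Dp d(1) parabolic_W by blast+
  have Dd: "D d = D v" by (rule DD[OF d(1)])
  define n where "n = ell d"
  have l1: "ell (sr t \<circ> d) = n + 1"
    using d(2)[OF quad_left[of "sr t" d, folded D_def, unfolded Dd]] len_left_cases[OF dW, of t]
    unfolding n_def by linarith
  have l2: "ell (d \<circ> sr t) = n + 1"
    using d(2)[OF quad_right[of d "sr t", folded D_def, unfolded Dd]] len_right_cases[OF dW, of t]
    unfolding n_def by linarith
  have nc: "sr t \<circ> d \<noteq> d \<circ> sr t"
  proof
    assume c: "sr t \<circ> d = d \<circ> sr t"
    have tdt: "sr t \<circ> d \<circ> sr t = d" unfolding c by simp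
    have "D d = {d, sr t \<circ> d}" unfolding D_def' tdt c[symmetric] by blast
    then have "v = d \<or> v = sr t \<circ> d" using Dd quad_self[of v "sr t"] unfolding D_def by blast
    then show False
    proof
      assume "v = sr t \<circ> d" then show False using False tdt by (metis Tl)
    qed (use False c in blast)
  qed
  have l3: "ell (sr t \<circ> d \<circ> sr t) = n + 2"
  proof -
    have "\<not> ell (sr t \<circ> (d \<circ> sr t)) < ell (sr t \<circ> d)" using exotic[OF dW, of t t] l2 nc unfolding n_def by auto
    moreover have "ell (sr t \<circ> d \<circ> sr t) = ell (sr t \<circ> d) + 1 \<or> ell (sr t \<circ> d) = ell (sr t \<circ> d \<circ> sr t) + 1"
      using dW by (intro len_right_cases) simp
    ultimately show ?thesis using l1 by (simp only: comp_assoc) linarith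
  qed
  have distinct: "sr t \<circ> d \<noteq> d" "d \<circ> sr t \<noteq> d" "sr t \<circ> d \<circ> sr t \<noteq> d" "sr t \<circ> d \<circ> sr t \<noteq> sr t \<circ> d" "sr t \<circ> d \<circ> sr t \<noteq> d \<circ> sr t"
    using l1 l2 l3 unfolding n_def by force+
  define \<alpha>' \<beta>' where "\<alpha>' = ff d" and "\<beta>' = ff (sr t \<circ> d)"
  have tdp: "sr t \<circ> d \<in> par I2" "d \<circ> sr t \<in> par I2" using dp tp comp_parabolic by blast+
  have b2: "ff (d \<circ> sr t) = \<beta>'"
    using step_left_right[OF t dp] l1 l2 unfolding step_left_def step_right_def \<beta>'_def n_def by simp
  \<comment> \<open>Apply the trace property to \<open>sr t\<close> and
    \<open>d \<circ> sr t\<close>: multiplication on the left goes up to the longest element, on the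
    right it goes down to \<open>d\<close>.\<close>
  have b3: "ff (sr t \<circ> d \<circ> sr t) = qvar * \<alpha>' + (qvar - 1) * \<beta>'"
  proof -
    have "ell (d \<circ> sr t) < ell (sr t \<circ> (d \<circ> sr t))" using l2 l3 by (simp only: comp_assoc)
    then have "step_left t (d \<circ> sr t) = ff (sr t \<circ> d \<circ> sr t)" unfolding step_left_def by (simp only: if_True comp_assoc)
    moreover have "step_right t (d \<circ> sr t) = qvar * \<alpha>' + (qvar - 1) * \<beta>'"
      using l2 b2 unfolding step_right_def Tr \<alpha>'_def n_def by simp
    ultimately show ?thesis using step_left_right[OF t tdp(2)] by simp
  qed
  define x where "x = w0 \<circ> winv d"
  have xW: "x \<in> W" using dW by (simp add: x_def)
  have wt0: "w0 \<circ> sr t = sr t \<circ> w0" by (rule w0_commute[OF par_I2_II[OF tp]])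
  have i1: "w0 \<circ> winv (sr t \<circ> d) = x \<circ> sr t"
    unfolding inv_comp[OF sr_W dW] x_def by (simp only: inv_sr comp_assoc)
  have i2: "w0 \<circ> winv (d \<circ> sr t) = sr t \<circ> x"
  proof -
    have "w0 \<circ> winv (d \<circ> sr t) = (w0 \<circ> sr t) \<circ> winv d"
      unfolding inv_comp[OF dW sr_W] by (simp only: inv_sr comp_assoc)
    then show ?thesis unfolding wt0 x_def by (simp only: comp_assoc)
  qed
  have i3: "w0 \<circ> winv (sr t \<circ> d \<circ> sr t) = sr t \<circ> x \<circ> sr t"
  proof -
    have tdW: "sr t \<circ> d \<in> W" using dW by simp
    have "w0 \<circ> winv (sr t \<circ> d \<circ> sr t) = (w0 \<circ> sr t) \<circ> winv d \<circ> sr t"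
      unfolding inv_comp[OF tdW sr_W] inv_comp[OF sr_W dW] by (simp only: inv_sr comp_assoc)
    then show ?thesis unfolding wt0 x_def by (simp only: comp_assoc)
  qed
  have w0m: "w0 \<in> mcr I2"
  proof -
    have "w0 (\<alpha> k) = \<alpha> k" if "k \<in> I2" for k using parabolic_fix[OF w0(1)] I2_zero(2)[OF that] by simp
    then show ?thesis using nn_simple by (simp add: mcr_iff)
  qed
  have lw: "ell (w0 \<circ> winv u) = ell w0 + ell u" if "u \<in> par I2" for u
    using len_coset_add[OF w0m inv_parabolic[OF that]] parabolic_W[OF that] by simp
  define N where "N = ell w0 + n"
  have L0: "ell x = N" using lw[OF dp] by (simp add: x_def N_def n_def)
  have L1: "ell (x \<circ> sr t) = N + 1" using lw[OF tdp(1)] l1 by (simp add: i1 N_def)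
  have L2: "ell (sr t \<circ> x) = N + 1" using lw[OF tdp(2)] l2 by (simp add: i2 N_def)
  have L3: "ell (sr t \<circ> x \<circ> sr t) = N + 2" using lw[OF comp_parabolic[OF tdp(1) tp]] l3 by (simp add: i3 N_def)
  have L3': "ell (sr t \<circ> (x \<circ> sr t)) = N + 2" using L3 by (simp only: comp_assoc)
  have Wx: "x \<circ> sr t \<in> W" "sr t \<circ> x \<in> W" "sr t \<circ> x \<circ> sr t \<in> W" using xW by simp_all
  have T2: "sr t \<circ> (sr t \<circ> x \<circ> sr t) = x \<circ> sr t" by (simp only: comp_assoc Tl)
  have r0: "rho t (dl x) = dl (x \<circ> sr t)" "lam t (dl x) = dl (sr t \<circ> x)"
    using rho_dl[OF xW, of t] lam_dl[OF xW, of t] L0 L1 L2 by simp_all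
  have r1: "rho t (dl (x \<circ> sr t)) = qvar \<cdot> dl x + (qvar - 1) \<cdot> dl (x \<circ> sr t)"
    using rho_dl[OF Wx(1), of t] L0 L1 unfolding Tr by simp
  have r1': "lam t (dl (x \<circ> sr t)) = dl (sr t \<circ> x \<circ> sr t)"
    using lam_dl[OF Wx(1), of t] L1 L3' by (simp only: comp_assoc) simp
  have r2: "rho t (dl (sr t \<circ> x)) = dl (sr t \<circ> x \<circ> sr t)"
    using rho_dl[OF Wx(2), of t] L2 L3 by simp
  have r2': "lam t (dl (sr t \<circ> x)) = qvar \<cdot> dl x + (qvar - 1) \<cdot> dl (sr t \<circ> x)"
    using lam_dl[OF Wx(2), of t] L0 L2 unfolding Tl by simp
  have r3: "rho t (dl (sr t \<circ> x \<circ> sr t)) = qvar \<cdot> dl (sr t \<circ> x) + (qvar - 1) \<cdot> dl (sr t \<circ> x \<circ> sr t)"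
    using rho_dl[OF Wx(3), of t] L2 L3 unfolding Tr by simp
  have r3': "lam t (dl (sr t \<circ> x \<circ> sr t)) = qvar \<cdot> dl (x \<circ> sr t) + (qvar - 1) \<cdot> dl (sr t \<circ> x \<circ> sr t)"
    using lam_dl[OF Wx(3), of t] L1 L3 unfolding T2 by simp
  \<comment> \<open>The common factor belonging to the largest length n+2; what remains of the four
    weights is polynomial in \<open>qvar\<close>.\<close>
  define Q where "Q = qpow (- int n - 2)"
  have q0: "cD d = Q * (qvar * qvar) * \<alpha>'"
    by (simp add: cD_def Q_def \<alpha>'_def n_def qpow_mult)
  have q1: "cD (sr t \<circ> d) = Q * qvar * \<beta>'"
    by (simp add: cD_def Q_def \<beta>'_def l1 qpow_mult)
  have q2: "cD (d \<circ> sr t) = Q * qvar * \<beta>'"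
    by (simp add: cD_def Q_def b2 l2 qpow_mult)
  have q3: "cD (sr t \<circ> d \<circ> sr t) = Q * (qvar * \<alpha>' + (qvar - 1) * \<beta>')"
    by (simp add: cD_def Q_def b3 l3 algebra_simps)
  have "dD t d + (dD t (sr t \<circ> d) + (dD t (d \<circ> sr t) + dD t (sr t \<circ> d \<circ> sr t))) = 0"
    unfolding dD_def i1 i2 i3 x_def[symmetric] r0 r1 r1' r2 r2' r3 r3' q0 q1 q2 q3
    by (rule ext) (simp add: vec algebra_simps)
  moreover have "(\<Sum>x\<in>D d. dD t x) = dD t d + (dD t (sr t \<circ> d) + (dD t (d \<circ> sr t) + dD t (sr t \<circ> d \<circ> sr t)))"
  proof -
    have n: "d \<notin> {sr t \<circ> d, d \<circ> sr t, sr t \<circ> d \<circ> sr t}" "sr t \<circ> d \<notin> {d \<circ> sr t, sr t \<circ> d \<circ> sr t}"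
      "d \<circ> sr t \<notin> {sr t \<circ> d \<circ> sr t}"
      using distinct nc by (metis empty_iff insert_iff)+
    show ?thesis unfolding D_def'
      by (subst sum.insert[OF _ n(1)], simp, subst sum.insert[OF _ n(2)], simp, subst sum.insert[OF _ n(3)], simp, simp only: sum.insert[OF finite.emptyI empty_iff[THEN iffD1, THEN notI]] sum.empty) simp
  qed
  ultimately have "(\<Sum>x\<in>D v. dD t x) = 0" unfolding Dd by simp
  then show ?thesis unfolding D_def' .
qed

end

section \<open>Evaluation at the identity\<close>

context gcm
begin

lemma lamL_zero: "lamL ss 0 = 0" and rhoL_zero: "rhoL ss 0 = 0"
  using lamL_smul[of ss 0 0] rhoL_smul[of ss 0 0] by (simp_all add: smul_def zero_fun_def)

lemma lamL_diff: "lamL ss (m - n) = lamL ss m - lamL ss n"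
  using lamL_add[of ss "m - n" n] by (simp only: diff_add_cancel eq_diff_eq)

lemma rhoL_diff: "rhoL ss (m - n) = rhoL ss m - rhoL ss n"
  using rhoL_add[of ss "m - n" n] by (simp only: diff_add_cancel eq_diff_eq)

lemma additive_sum:
  fixes h :: "'b::comm_monoid_add \<Rightarrow> 'c::comm_monoid_add"
  assumes "h 0 = 0" "\<And>x y. h (x + y) = h x + h y" shows "h (\<Sum>i\<in>X. g i) = (\<Sum>i\<in>X. h (g i))"
  by (induction X rule: infinite_finite_induct) (simp_all add: assms)

text \<open>Along a reduced word \<open>rho\<close> is always evaluated at an element that the
  letter lengthens, so each letter contributes one factor \<open>qvar\<close> and no second term.
  This is the orthogonality of the standard basis under \<open>tau\<close>.\<close>

lemma rhoL_at_id: "reduced_word A y ys \<Longrightarrow> rhoL ys m id = qpow (int (length ys)) * m (winv y)"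
proof (induction ys arbitrary: y m)
  case Nil
  then have "y = id" by (simp add: reduced_word_def)
  moreover have "winv id = (id :: 's weyl_elt)" by (rule inv_id)
  ultimately show ?case by simp
next
  case (Cons s ys)
  have yW: "y \<in> W" using Cons.prems reduced_W by blast
  define x where "x = sr s \<circ> y"
  have xW: "x \<in> W" using yW by (simp add: x_def)
  have y: "y = sr s \<circ> x" by (simp add: x_def)
  have wx: "wp ys = x" using Cons.prems by (auto simp: reduced_word_def x_def)
  have le: "ell x \<le> length ys" using len_le[OF wx] .
  have ly: "ell y = Suc (length ys)" using Cons.prems by (simp add: reduced_word_def)
  have "ell y \<le> ell x + 1" unfolding y using len_left_cases[OF xW, of s] by linarith
  then have lx: "ell x = length ys" using le ly by linarith
  then have rx: "reduced_word A x ys" using wx by (simp add: reduced_word_def)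
  have iy: "winv y = winv x \<circ> sr s" unfolding y inv_comp[OF sr_W xW] by simp
  have "ell (winv x) < ell (winv x \<circ> sr s)"
    unfolding iy[symmetric] using lx ly xW yW by simp
  then have "rho s m (winv x) = qvar * m (winv y)" using xW unfolding iy rho_def by simp
  then have "rhoL (s # ys) m id = qpow (int (length ys)) * (qvar * m (winv y))"
    unfolding rhoL.simps Cons.IH[OF rx] by (simp only:)
  moreover have "qpow (int (length ys)) * (qvar * m (winv y)) = qpow (int (length (s # ys))) * m (winv y)"
    unfolding mult.assoc[symmetric] qpow_mult by (simp only: list.size(4) of_nat_add of_nat_1 One_nat_def[symmetric])
  ultimately show ?case by (rule trans)
qed

section \<open>Congruences modulo \<open>q - 1\<close>\<close>

definition cg :: "laurent \<Rightarrow> laurent \<Rightarrow> bool" where "cg a c \<longleftrightarrow> (qvar - 1) dvd (a - c)"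

lemma cg_refl [simp]: "cg a a" by (simp add: cg_def)
lemma cg_sym: "cg a c \<Longrightarrow> cg c a" unfolding cg_def by (metis dvd_minus_iff minus_diff_eq)
lemma cg_trans [trans]: "cg a c \<Longrightarrow> cg c d \<Longrightarrow> cg a d"
  unfolding cg_def using dvd_add[of "qvar - 1" "a - c" "c - d"] by simp
lemma cg_add: "cg a c \<Longrightarrow> cg a' c' \<Longrightarrow> cg (a + a') (c + c')"
  unfolding cg_def using dvd_add[of "qvar - 1" "a - c" "a' - c'"] by (simp add: algebra_simps)
lemma cg_mult: assumes "cg a c" "cg a' c'" shows "cg (a * a') (c * c')"
proof -
  have "a * a' - c * c' = (a - c) * a' + c * (a' - c')" by (simp add: algebra_simps)
  then show ?thesis using assms unfolding cg_def by simp
qed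
lemma cg_sum: "(\<And>i. i \<in> X \<Longrightarrow> cg (g i) 0) \<Longrightarrow> cg (\<Sum>i\<in>X. g i) 0"
  unfolding cg_def using dvd_sum[of X "qvar - 1" g] by simp
lemma cg_q: "cg qvar 1" and cg_q1: "cg (qvar - 1) 0" by (simp_all add: cg_def)

lemma cg_qpow: "cg (qpow n) 1"
proof -
  have nat: "cg (qpow (int k)) 1" for k
  proof (induction k)
    case (Suc k)
    have "cg (qvar * qpow (int k)) (1 * 1)" by (rule cg_mult[OF cg_q Suc.IH])
    then show ?case by (simp add: qpow_mult)
  qed simp
  show ?thesis
  proof (cases "n \<ge> 0")
    case True then show ?thesis using nat[of "nat n"] by simp
  next
    case False
    have "cg (qpow n * 1) (qpow n * qpow (int (nat (- n))))" by (rule cg_mult[OF cg_refl cg_sym[OF nat]])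
    then show ?thesis using False by (simp add: qpow_mult)
  qed
qed

lemma lam_cg: assumes "w \<in> W" shows "cg (lam s m w) (m (sr s \<circ> w))"
proof (cases "ell w < ell (sr s \<circ> w)")
  case True
  then have e: "lam s m w = qvar * m (sr s \<circ> w)" using assms unfolding lam_def by (simp only: not_True_eq_False if_False if_True)
  have "cg (qvar * m (sr s \<circ> w)) (1 * m (sr s \<circ> w))" by (rule cg_mult[OF cg_q cg_refl])
  then show ?thesis unfolding e by (simp only: mult_1)
next
  case False
  then have e: "lam s m w = m (sr s \<circ> w) + (qvar - 1) * m w" using assms unfolding lam_def by (simp only: not_True_eq_False if_False)
  have "cg (m (sr s \<circ> w) + (qvar - 1) * m w) (m (sr s \<circ> w) + 0 * m w)"
    by (rule cg_add[OF cg_refl cg_mult[OF cg_q1 cg_refl]])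
  then show ?thesis unfolding e by (simp only: mult_zero_left add_0_right)
qed

text \<open>At q = 1 the Hecke algebra is the group ring, so the operator of a word becomes
  translation by its product.\<close>

lemma lamL_cg: "w \<in> W \<Longrightarrow> cg (lamL ss m w) (m (winv (wp ss) \<circ> w))"
proof (induction ss arbitrary: w)
  case Nil
  have "winv (wp []) \<circ> w = w" by (simp add: inv_id[unfolded id_def] fun_eq_iff)
  then show ?case by (simp only: lamL.simps cg_refl)
next
  case (Cons s ss)
  have sw: "sr s \<circ> w \<in> W" using Cons.prems by simp
  have "cg (lam s (lamL ss m) w) (lamL ss m (sr s \<circ> w))" by (rule lam_cg[OF Cons.prems])
  also have "cg (lamL ss m (sr s \<circ> w)) (m (winv (wp ss) \<circ> (sr s \<circ> w)))"
    by (rule Cons.IH[OF sw])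
  also have "winv (wp ss) \<circ> (sr s \<circ> w) = winv (wp (s # ss)) \<circ> w"
    unfolding wp_Cons inv_comp[OF sr_W wp_in_W] by (simp only: inv_sr comp_assoc)
  finally show ?case by (simp only: lamL.simps)
qed

definition subprods :: "'s list \<Rightarrow> 's weyl_elt set" where
  "subprods ss = wp ` set (subseqs ss)"

text \<open>Multiplying by a generator yields at most the terms with and without the new letter, so
  every basis element that occurs comes from a subword.\<close>

lemma lamL_dl_nonzero: "lamL ss (dl x) z \<noteq> 0 \<Longrightarrow> \<exists>w\<in>subprods ss. z = w \<circ> x"
proof (induction ss arbitrary: z)
  case Nil
  then have "z = x" by (auto simp: dl_def split: if_splits)
  moreover have "id \<in> subprods []" by (simp add: subprods_def)
  ultimately show ?case by (intro bexI[of _ id]) simp_all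
next
  case (Cons s ss)
  have "lamL ss (dl x) (sr s \<circ> z) \<noteq> 0 \<or> lamL ss (dl x) z \<noteq> 0"
    using Cons.prems unfolding lamL.simps lam_def by (auto split: if_splits)
  then show ?case
  proof
    assume "lamL ss (dl x) (sr s \<circ> z) \<noteq> 0"
    then obtain w where w: "w \<in> subprods ss" "sr s \<circ> z = w \<circ> x" using Cons.IH by blast
    then obtain rs where rs: "rs \<in> set (subseqs ss)" "w = wp rs" by (auto simp: subprods_def)
    have "z = sr s \<circ> (sr s \<circ> z)" by simp
    also have "\<dots> = wp (s # rs) \<circ> x" unfolding w(2) rs(2) wp_Cons by (simp only: comp_assoc)
    finally have z: "z = wp (s # rs) \<circ> x" .
    have "s # rs \<in> set (subseqs (s # ss))" using rs(1) by (simp add: Let_def)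
    then have "wp (s # rs) \<in> subprods (s # ss)" unfolding subprods_def by (rule imageI)
    then show ?thesis using z by blast
  next
    assume "lamL ss (dl x) z \<noteq> 0"
    then obtain w where w: "w \<in> subprods ss" "z = w \<circ> x" using Cons.IH by blast
    then have "w \<in> subprods (s # ss)" by (auto simp: subprods_def Let_def)
    then show ?thesis using w(2) by blast
  qed
qed

end

section \<open>Cancellation within the groups of pairs\<close>

context e7_trace
begin

lemma supported_kp: assumes "p \<in> valid" shows "supported (kp p)"
proof -
  obtain v1 v2 where p: "p = (v1, v2)" by fastforce
  note v = valid_par[of v1 v2]
  show ?thesis unfolding p kp_def using assms v(4) p
    by (intro supported_lamL supported_rhoL supported_dl) simp
qed

lemma defect_pair:
  assumes p: "(v1, v2) \<in> valid" and p': "(sr s \<circ> v1, v2) \<in> valid" and l: "ell (sr s \<circ> v1) = ell v1 + 1"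
  shows "defect s (v1, v2) + defect s (sr s \<circ> v1, v2) = 0"
proof -
  note v = valid_par[OF p]
  have k: "kp (sr s \<circ> v1, v2) = lam s (rho s (kp (v1, v2)))"
    unfolding kp_def fst_conv snd_conv by (rule Lm_Rm_up[OF v(1) valid_par(1)[OF p'] l v(5)])
  have c: "cq (sr s \<circ> v1, v2) = qpow (- 1) * cq (v1, v2)"
    unfolding cq_def fst_conv snd_conv l mult.assoc[symmetric] qpow_mult
    by (simp only: of_nat_add of_nat_1 diff_conv_add_uminus minus_add_distrib ac_simps)
  show ?thesis unfolding defect_def k c by (rule quad_sum[OF supported_kp[OF p]])
qed

lemma grp_sum:
  assumes "p \<in> valid" shows "(\<Sum>x\<in>grp s p. defect s x) = 0"
proof -
  obtain v1 v2 where p: "p = (v1, v2)" by fastforce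
  have valid: "(v1, v2) \<in> valid" using assms p by simp
  note v = valid_par[OF valid]
  show ?thesis
  proof (cases "sr s \<circ> v1 \<in> mcr II")
    case True
    show ?thesis
    proof (cases "(sr s \<circ> v1, v2) \<in> valid")
      case T: True
      have g: "grp s p = {(v1, v2), (sr s \<circ> v1, v2)}"
        using True T valid unfolding grp_def p fst_conv snd_conv by simp
      have ne: "(v1, v2) \<noteq> (sr s \<circ> v1, v2)" using len_left_cases[OF v(3), of s] by force
      have "(\<Sum>x\<in>grp s p. defect s x) = defect s (v1, v2) + defect s (sr s \<circ> v1, v2)"
        unfolding g using ne by simp
      also have "\<dots> = 0"
      proof (cases "ell (sr s \<circ> v1) = ell v1 + 1")
        case True then show ?thesis by (rule defect_pair[OF valid T])
      next
        case False
        have ss: "sr s \<circ> (sr s \<circ> v1) = v1" by simp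
        have "ell v1 = ell (sr s \<circ> v1) + 1" using False len_left_cases[OF v(3), of s] by blast
        then have "defect s (sr s \<circ> v1, v2) + defect s (v1, v2) = 0"
          using defect_pair[OF T, of s] valid unfolding ss by blast
        then show ?thesis by (simp only: add.commute)
      qed
      finally show ?thesis .
    next
      case F: False
      have g: "grp s p = {(v1, v2)}" using True F valid unfolding grp_def p fst_conv snd_conv by auto
      obtain j where j: "E8_node j" "v2 \<in> par (CJ j)" "v1 (theta j) = \<alpha> s"
        by (rule invalid_step[OF valid True F])
      have "defect s (v1, v2) = 0"
        unfolding defect_def kp_E8[OF v(1) j] by (simp add: smul_def vec zero_fun_def)
      then show ?thesis unfolding g by simp
    qed
  next
    case False
    then obtain t where t: "t \<in> II" "v1 (\<alpha> t) = \<alpha> s" using deodhar[OF v(1)] by blast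
    have c: "v1 \<circ> sr t = sr s \<circ> v1" by (rule reflection_eq[OF v(3) t(2)])
    have T: "winv v1 \<circ> sr s \<circ> v1 = sr t"
    proof -
      have "winv v1 \<circ> (v1 \<circ> sr t) = sr t" using v(3) by (simp add: comp_assoc[symmetric])
      then show ?thesis unfolding c by (simp only: comp_assoc)
    qed
    have g: "grp s p = Pair v1 ` quad (sr t) v2 \<inter> valid"
      unfolding grp_def p fst_conv snd_conv T using False by simp
    \<comment> \<open>All pairs of the group share the conjugation by the basis element of
      \<open>v1\<close>; collecting it in the linear map \<open>h\<close> leaves a statement about
      the second components.\<close>
    define h where "h = (\<lambda>m. qpow (- int (ell v1)) \<cdot> Lm v1 (Rm (winv v1) m))"
    have h0: "h 0 = 0" unfolding h_def rhoL_zero lamL_zero by (simp add: smul_def zero_fun_def)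
    have hadd: "h (m + n) = h m + h n" for m n :: "'s weyl_elt \<Rightarrow> laurent"
      unfolding h_def rhoL_add lamL_add smul_add_right ..
    have d: "defect s (v1, x) = h (dD t x)" if "(v1, x) \<in> valid" for x
    proof -
      note vx = valid_par[OF that]
      have cqx: "cq (v1, x) = qpow (- int (ell v1)) * cD x"
        unfolding cq_def cD_def fst_conv snd_conv mult.assoc[symmetric] qpow_mult by simp
      have "rho s (kp (v1, x)) - lam s (kp (v1, x))
         = Lm v1 (Rm (winv v1) (rho t (dl (w0 \<circ> winv x)) - lam t (dl (w0 \<circ> winv x))))"
        unfolding kp_def fst_conv snd_conv Lm_Rm_lam[OF v(1) t vx(5)] lamL_diff rhoL_diff ..
      then show ?thesis unfolding defect_def cqx h_def dD_def
        by (simp only: rhoL_smul lamL_smul smul_smul)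
    qed
    show ?thesis
    proof (cases "t \<in> I1")
      case True
      have "defect s y = 0" if "y \<in> grp s p" for y
      proof -
        obtain x where x: "y = (v1, x)" "(v1, x) \<in> valid" using \<open>y \<in> grp s p\<close> unfolding g by blast
        have "sr t \<circ> x = x \<circ> sr t" by (rule I12_commute[OF sr_parabolic[OF True] valid_par(2)[OF x(2)]])
        then have "dD t x = 0" by (rule dD_commute[OF t(1) valid_par(2)[OF x(2)]])
        then show ?thesis unfolding x(1) d[OF x(2)] by (simp only: h0)
      qed
      then show ?thesis by (rule sum.neutral[OF ballI])
    next
      case F: False
      then have tI: "t \<in> I2" using t(1) by blast
      \<comment> \<open>The cancellation needs the whole double coset, and validity is constant on
        it.\<close>
      have all: "(v1, x) \<in> valid" if "x \<in> quad (sr t) v2" for x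
      proof -
        have "\<exists>y z. y \<in> {id, sr t} \<and> z \<in> {id, sr t} \<and> x = y \<circ> v2 \<circ> z"
          using that unfolding quad_def by (elim insertE emptyE) (metis comp_id id_comp insertCI)+
        then show ?thesis using valid_sr_I2[OF v(1) tI t(2)] valid by blast
      qed
      then have g': "grp s p = Pair v1 ` quad (sr t) v2" unfolding g by blast
      have "(\<Sum>y\<in>grp s p. defect s y) = (\<Sum>x\<in>quad (sr t) v2. defect s (v1, x))"
        unfolding g' by (subst sum.reindex) (auto simp: inj_on_def)
      also have "\<dots> = (\<Sum>x\<in>quad (sr t) v2. h (dD t x))" using d all by (intro sum.cong) auto
      also have "\<dots> = h (\<Sum>x\<in>quad (sr t) v2. dD t x)" by (rule additive_sum[of h, OF h0 hadd, symmetric])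
      also have "\<dots> = 0" unfolding quad_def dD_double_coset[OF tI v(2)] by (rule h0)
      finally show ?thesis .
    qed
  qed
qed

section \<open>Finiteness of the sum\<close>

definition supportG :: "'s falg \<Rightarrow> ('s weyl_elt \<times> 's weyl_elt) set" where
  "supportG x = {p \<in> valid. G p x \<noteq> 0}"

lemma F_support_G: "F_support A I1 f (cls x) = supportG x"
  unfolding F_support_def supportG_def using F_term_G by auto

text \<open>Moving \<open>v1\<close> back out of \<open>kp\<close> turns the trace into a single
  coefficient of the product of \<open>x\<close> with the basis element of \<open>v1\<close>. Both
  finiteness and the reduction at q = 1 are read off from it.\<close>

lemma act_kp_value:
  assumes "(v1, v2) \<in> valid"
  shows "act x (kp (v1, v2)) id = qpow (int (ell (v1 \<circ> v2 \<circ> w0))) * act x (dl v1) (v1 \<circ> v2 \<circ> w0)"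
proof -
  note v = valid_par[OF assms]
  have W: "v1 \<circ> v2 \<circ> w0 \<in> W" using v by simp
  then have iW: "winv (v1 \<circ> v2 \<circ> w0) \<in> W" by simp
  show ?thesis unfolding act_kp[OF assms] rhoL_at_id[OF rw_reduced[OF iW]] rw_length[OF iW]
      len_inv[OF W] inv_inv_W[OF W] ..
qed

lemma G_add: "G p (x + y) = G p x + G p y"
  unfolding G_def act_add plus_fun_apply[of _ _ id] by (simp only: distrib_left)

lemma G_scalar: "G p (scalar c * x) = c * G p x"
  unfolding G_def act_mult act_scalar smul_apply[of c _ id] by (simp only: mult.left_commute)

lemma supportG_finite: "finite (supportG x)"
proof (induction x rule: falg_induct)
  case (single ss c)
  have "supportG (scalar c * word_monomial ss) \<subseteq> {p \<in> valid. wt p \<in> subprods ss}"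
  proof
    fix p assume p: "p \<in> supportG (scalar c * word_monomial ss)"
    obtain v1 v2 where e: "p = (v1, v2)" by fastforce
    have valid: "(v1, v2) \<in> valid" and "G (v1, v2) (scalar c * word_monomial ss) \<noteq> 0"
      using p e by (auto simp: supportG_def)
    then have "act (word_monomial ss) (kp (v1, v2)) id \<noteq> 0" unfolding G_scalar unfolding G_def by auto
    then have "act (word_monomial ss) (dl v1) (v1 \<circ> v2 \<circ> w0) \<noteq> 0" unfolding act_kp_value[OF valid] by auto
    then have "lamL ss (dl v1) (v1 \<circ> v2 \<circ> w0) \<noteq> 0" unfolding act_word .
    then obtain w where w: "w \<in> subprods ss" "v1 \<circ> v2 \<circ> w0 = w \<circ> v1" using lamL_dl_nonzero by blast
    \<comment> \<open>A nonzero coefficient of a word forces \<open>wt\<close> of the pair to be one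
      of finitely many subproducts, and \<open>valid_unique\<close> makes the fibres of
      \<open>wt\<close> singletons.\<close>
    have "w = wt (v1, v2)"
      unfolding wt_eq_iff[OF valid_par(3)[OF valid]] w(2)[symmetric] by (simp only: comp_assoc)
    then show "p \<in> {p \<in> valid. wt p \<in> subprods ss}" using w(1) valid e by simp
  qed
  moreover have "finite {p \<in> valid. wt p \<in> subprods ss}"
  proof (rule finite_imageD)
    show "finite (wt ` {p \<in> valid. wt p \<in> subprods ss})"
      by (rule finite_subset[of _ "subprods ss"]) (auto simp: subprods_def)
    show "inj_on wt {p \<in> valid. wt p \<in> subprods ss}"
      by (rule inj_onI, rule valid_unique) (simp_all only: mem_Collect_eq)
  qed
  ultimately show ?case by (rule finite_subset)
next
  case (add x y)
  have "supportG (x + y) \<subseteq> supportG x \<union> supportG y" by (auto simp: supportG_def G_add)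
  then show ?case using add finite_subset by blast
qed

section \<open>The trace on the free algebra\<close>

definition tr :: "'s falg \<Rightarrow> laurent" where "tr x = (\<Sum>p\<in>supportG x. G p x)"

lemma tr_superset: "finite U \<Longrightarrow> supportG x \<subseteq> U \<Longrightarrow> U \<subseteq> valid \<Longrightarrow> tr x = (\<Sum>p\<in>U. G p x)"
  unfolding tr_def by (rule sum.mono_neutral_left) (auto simp: supportG_def)

lemma trace_F_tr: "trace_F A I1 f (cls x) = tr x"
  unfolding trace_F_def tr_def F_support_G using F_term_G by (intro sum.cong) (auto simp: supportG_def)

lemma supportG_valid: "supportG x \<subseteq> valid"
  by (auto simp: supportG_def)

lemma tr_add: "tr (x + y) = tr x + tr y"
proof -
  define U where "U = supportG x \<union> supportG y \<union> supportG (x + y)"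
  have "finite U" "U \<subseteq> valid" using supportG_finite supportG_valid unfolding U_def by auto
  then have e: "tr z = (\<Sum>p\<in>U. G p z)" if "supportG z \<subseteq> U" for z using tr_superset that by blast
  have "supportG (x + y) \<subseteq> U" "supportG x \<subseteq> U" "supportG y \<subseteq> U" unfolding U_def by blast+
  note this[THEN e]
  then show ?thesis by (simp only: G_add sum.distrib)
qed

lemma tr_scalar: "tr (scalar c * x) = c * tr x"
proof -
  define U where "U = supportG x \<union> supportG (scalar c * x)"
  have "finite U" "U \<subseteq> valid" using supportG_finite supportG_valid unfolding U_def by auto
  then have e: "tr z = (\<Sum>p\<in>U. G p z)" if "supportG z \<subseteq> U" for z using tr_superset that by blast
  have "supportG (scalar c * x) \<subseteq> U" "supportG x \<subseteq> U" unfolding U_def by blast+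
  note this[THEN e]
  then show ?thesis by (simp only: G_scalar sum_distrib_left)
qed

text \<open>The difference of the two traces is a sum of defects, and it splits into complete
  groups, each of which cancels by \<open>grp_sum\<close>.\<close>

lemma tr_letter: "tr (Ts s * x) = tr (x * Ts s)"
proof -
  define U0 where "U0 = supportG (Ts s * x) \<union> supportG (x * Ts s)"
  \<comment> \<open>The supports need not be unions of groups, so they are saturated first; the
    added summands are zero for the traces but complete the cancellation of the defects.\<close>
  define U where "U = (\<Union>p\<in>U0. grp s p)"
  have U0: "finite U0" "U0 \<subseteq> valid" using supportG_finite supportG_valid by (auto simp: U0_def)
  have U: "finite U" "U \<subseteq> valid" "U0 \<subseteq> U"
  proof -
    show "finite U" unfolding U_def using U0(1) grp_finite by (rule finite_UN_I)
    show "U \<subseteq> valid" unfolding U_def by (rule UN_least[OF grp_valid])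
    show "U0 \<subseteq> U"
    proof
      fix p assume p: "p \<in> U0"
      then have "p \<in> grp s p" using U0(2) by (intro grp_self subsetD[of U0 valid])
      then show "p \<in> U" unfolding U_def using p by (rule UN_I[rotated])
    qed
  qed
  have "supportG (Ts s * x) \<subseteq> U" "supportG (x * Ts s) \<subseteq> U" using U(3) unfolding U0_def by blast+
  note this[THEN tr_superset[OF U(1) _ U(2)]]
  then have "tr (Ts s * x) - tr (x * Ts s) = (\<Sum>p\<in>U. act x (defect s p) id)"
    by (simp only: G_defect[symmetric] sum_subtractf)
  also have "\<dots> = (\<Sum>C\<in>grp s ` U0. \<Sum>p\<in>C. act x (defect s p) id)"
    unfolding U_def
  proof (rule sum.Union_disjoint[unfolded comp_def])
    show "\<forall>C\<in>grp s ` U0. finite C" using grp_finite by blast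
    show "\<forall>C\<in>grp s ` U0. \<forall>D\<in>grp s ` U0. C \<noteq> D \<longrightarrow> C \<inter> D = {}"
    proof (intro ballI impI)
      fix C D assume "C \<in> grp s ` U0" "D \<in> grp s ` U0" "C \<noteq> D"
      then obtain p q where "p \<in> valid" "q \<in> valid" "C = grp s p" "D = grp s q" using U0 by blast
      then show "C \<inter> D = {}" using grp_eq \<open>C \<noteq> D\<close> by (metis disjoint_iff)
    qed
  qed
  also have "\<dots> = 0"
  proof (rule sum.neutral, rule ballI)
    fix C assume "C \<in> grp s ` U0"
    then obtain p where p: "p \<in> valid" "C = grp s p" using U0 by blast
    have "(\<Sum>p\<in>C. act x (defect s p) id) = (\<Sum>p\<in>C. act x (defect s p)) id" by (rule sum_fun_apply[symmetric])
    also have "(\<Sum>p\<in>C. act x (defect s p)) = act x (\<Sum>p\<in>C. defect s p)"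
      by (rule additive_sum[of "act x", OF act_m0 act_madd, symmetric])
    also have "\<dots> = 0" unfolding p(2) grp_sum[OF p(1)] by (rule act_m0)
    finally show "(\<Sum>p\<in>C. act x (defect s p) id) = 0" unfolding zero_fun_apply[of id] .
  qed
  finally show ?thesis by (simp only: right_minus_eq)
qed

text \<open>A word is moved around one letter at a time; linearity covers the rest.\<close>

lemma tr_commute: "tr (x * y) = tr (y * x)"
proof (induction x arbitrary: y rule: falg_induct)
  case (single ss c)
  have w: "tr (word_monomial ss * y) = tr (y * word_monomial ss)" for y
  proof (induction ss arbitrary: y)
    case (Cons s ss)
    have "tr (word_monomial (s # ss) * y) = tr (Ts s * (word_monomial ss * y))"
      by (simp only: word_monomial_Cons[of s ss] mult.assoc)
    also have "\<dots> = tr (word_monomial ss * (y * Ts s))" by (simp only: tr_letter mult.assoc)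
    also have "\<dots> = tr (y * Ts s * word_monomial ss)" by (rule Cons.IH)
    finally show ?case by (simp only: word_monomial_Cons[of s ss] mult.assoc)
  qed simp
  have "tr (scalar c * word_monomial ss * y) = c * tr (word_monomial ss * y)"
    by (simp only: mult.assoc tr_scalar)
  also have "\<dots> = tr (scalar c * (y * word_monomial ss))" by (simp only: tr_scalar w)
  also have "scalar c * (y * word_monomial ss) = y * (scalar c * word_monomial ss)"
    by (simp only: mult.assoc[symmetric] scalar_central[of c y])
  finally show ?case .
next
  case (add x z)
  then show ?case by (simp only: distrib_left distrib_right tr_add)
qed

lemma tr_diff: "tr (x - y) = tr x - tr y"
  using tr_add[of "x - y" y] by simp

lemma trace_F_commutator:
  assumes "h \<in> commutator_span A (carrier HH)" shows "h \<in> carrier HH \<and> trace_F A I1 f h = 0"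
  using assms unfolding commutator_span_def
proof (induction rule: hecke_span.induct)
  case zero
  have "tr 0 = 0" using tr_scalar[of 0 0] by simp
  then show ?case by (simp add: cls_zero trace_F_tr)
next
  case (step x y c)
  obtain a c' where ac: "x = a \<otimes>\<^bsub>HH\<^esub> c' \<ominus>\<^bsub>HH\<^esub> c' \<otimes>\<^bsub>HH\<^esub> a" "a \<in> carrier HH" "c' \<in> carrier HH"
    using step(1) by blast
  obtain u where u: "a = cls u" using ac(2) by (rule carrierE)
  obtain v where v: "c' = cls v" using ac(3) by (rule carrierE)
  have uv: "x = cls (u * v - v * u)" unfolding ac(1) u v cls_mult cls_minus ..
  obtain z where z: "y = cls z" using step(3)[THEN conjunct1] by (rule carrierE)
  have "tr z = 0" using step(3) unfolding z trace_F_tr by blast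
  moreover have "tr (u * v - v * u) = 0" unfolding tr_diff tr_commute[of u v] by simp
  ultimately have "tr (scalar c * (u * v - v * u) + z) = 0" unfolding tr_add tr_scalar by simp
  then show ?case unfolding uv z cls_smult cls_add trace_F_tr by simp
qed

text \<open>Two representatives of a coset differ by an element of the commutator span, on which the
  trace vanishes, so a chosen representative gives a well-defined value.\<close>

lemma trace_F_factors:
  "\<exists>Fbar. \<forall>h\<in>carrier HH. Fbar (commutator_span A (carrier HH) +>\<^bsub>HH\<^esub> h) = trace_F A I1 f h"
proof -
  define C where "C = commutator_span A (carrier HH)"
  have eq: "trace_F A I1 f h = trace_F A I1 f k"
    if hk: "h \<in> carrier HH" "k \<in> carrier HH" "C +>\<^bsub>HH\<^esub> h = C +>\<^bsub>HH\<^esub> k" for h k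
  proof -
    obtain x where x: "h = cls x" using hk(1) by (rule carrierE)
    obtain y where y: "k = cls y" using hk(2) by (rule carrierE)
    have "\<zero>\<^bsub>HH\<^esub> \<oplus>\<^bsub>HH\<^esub> h = h" unfolding x cls_zero cls_add by (simp only: add_0_left)
    moreover have "\<zero>\<^bsub>HH\<^esub> \<in> C" unfolding C_def commutator_span_def by (rule hecke_span.zero)
    ultimately have "h \<in> C +>\<^bsub>HH\<^esub> h" unfolding a_r_coset_def' by (metis UN_I singletonI)
    then have "h \<in> C +>\<^bsub>HH\<^esub> k" by (rule back_subst[of "(\<in>) h"]) (rule hk(3))
    then obtain c where c: "c \<in> C" "h = c \<oplus>\<^bsub>HH\<^esub> k" unfolding a_r_coset_def' by blast
    have cc: "c \<in> carrier HH \<and> trace_F A I1 f c = 0" using c(1) unfolding C_def by (rule trace_F_commutator)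
    obtain w where w: "c = cls w" using cc[THEN conjunct1] by (rule carrierE)
    have z: "tr w = 0" using cc unfolding w trace_F_tr by blast
    show ?thesis unfolding c(2) unfolding w y cls_add trace_F_tr tr_add z by (rule add_0_left)
  qed
  define Fbar where "Fbar = (\<lambda>D. trace_F A I1 f (SOME h. h \<in> carrier HH \<and> C +>\<^bsub>HH\<^esub> h = D))"
  have "Fbar (C +>\<^bsub>HH\<^esub> h) = trace_F A I1 f h" if h: "h \<in> carrier HH" for h
  proof -
    have "\<exists>k. k \<in> carrier HH \<and> C +>\<^bsub>HH\<^esub> k = C +>\<^bsub>HH\<^esub> h" using h by blast
    then have "(SOME k. k \<in> carrier HH \<and> C +>\<^bsub>HH\<^esub> k = C +>\<^bsub>HH\<^esub> h) \<in> carrier HH \<and>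
       C +>\<^bsub>HH\<^esub> (SOME k. k \<in> carrier HH \<and> C +>\<^bsub>HH\<^esub> k = C +>\<^bsub>HH\<^esub> h) = C +>\<^bsub>HH\<^esub> h" by (rule someI_ex)
    then show ?thesis unfolding Fbar_def by (intro eq h) blast+
  qed
  then show ?thesis unfolding C_def by blast
qed

section \<open>Reduction at q = 1\<close>

lemma G_cg:
  assumes p: "p \<in> valid" and w: "w \<in> W"
  shows "cg (G p (Tm w)) (if w = wt p then ff (snd p) else 0)"
proof -
  obtain v1 v2 where e: "p = (v1, v2)" by fastforce
  have valid: "(v1, v2) \<in> valid" using p e by simp
  note v = valid_par[OF valid]
  define y where "y = v1 \<circ> v2 \<circ> w0"
  have yW: "y \<in> W" using v by (simp add: y_def)
  have "cg (lamL (rw w) (dl v1) y) (dl v1 (winv (wp (rw w)) \<circ> y))" by (rule lamL_cg[OF yW])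
  then have c: "cg (act (Tm w) (dl v1) y) (dl v1 (winv w \<circ> y))" unfolding Tm_def act_word rw_wp[OF w] .
  \<comment> \<open>In the group ring the coefficient of \<open>y\<close> in the product of
    \<open>w\<close> and \<open>v1\<close> is 1 or 0 according to whether
    \<open>w \<circ> v1\<close> equals \<open>y\<close>, which is the equation
    \<open>w = wt p\<close>.\<close>
  have "winv w \<circ> y = v1 \<longleftrightarrow> y = w \<circ> v1"
    using w by (metis W_inv_left W_inv_right comp_assoc id_comp)
  moreover have "w = wt (v1, v2) \<longleftrightarrow> y = w \<circ> v1"
    unfolding wt_eq_iff[OF v(3)] y_def comp_assoc by (rule eq_commute)
  ultimately have d: "dl v1 (winv w \<circ> y) = (if w = wt p then 1 else 0)" unfolding dl_def e by simp
  have cqc: "cg (cq p) (1 * ff (snd p))" unfolding cq_def by (rule cg_mult[OF cg_qpow cg_refl])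
  have "cg (cq p * (qpow (int (ell y)) * act (Tm w) (dl v1) y)) (1 * ff (snd p) * (1 * (if w = wt p then 1 else 0)))"
    by (rule cg_mult[OF cqc cg_mult[OF cg_qpow c[unfolded d]]])
  then show ?thesis unfolding G_def e act_kp_value[OF valid] y_def by (simp split: if_splits)
qed

text \<open>Apply the trace property to \<open>sr t\<close> and \<open>v \<circ> sr t\<close>;
  modulo \<open>qvar - 1\<close> both steps reduce to plain multiplication in the group, whether the
  length goes up or down.\<close>

lemma ff_conj_letter:
  assumes t: "t \<in> I2" and v: "v \<in> par I2" shows "cg (ff (sr t \<circ> v \<circ> sr t)) (ff v)"
proof -
  define x where "x = v \<circ> sr t"
  have x: "x \<in> par I2" unfolding x_def using v t sr_parabolic comp_parabolic by blast
  have down: "cg (qvar * a + (qvar - 1) * c) a" for a c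
  proof -
    have "cg (qvar * a + (qvar - 1) * c) (1 * a + 0 * c)"
      by (rule cg_add[OF cg_mult[OF cg_q cg_refl] cg_mult[OF cg_q1 cg_refl]])
    then show ?thesis by simp
  qed
  have "cg (step_left t x) (ff (sr t \<circ> x))" unfolding step_left_def using down by auto
  moreover have "cg (step_right t x) (ff (x \<circ> sr t))" unfolding step_right_def using down by auto
  ultimately have "cg (ff (sr t \<circ> x)) (ff (x \<circ> sr t))"
    unfolding step_left_right[OF t x] using cg_sym cg_trans by blast
  then show ?thesis unfolding x_def comp_assoc sr_comp_self comp_id .
qed

lemma ff_conj:
  assumes y: "y \<in> par I2" and v: "v \<in> par I2" shows "cg (ff (y \<circ> v \<circ> winv y)) (ff v)"
proof -
  obtain ss where ss: "set ss \<subseteq> I2" "y = wp ss" using y by (rule parabolicE)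
  have "cg (ff (wp ss \<circ> v \<circ> winv (wp ss))) (ff v)"
    using ss(1)
  proof (induction ss)
    case Nil
    have "wp [] \<circ> v \<circ> winv (wp []) = v" unfolding wp_Nil inv_id by simp
    then show ?case by (simp only: cg_refl)
  next
    case (Cons s ss)
    define u where "u = wp ss \<circ> v \<circ> winv (wp ss)"
    have up: "u \<in> par I2" unfolding u_def using Cons.prems v
      by (intro comp_parabolic inv_parabolic wp_in_parabolic) auto
    have "wp (s # ss) \<circ> v \<circ> winv (wp (s # ss)) = sr s \<circ> u \<circ> sr s"
      unfolding u_def wp_Cons inv_comp[OF sr_W wp_in_W] inv_sr by (simp only: comp_assoc)
    moreover have "cg (ff (sr s \<circ> u \<circ> sr s)) (ff u)" using Cons.prems by (intro ff_conj_letter up) simp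
    moreover have "set ss \<subseteq> I2" using Cons.prems by simp
    then have "cg (ff u) (ff v)" unfolding u_def by (rule Cons.IH)
    ultimately show ?case using cg_trans by metis
  qed
  then show ?thesis unfolding ss(2) .
qed

lemma tr_mod_valid:
  assumes w: "w \<in> W" and p: "p \<in> valid" "wt p = w" shows "cg (tr (Tm w)) (ff (snd p))"
proof -
  define U where "U = insert p (supportG (Tm w))"
  have U: "finite U" "U \<subseteq> valid" "supportG (Tm w) \<subseteq> U"
    using supportG_finite supportG_valid p by (auto simp: U_def)
  have "tr (Tm w) = (\<Sum>x\<in>U. G x (Tm w))" by (rule tr_superset[OF U(1,3,2)])
  also have "\<dots> = G p (Tm w) + (\<Sum>x\<in>U - {p}. G x (Tm w))" using U(1) by (intro sum.remove) (simp_all add: U_def)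
  finally have e: "tr (Tm w) = G p (Tm w) + (\<Sum>x\<in>U - {p}. G x (Tm w))" .
  have "cg (\<Sum>x\<in>U - {p}. G x (Tm w)) 0"
  proof (rule cg_sum)
    fix x assume x: "x \<in> U - {p}"
    then have "x \<in> valid" "w \<noteq> wt x" using U(2) valid_unique[of x p] p by auto
    then show "cg (G x (Tm w)) 0" using G_cg[of x w] w by (simp only: if_False)
  qed
  moreover have "cg (G p (Tm w)) (ff (snd p))" using G_cg[OF p(1) w] unfolding if_P[OF p(2)[symmetric]] .
  ultimately show ?thesis unfolding e using cg_add by fastforce
qed

lemma tr_mod_none:
  assumes w: "w \<in> W" and no: "\<And>p. p \<in> valid \<Longrightarrow> wt p \<noteq> w" shows "cg (tr (Tm w)) 0"
  unfolding tr_def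
proof (rule cg_sum)
  fix x assume "x \<in> supportG (Tm w)"
  then have x: "x \<in> valid" using supportG_valid by blast
  have "w \<noteq> wt x" using no[OF x] by blast
  then show "cg (G x (Tm w)) 0" using G_cg[OF x w] by (simp only: if_False)
qed

lemma conj_w0: assumes "w2 \<in> par I2" "x \<in> W"
  shows "x \<circ> (w0 \<circ> w2) \<circ> winv x = x \<circ> w2 \<circ> w0 \<circ> winv x"
proof -
  have "w0 \<circ> w2 = w2 \<circ> w0" by (rule w0_commute[OF par_I2_II[OF assms(1)]])
  then have "x \<circ> (w0 \<circ> w2) \<circ> winv x = x \<circ> (w2 \<circ> w0) \<circ> winv x"
    by (rule arg_cong[of _ _ "\<lambda>u. x \<circ> u \<circ> winv x"])
  then show ?thesis unfolding comp_assoc .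
qed

theorem trace_F_mod:
  assumes w: "w \<in> W"
  shows "\<And>w2. w2 \<in> par I2 \<Longrightarrow> conjugate A (longest A I1 \<circ> w2) w \<Longrightarrow>
      (qvar - 1) dvd (trace_F A I1 f (hecke_T A w) - f (hecke_T A w2))"
    and "\<nexists>w2. w2 \<in> par I2 \<and> conjugate A (longest A I1 \<circ> w2) w \<Longrightarrow> (qvar - 1) dvd trace_F A I1 f (hecke_T A w)"
proof -
  fix w2 assume w2: "w2 \<in> par I2" and "conjugate A (longest A I1 \<circ> w2) w"
  then obtain x where x: "x \<in> W" "w = x \<circ> (w0 \<circ> w2) \<circ> winv x" unfolding conjugate_def w0_def by blast
  then have wx: "w = x \<circ> w2 \<circ> w0 \<circ> winv x" using conj_w0[OF w2] by simp
  obtain v1 v2 y where v: "(v1, v2) \<in> valid" "wt (v1, v2) = w" "y \<in> par I2" "v2 = y \<circ> w2 \<circ> winv y"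
    using valid_exists[OF w2 x(1)] unfolding wx by blast
  have "cg (tr (Tm w)) (ff v2)" using tr_mod_valid[OF w v(1,2)] by simp
  also have "cg (ff v2) (ff w2)" unfolding v(4) by (rule ff_conj[OF v(3) w2])
  finally show "(qvar - 1) dvd (trace_F A I1 f (hecke_T A w) - f (hecke_T A w2))"
    unfolding cg_def ff_def hecke_T_cls trace_F_tr .
next
  assume no: "\<nexists>w2. w2 \<in> par I2 \<and> conjugate A (longest A I1 \<circ> w2) w"
  have "wt p \<noteq> w" if "p \<in> valid" for p
  proof
    assume eq: "wt p = w"
    obtain v1 v2 where p: "p = (v1, v2)" by fastforce
    note v = valid_par[OF that[unfolded p]]
    have "w = v1 \<circ> (w0 \<circ> v2) \<circ> winv v1" unfolding conj_w0[OF v(2,3)] eq[symmetric] p by simp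
    then have "conjugate A (longest A I1 \<circ> v2) w" unfolding conjugate_def w0_def using v(3) by blast
    then show False using no v(2) by blast
  qed
  then have "cg (tr (Tm w)) 0" by (rule tr_mod_none[OF w])
  then show "(qvar - 1) dvd trace_F A I1 f (hecke_T A w)"
    unfolding cg_def hecke_T_cls trace_F_tr by simp
qed

end

theorem theorem9p2:
  fixes A :: "'s::finite \<Rightarrow> 's \<Rightarrow> int"
    and alpha coalpha :: "'s \<Rightarrow> 'r::finite \<Rightarrow> int"
    and I\<^sub>1 I\<^sub>2 :: "'s set"
    and f :: "'s falg set \<Rightarrow> laurent"
  assumes "kac_moody_root_datum A alpha coalpha"
    and "type_E 7 A I\<^sub>1"
    and "I\<^sub>2 = commutant A I\<^sub>1"
    and "laurent_linear_on A (hecke_parabolic A I\<^sub>2) f"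
    and "\<forall>h\<in>commutator_span A (hecke_parabolic A I\<^sub>2). f h = 0"
  shows "(\<forall>h\<in>carrier (hecke A). finite (F_support A I\<^sub>1 f h)) \<and>
         (\<forall>h\<in>commutator_span A (carrier (hecke A)). trace_F A I\<^sub>1 f h = 0) \<and>
         (\<exists>Fbar. \<forall>h\<in>carrier (hecke A).
            Fbar (commutator_span A (carrier (hecke A)) +>\<^bsub>hecke A\<^esub> h) = trace_F A I\<^sub>1 f h) \<and>
         (\<forall>w\<in>weyl_group A.
            (\<forall>w\<^sub>2\<in>parabolic A I\<^sub>2. conjugate A (longest A I\<^sub>1 \<circ> w\<^sub>2) w \<longrightarrow>
               (qvar - 1) dvd (trace_F A I\<^sub>1 f (hecke_T A w) - f (hecke_T A w\<^sub>2))) \<and>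
            ((\<nexists>w\<^sub>2. w\<^sub>2 \<in> parabolic A I\<^sub>2 \<and> conjugate A (longest A I\<^sub>1 \<circ> w\<^sub>2) w) \<longrightarrow>
               (qvar - 1) dvd trace_F A I\<^sub>1 f (hecke_T A w)))"
proof -
  obtain b where b: "bij_betw b {1..7} I\<^sub>1"
    "\<forall>i\<in>{1..7}. \<forall>j\<in>{1..7}. A (b i) (b j) = (if i = j then 2 else if E_edge i j then -1 else 0)"
    using assms(2) unfolding type_E_def by blast
  interpret e7_trace A I\<^sub>1 b f
  proof (unfold_locales)
    show "generalized_cartan_matrix A" using assms(1) by (simp add: kac_moody_root_datum_def)
    show "bij_betw b {1..7} I\<^sub>1" by (rule b(1))
    show "A (b i) (b j) = (if i = j then 2 else if E_edge i j then -1 else 0)"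
      if "i \<in> {1..7}" "j \<in> {1..7}" for i j using b(2) that by blast
    show "laurent_linear_on A (hecke_parabolic A (commutant A I\<^sub>1)) f" using assms(3,4) by simp
    show "\<forall>h\<in>commutator_span A (hecke_parabolic A (commutant A I\<^sub>1)). f h = 0" using assms(3,5) by simp
  qed
  have "finite (F_support A I\<^sub>1 f h)" if "h \<in> carrier (hecke A)" for h
    using that supportG_finite by (metis carrierE F_support_G)
  moreover have "trace_F A I\<^sub>1 f h = 0" if "h \<in> commutator_span A (carrier (hecke A))" for h
    using trace_F_commutator[OF that] by (rule conjunct2)
  moreover note trace_F_factors trace_F_mod
  ultimately show ?thesis
    unfolding assms(3) by (intro conjI ballI impI) assumption+
qed

end
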